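(* For each fixed integer $d\ge1$ there is a constant $C=C(d)$ such that for all sufficiently large $n$ and any choice of $d$ labeled pieces of the $n^2-1$ puzzle, there is a coupling $(X_t,Y_t)_{t\ge0}$ of the Markov chain $(\mathcal{X}_d,P_d)$ describing the empty square and the $d$ chosen pieces such that, whenever $X_0=x$ is a deterministic state in $\mathcal{X}_d$ and $Y_0$ is distributed according to the stationary distribution of $P_d$, the expected value of the first time $\tau_c=\min\{t\ge0:X_t=Y_t\}$ is at most $Cn^4\log n$.
   Context: The $n^2-1$ puzzle chain: the board is $(\mathbb{Z}/n\mathbb{Z})^2$ (an $n\times n$ board with periodic boundary conditions); $n^2-1$ labeled pieces occupy all squares but one, the remaining square being empty. At each step, independently and with probability $\frac15$ each, either nothing happens or the empty square moves right, left, up or down, i.e. it exchanges positions with the piece occupying the corresponding (cyclically) adjacent square. The chain $(\mathcal{X}_d,P_d)$ is obtained by forgetting the locations of all but the $d$ chosen labeled pieces and the empty square; its states are the $(d+1)$-tuples of distinct positions in $(\mathbb{Z}/n\mathbb{Z})^2$ of the $d$ pieces and the empty square, and its stationary distribution is uniform on $\mathcal{X}_d$. A coupling of a Markov chain $(\mathcal{X},P)$ is a Markov process $(X_t,Y_t)$ on $\mathcal{X}\times\mathcal{X}$ each of whose two marginal processes is a Markov chain with transition kernel $P$. *)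

theory Defs
  imports "HOL-Probability.Probability" "HOL-Combinatorics.Transposition"
begin

definition markov_chain ::
  "'w measure \<Rightarrow> 's set \<Rightarrow> ('s \<Rightarrow> 's pmf) \<Rightarrow> (nat \<Rightarrow> 'w \<Rightarrow> 's) \<Rightarrow> bool" where
  "markov_chain M S P X \<longleftrightarrow>
     prob_space M \<and>
     (\<forall>t. X t \<in> M \<rightarrow>\<^sub>M count_space S) \<and>
     (\<forall>t x y. \<P>(\<omega> in M. \<forall>i\<le>t. X i \<omega> = x i) > 0 \<longrightarrow>
        \<P>(\<omega> in M. X (Suc t) \<omega> = y \<bar> \<forall>i\<le>t. X i \<omega> = x i) = pmf (P (x t)) y)"

definition stationary_distribution :: "'s set \<Rightarrow> ('s \<Rightarrow> 's pmf) \<Rightarrow> 's pmf \<Rightarrow> bool" where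
  "stationary_distribution S P \<pi> \<longleftrightarrow> set_pmf \<pi> \<subseteq> S \<and> bind_pmf \<pi> P = \<pi>"

text \<open>
  A coupling is given by the transition kernel \<open>K\<close> of the pair process, so that it can be started
  from any initial distribution on \<open>S \<times> S\<close>. The sample space is fixed to the path space only
  because a definition cannot quantify over types; by \<open>markov_chain_exists\<close> below every kernel and
  every initial distribution are realised on it (for countable \<open>S\<close>).
\<close>

definition markov_coupling ::
  "'s set \<Rightarrow> ('s \<Rightarrow> 's pmf) \<Rightarrow> ('s \<times> 's \<Rightarrow> ('s \<times> 's) pmf) \<Rightarrow> bool" where
  "markov_coupling S P K \<longleftrightarrow>
     (\<forall>z\<in>S \<times> S. set_pmf (K z) \<subseteq> S \<times> S) \<and>
     (\<forall>(M :: (nat \<Rightarrow> 's \<times> 's) measure) X Y.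
        markov_chain M (S \<times> S) K (\<lambda>t \<omega>. (X t \<omega>, Y t \<omega>)) \<longrightarrow>
        markov_chain M S P X \<and> markov_chain M S P Y)"

text \<open>The value is \<open>\<infinity>\<close> if the two processes never meet.\<close>

definition coalescence_time :: "(nat \<Rightarrow> 'w \<Rightarrow> 's) \<Rightarrow> (nat \<Rightarrow> 'w \<Rightarrow> 's) \<Rightarrow> 'w \<Rightarrow> ennreal" where
  "coalescence_time X Y \<omega> = (INF t\<in>{t. X t \<omega> = Y t \<omega>}. of_nat t)"

text \<open>The square \<open>(a, b)\<close> with \<open>0 \<le> a, b < n\<close> represents a pair of residue classes modulo \<open>n\<close>.\<close>

definition board :: "nat \<Rightarrow> (int \<times> int) set" where
  "board n = {0..<int n} \<times> {0..<int n}"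

definition shift_square :: "nat \<Rightarrow> int \<times> int \<Rightarrow> int \<times> int \<Rightarrow> int \<times> int" where
  "shift_square n v p = ((fst p + fst v) mod int n, (snd p + snd v) mod int n)"

definition moves :: "(int \<times> int) set" where
  "moves = {(0, 0), (1, 0), (-1, 0), (0, 1), (0, -1)}"

text \<open>
  Label \<open>0\<close> stands for the empty square and the labels \<open>1, \<dots>, n\<^sup>2 - 1\<close> for the pieces. A state
  records the position of every label in \<open>A\<close>. The set \<open>A = {..<n\<^sup>2}\<close> yields the full puzzle, and
  \<open>A = insert 0 D\<close> yields the chain obtained by forgetting all pieces outside \<open>D\<close>; see
  \<open>forget_states\<close> and \<open>forget_puzzle_step\<close> below.
\<close>

definition puzzle_states :: "nat \<Rightarrow> nat set \<Rightarrow> (nat \<Rightarrow> int \<times> int) set" where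
  "puzzle_states n A = {s \<in> A \<rightarrow>\<^sub>E board n. inj_on s A}"

definition puzzle_move ::
  "nat \<Rightarrow> nat set \<Rightarrow> int \<times> int \<Rightarrow> (nat \<Rightarrow> int \<times> int) \<Rightarrow> nat \<Rightarrow> int \<times> int" where
  "puzzle_move n A v s = restrict (Transposition.transpose (s 0) (shift_square n v (s 0)) \<circ> s) A"

definition puzzle_step ::
  "nat \<Rightarrow> nat set \<Rightarrow> (nat \<Rightarrow> int \<times> int) \<Rightarrow> (nat \<Rightarrow> int \<times> int) pmf" where
  "puzzle_step n A s = map_pmf (\<lambda>v. puzzle_move n A v s) (pmf_of_set moves)"

lemma finite_board [simp]: "finite (board n)"
  by (simp add: board_def)

lemma card_board: "card (board n) = n\<^sup>2"
  by (simp add: board_def card_cartesian_product power2_eq_square)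

lemma shift_square_in_board: "n > 0 \<Longrightarrow> shift_square n v p \<in> board n"
  by (simp add: shift_square_def board_def)

lemma finite_puzzle_states [simp]: "finite A \<Longrightarrow> finite (puzzle_states n A)"
  unfolding puzzle_states_def
  by (rule finite_subset[of _ "A \<rightarrow>\<^sub>E board n"]) (auto intro: finite_PiE)

lemma full_puzzle_states:
  assumes "s \<in> puzzle_states n {..<n\<^sup>2}"
  shows "bij_betw s {..<n\<^sup>2} (board n)"
proof -
  have inj: "inj_on s {..<n\<^sup>2}" and PiE: "s \<in> {..<n\<^sup>2} \<rightarrow>\<^sub>E board n"
    using assms by (simp_all add: puzzle_states_def)
  from PiE have sub: "s ` {..<n\<^sup>2} \<subseteq> board n" by blast
  have "card (s ` {..<n\<^sup>2}) = card (board n)"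
    by (simp only: card_image[OF inj] card_board card_lessThan)
  then have "s ` {..<n\<^sup>2} = board n"
    by (rule card_subset_eq[OF finite_board sub])
  with inj show ?thesis by (simp add: bij_betw_def)
qed

lemma forget_states:
  assumes "B \<subseteq> {..<n\<^sup>2}"
  shows "(\<lambda>s. restrict s B) ` puzzle_states n {..<n\<^sup>2} = puzzle_states n B"
proof (intro subset_antisym subsetI)
  fix r assume "r \<in> (\<lambda>s. restrict s B) ` puzzle_states n {..<n\<^sup>2}"
  then show "r \<in> puzzle_states n B"
    using assms by (auto simp: puzzle_states_def intro: inj_on_subset)
next
  fix r assume r: "r \<in> puzzle_states n B"
  then have inj: "inj_on r B" and sub: "r ` B \<subseteq> board n" and ext: "r \<in> extensional B"
    by (auto simp: puzzle_states_def PiE_def)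
  have fin: "finite B" using assms finite_subset by blast
  have "card ({..<n\<^sup>2} - B) = card (board n - r ` B)"
    using assms sub fin by (simp add: card_Diff_subset card_board card_image[OF inj])
  then obtain g where g: "bij_betw g ({..<n\<^sup>2} - B) (board n - r ` B)"
    using bij_betw_iff_card[of "{..<n\<^sup>2} - B" "board n - r ` B"] by auto
  define s where "s = (\<lambda>i. if i \<in> B then r i else if i \<in> {..<n\<^sup>2} then g i else undefined)"
  have mem: "s i \<in> board n" if "i \<in> {..<n\<^sup>2}" for i
    using that sub g by (auto simp: s_def bij_betw_def)
  have "inj_on s {..<n\<^sup>2}"
  proof (rule inj_onI)
    fix i j assume ij: "i \<in> {..<n\<^sup>2}" "j \<in> {..<n\<^sup>2}" "s i = s j"
    have gn: "g k \<notin> r ` B" if "k \<in> {..<n\<^sup>2} - B" for k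
      using that g by (auto simp: bij_betw_def)
    have gi: "inj_on g ({..<n\<^sup>2} - B)" using g by (simp add: bij_betw_def)
    consider "i \<in> B" "j \<in> B" | "i \<in> B" "j \<notin> B" | "i \<notin> B" "j \<in> B" | "i \<notin> B" "j \<notin> B"
      by blast
    then show "i = j"
    proof cases
      case 1
      then show ?thesis using ij inj_onD[OF inj, of i j] by (simp add: s_def)
    next
      case 2
      then have "r i = g j" using ij by (simp add: s_def)
      then show ?thesis using gn[of j] ij 2 by (metis DiffI imageI)
    next
      case 3
      then have "g i = r j" using ij by (simp add: s_def)
      then show ?thesis using gn[of i] ij 3 by (metis DiffI imageI)
    next
      case 4
      then show ?thesis using ij inj_onD[OF gi, of i j] by (simp add: s_def)
    qed
  qed
  moreover have "s \<in> {..<n\<^sup>2} \<rightarrow>\<^sub>E board n"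
    using mem assms by (auto simp: PiE_def extensional_def s_def)
  ultimately have "s \<in> puzzle_states n {..<n\<^sup>2}" by (simp add: puzzle_states_def)
  moreover have "r = restrict s B"
    using ext by (auto simp: fun_eq_iff s_def restrict_def extensional_def)
  ultimately show "r \<in> (\<lambda>s. restrict s B) ` puzzle_states n {..<n\<^sup>2}" by blast
qed

lemma forget_puzzle_step:
  assumes "0 \<in> B" "B \<subseteq> A"
  shows "map_pmf (\<lambda>s. restrict s B) (puzzle_step n A s) = puzzle_step n B (restrict s B)"
proof -
  have "restrict (puzzle_move n A v s) B = puzzle_move n B v (restrict s B)" for v
    using assms by (intro ext) (auto simp: puzzle_move_def restrict_def)
  then show ?thesis by (simp add: puzzle_step_def map_pmf_comp)
qed

lemma puzzle_move_in_states:
  assumes "0 \<in> A" "s \<in> puzzle_states n A"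
  shows "puzzle_move n A v s \<in> puzzle_states n A"
proof -
  have s0: "s 0 \<in> board n" using assms by (auto simp: puzzle_states_def)
  then have "n > 0" by (auto simp: board_def)
  then have "shift_square n v (s 0) \<in> board n" by (rule shift_square_in_board)
  moreover have "inj_on s A" "\<And>i. i \<in> A \<Longrightarrow> s i \<in> board n"
    using assms by (auto simp: puzzle_states_def)
  ultimately show ?thesis
    using s0 unfolding puzzle_states_def puzzle_move_def
    by (auto simp: inj_on_def Transposition.transpose_def)
qed

lemma puzzle_move_inverse:
  assumes "0 \<in> A" "s \<in> puzzle_states n A"
  shows "puzzle_move n A (- v) (puzzle_move n A v s) = s"
proof -
  have s0: "s 0 \<in> board n" and ext: "s \<in> extensional A"
    using assms by (auto simp: puzzle_states_def PiE_def)
  have "shift_square n (- v) (shift_square n v (s 0)) = s 0"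
    using s0 by (cases "s 0") (auto simp: shift_square_def board_def mod_simps)
  then have "puzzle_move n A (- v) (puzzle_move n A v s) i = s i" if "i \<in> A" for i
    using that assms(1) by (simp add: puzzle_move_def Transposition.transpose_commute)
  moreover have "puzzle_move n A (- v) (puzzle_move n A v s) i = s i" if "i \<notin> A" for i
    using that ext by (simp add: puzzle_move_def extensional_def)
  ultimately show ?thesis by blast
qed

lemma uniform_stationary:
  assumes "0 \<in> A" "A \<subseteq> {..<n\<^sup>2}"
  shows "stationary_distribution (puzzle_states n A) (puzzle_step n A) (pmf_of_set (puzzle_states n A))"
proof -
  let ?S = "puzzle_states n A"
  have fin: "finite ?S" using finite_subset[OF assms(2)] by simp
  have "card {..<n\<^sup>2} = card (board n)" by (simp add: card_board)
  then obtain b where b: "bij_betw b {..<n\<^sup>2} (board n)"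
    using bij_betw_iff_card[of "{..<n\<^sup>2}" "board n"] by auto
  have "restrict b A \<in> ?S"
    using bij_betw_apply[OF b] inj_on_subset[OF bij_betw_imp_inj_on[OF b] assms(2)] assms(2)
    by (auto simp: puzzle_states_def)
  then have ne: "?S \<noteq> {}" by blast
  have "map_pmf (puzzle_move n A v) (pmf_of_set ?S) = pmf_of_set ?S" for v
  proof (rule map_pmf_of_set_bij_betw)
    have "puzzle_move n A v (puzzle_move n A (- v) s) = s" if "s \<in> ?S" for s
      using puzzle_move_inverse[OF assms(1) that, of "- v"] by simp
    then show "bij_betw (puzzle_move n A v) ?S ?S"
      using puzzle_move_inverse[OF assms(1), of _ n v]
      by (intro bij_betw_byWitness[where f' = "puzzle_move n A (- v)"] ballI image_subsetI
          puzzle_move_in_states[OF assms(1)])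
  qed (use fin ne in auto)
  moreover have "bind_pmf (pmf_of_set ?S) (puzzle_step n A) =
      bind_pmf (pmf_of_set moves) (\<lambda>v. map_pmf (puzzle_move n A v) (pmf_of_set ?S))"
    unfolding puzzle_step_def map_pmf_def by (rule bind_commute_pmf)
  ultimately show ?thesis
    using fin ne by (simp add: stationary_distribution_def)
qed

lemma markov_chain_exists:
  fixes K :: "'s \<Rightarrow> 's pmf"
  assumes S: "countable S" and K: "\<And>s. s \<in> S \<Longrightarrow> set_pmf (K s) \<subseteq> S" and \<mu>: "set_pmf \<mu> \<subseteq> S"
  shows "\<exists>M :: (nat \<Rightarrow> 's) measure.
    markov_chain M S K (\<lambda>t \<omega>. \<omega> t) \<and> distr M (count_space UNIV) (\<lambda>\<omega>. \<omega> 0) = measure_pmf \<mu>"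
proof -
  obtain s0 where s0: "s0 \<in> S" using \<mu> set_pmf_not_empty[of \<mu>] by blast
  define q :: "nat \<times> 's \<Rightarrow> 's pmf"
    where "q = (\<lambda>(j, s). if j = 0 then \<mu> else if s \<in> S then K s else \<mu>)"
  define c where "c = (\<lambda>v. if v \<in> S then v else s0)"
  define N where "N = PiM UNIV (\<lambda>i. measure_pmf (q i))"
  interpret product_prob_space "\<lambda>i. measure_pmf (q i)" UNIV
    by unfold_locales
  interpret N: prob_space N unfolding N_def by (rule prob_space_axioms)
  define Z where "Z = (\<lambda>\<omega>. rec_nat (c (\<omega> (0, s0))) (\<lambda>t s. c (\<omega> (Suc t, s))))"
  have Z0: "Z \<omega> 0 = c (\<omega> (0, s0))" and ZS: "Z \<omega> (Suc t) = c (\<omega> (Suc t, Z \<omega> t))" for \<omega> t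
    by (simp_all add: Z_def)
  have qS: "set_pmf (q i) \<subseteq> S" for i
    using K \<mu> by (auto simp: q_def split: prod.split)
  have cS: "c v \<in> S" for v using s0 by (simp add: c_def)
  have ZinS: "Z \<omega> t \<in> S" for \<omega> t by (cases t) (auto simp: Z0 ZS cS)
  have comp: "(\<lambda>\<omega>. c (\<omega> i)) \<in> N \<rightarrow>\<^sub>M count_space S" for i
  proof -
    have "(\<lambda>\<omega>. \<omega> i) \<in> N \<rightarrow>\<^sub>M measure_pmf (q i)"
      unfolding N_def by (rule measurable_component_singleton) simp
    moreover have "c \<in> measure_pmf (q i) \<rightarrow>\<^sub>M count_space S" by (auto intro: measurableI cS)
    ultimately show ?thesis by (rule measurable_compose)
  qed
  have Zm: "(\<lambda>\<omega>. Z \<omega> t) \<in> N \<rightarrow>\<^sub>M count_space S" for t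
  proof (induction t)
    case 0
    then show ?case using comp by (simp add: Z0)
  next
    case (Suc t)
    show ?case unfolding ZS
      by (rule measurable_compose_countable'[OF _ Suc S]) (rule comp)
  qed
  have cp: "measure (measure_pmf (q i)) (c -` {x}) = (if x \<in> S then pmf (q i) x else 0)" for i x
  proof -
    have "measure (measure_pmf (q i)) (c -` {x}) = measure (measure_pmf (q i)) (S \<inter> {x})"
      by (rule measure_pmf.finite_measure_eq_AE)
         (use qS[of i] in \<open>auto simp: AE_measure_pmf_iff c_def\<close>)
    also have "\<dots> = (if x \<in> S then pmf (q i) x else 0)" by (auto simp: measure_pmf_single)
    finally show ?thesis .
  qed
  have emb: "{\<omega> \<in> space (PiM UNIV (\<lambda>i. measure_pmf (q i))). \<forall>k\<in>J. \<omega> k \<in> B k} =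
      prod_emb UNIV (\<lambda>i. measure_pmf (q i)) J (\<Pi>\<^sub>E k\<in>J. B k)" for J B
    by (auto simp: prod_emb_def space_PiM)
  have path: "measure N {\<omega> \<in> space N. \<forall>i\<le>t. Z \<omega> i = x i} =
      (\<Prod>i\<le>t. pmf (q (i, case i of 0 \<Rightarrow> s0 | Suc j \<Rightarrow> x j)) (x i))"
    if x: "\<And>i. i \<le> t \<Longrightarrow> x i \<in> S" for t x
  proof -
    define p where "p = (\<lambda>i. case i of 0 \<Rightarrow> s0 | Suc j \<Rightarrow> x j)"
    let ?J = "(\<lambda>i. (i, p i)) ` {..t}"
    have inj: "inj_on (\<lambda>i. (i, p i)) {..t}" by (auto simp: inj_on_def)
    have "(\<forall>i\<le>t. Z \<omega> i = x i) \<longleftrightarrow> (\<forall>i\<le>t. c (\<omega> (i, p i)) = x i)" for \<omega>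
    proof (induction t)
      case 0
      then show ?case by (simp add: Z0 p_def)
    next
      case (Suc t)
      have all_le_Suc: "(\<forall>i\<le>Suc t. Q i) \<longleftrightarrow> (\<forall>i\<le>t. Q i) \<and> Q (Suc t)" for Q
        by (auto simp: le_Suc_eq)
      have "(\<forall>i\<le>Suc t. Z \<omega> i = x i) \<longleftrightarrow> (\<forall>i\<le>t. Z \<omega> i = x i) \<and> c (\<omega> (Suc t, x t)) = x (Suc t)"
        using ZS[of \<omega> t] by (auto simp: all_le_Suc)
      also have "\<dots> \<longleftrightarrow> (\<forall>i\<le>Suc t. c (\<omega> (i, p i)) = x i)"
        unfolding Suc.IH all_le_Suc by (simp add: p_def)
      finally show ?case .
    qed
    then have "{\<omega> \<in> space N. \<forall>i\<le>t. Z \<omega> i = x i} =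
        {\<omega> \<in> space N. \<forall>k\<in>?J. \<omega> k \<in> c -` {x (fst k)}}"
      by (intro Collect_cong conj_cong refl) auto
    also have "\<dots> = prod_emb UNIV (\<lambda>i. measure_pmf (q i)) ?J (\<Pi>\<^sub>E k\<in>?J. c -` {x (fst k)})"
      unfolding N_def by (rule emb)
    finally have "measure N {\<omega> \<in> space N. \<forall>i\<le>t. Z \<omega> i = x i} =
        (\<Prod>k\<in>?J. measure (measure_pmf (q k)) (c -` {x (fst k)}))"
      unfolding N_def by (simp add: measure_PiM_emb)
    also have "\<dots> = (\<Prod>i\<le>t. pmf (q (i, p i)) (x i))"
      using x by (simp add: prod.reindex[OF inj] cp)
    finally show ?thesis unfolding p_def .
  qed
  define M where "M = distr N (PiM UNIV (\<lambda>_. count_space S)) Z"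
  have Zmeas: "Z \<in> N \<rightarrow>\<^sub>M PiM UNIV (\<lambda>_. count_space S)"
    by (rule measurable_PiM_single') (auto simp: Zm ZinS)
  have Mp: "prob_space M" unfolding M_def by (rule N.prob_space_distr) (rule Zmeas)
  have coord: "(\<lambda>\<omega>. \<omega> t) \<in> M \<rightarrow>\<^sub>M count_space S" for t
    unfolding M_def measurable_distr_eq1 by (rule measurable_component_singleton) simp
  have coordU: "(\<lambda>\<omega>. \<omega> t) \<in> M \<rightarrow>\<^sub>M count_space UNIV" for t
    by (rule measurable_compose[OF coord]) simp
  have Msets: "{\<omega> \<in> space M. \<forall>i\<le>t. \<omega> i = x i} \<in> sets M" for t x
  proof -
    have "{\<omega> \<in> space M. \<omega> i = x i} \<in> sets M" for i
    proof -
      have "{\<omega> \<in> space M. \<omega> i = x i} = (\<lambda>\<omega>. \<omega> i) -` {x i} \<inter> space M" by auto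
      then show ?thesis using measurable_sets[OF coordU, of "{x i}" i] by simp
    qed
    then have "{\<omega> \<in> space M. \<forall>i\<in>{..t}. \<omega> i = x i} \<in> sets M"
      by (intro sets.sets_Collect_finite_All finite_atMost)
    then show ?thesis by (simp only: Ball_def atMost_iff)
  qed
  have M_N: "measure M {\<omega> \<in> space M. \<forall>i\<le>t. \<omega> i = x i} =
      measure N {\<omega> \<in> space N. \<forall>i\<le>t. Z \<omega> i = x i}" for t x
  proof -
    have "measure M {\<omega> \<in> space M. \<forall>i\<le>t. \<omega> i = x i} =
        measure N (Z -` {\<omega> \<in> space M. \<forall>i\<le>t. \<omega> i = x i} \<inter> space N)"
      using Msets[of t x] unfolding M_def by (intro measure_distr Zmeas) (simp only: sets_distr)
    also have "Z -` {\<omega> \<in> space M. \<forall>i\<le>t. \<omega> i = x i} \<inter> space N = {\<omega> \<in> space N. \<forall>i\<le>t. Z \<omega> i = x i}"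
      using measurable_space[OF Zmeas] by (auto simp: M_def)
    finally show ?thesis .
  qed
  have step: "\<P>(\<omega> in M. \<omega> (Suc t) = y \<bar> \<forall>i\<le>t. \<omega> i = x i) = pmf (K (x t)) y"
    if pos: "\<P>(\<omega> in M. \<forall>i\<le>t. \<omega> i = x i) > 0" for t x y
  proof -
    have "{\<omega> \<in> space M. \<forall>i\<le>t. \<omega> i = x i} \<noteq> {}" using pos by force
    then obtain \<omega> where \<omega>: "\<omega> \<in> space M" "\<forall>i\<le>t. \<omega> i = x i" by blast
    have x: "x i \<in> S" if "i \<le> t" for i
      using measurable_space[OF coord \<omega>(1), of i] \<omega>(2) that by simp
    define x' where "x' = x(Suc t := y)"
    have eq: "(\<omega> (Suc t) = y \<and> (\<forall>i\<le>t. \<omega> i = x i)) \<longleftrightarrow> (\<forall>i\<le>Suc t. \<omega> i = x' i)" for \<omega>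
      by (auto simp: x'_def le_Suc_eq)
    show ?thesis
    proof (cases "y \<in> S")
      case True
      have x'S: "x' i \<in> S" if "i \<le> Suc t" for i using that True x by (auto simp: x'_def le_Suc_eq)
      have "(\<Prod>i\<le>t. pmf (q (i, case i of 0 \<Rightarrow> s0 | Suc j \<Rightarrow> x' j)) (x' i)) =
          (\<Prod>i\<le>t. pmf (q (i, case i of 0 \<Rightarrow> s0 | Suc j \<Rightarrow> x j)) (x i))"
        by (intro prod.cong refl) (auto simp: x'_def split: nat.split)
      then have "\<P>(\<omega> in M. \<forall>i\<le>Suc t. \<omega> i = x' i) =
          \<P>(\<omega> in M. \<forall>i\<le>t. \<omega> i = x i) * pmf (K (x t)) y"
        using x by (simp add: M_N path[of "Suc t" x', OF x'S] path[of t x, OF x])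
          (simp add: x'_def q_def)
      then show ?thesis using pos by (simp add: cond_prob_def eq)
    next
      case False
      have "{\<omega> \<in> space M. \<forall>i\<le>Suc t. \<omega> i = x' i} = {}"
        using False measurable_space[OF coord, of _ "Suc t"] by (force simp: x'_def)
      then have "\<P>(\<omega> in M. \<forall>i\<le>Suc t. \<omega> i = x' i) = 0" by (simp only: measure_empty)
      moreover have "pmf (K (x t)) y = 0"
        using False K[OF x[of t]] by (auto simp: pmf_eq_0_set_pmf)
      ultimately show ?thesis by (simp add: cond_prob_def eq)
    qed
  qed
  have "distr M (count_space UNIV) (\<lambda>\<omega>. \<omega> 0) = distr N (count_space UNIV) (\<lambda>\<omega>. c (\<omega> (0, s0)))"
    unfolding M_def
    by (subst distr_distr) (use coordU Zmeas in \<open>auto simp: M_def comp_def Z0 measurable_distr_eq1\<close>)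
  also have "\<dots> = distr (distr N (measure_pmf (q (0, s0))) (\<lambda>\<omega>. \<omega> (0, s0))) (count_space UNIV) c"
    unfolding N_def
    by (subst distr_distr) (auto simp: comp_def intro!: measurable_component_singleton)
  also have "distr N (measure_pmf (q (0, s0))) (\<lambda>\<omega>. \<omega> (0, s0)) = measure_pmf (q (0, s0))"
    unfolding N_def by (rule PiM_component) simp
  also have "distr (measure_pmf (q (0, s0))) (count_space UNIV) c = measure_pmf (map_pmf c \<mu>)"
    by (simp add: map_pmf_rep_eq q_def)
  also have "map_pmf c \<mu> = \<mu>"
    using \<mu> by (intro map_pmf_idI) (auto simp: c_def)
  finally show ?thesis using Mp coord step unfolding markov_chain_def by blast
qed

end

theory Submission
  imports Defs
begin

text \<open>
  Two moves of a pair of configurations are used: both empty squares make the same step, or they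
  step independently. Let \<open>V\<^sub>k\<close> be the smallest expected value of \<open>min \<tau> k\<close> when one may choose between
  these two at every step. Since \<open>V\<^sub>k\<close> is a minimum, it can be estimated with strategies that have
  memory, while the limit of the \<open>V\<^sub>k\<close> still yields a coupling kernel that depends on the current pair only.

  The strategy is as follows. First let the empty squares step independently until they meet. Then let
  them step together, which keeps matched pieces matched, until the empty square and the two positions
  of some unmatched piece form a fixed pattern inside a \<open>2 \<times> 2\<close> block. Once the fourth square of the block
  contains no matched piece (a bounded number of common moves around a strip achieves this), rotating
  the block in one configuration matches the piece and disturbs no matched one. This takes boundedly many
  steps, hence succeeds with probability bounded below, and \<open>d\<close> successes in a row suffice.

  The time to reach the pattern is bounded by \<open>C n\<^sup>4 log n\<close> as follows. Relative to one piece, the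
  positions of the empty square and of the other piece form a chain on at most \<open>n\<^sup>4\<close> states which is driven
  by uniformly chosen bijections, so the Dirichlet energy of its expected hitting time \<open>h\<close> is at most a
  constant times the sum of \<open>h\<close>. With the empty square next to the piece, \<open>h\<close> becomes a function of the
  displacement of the other piece, i.e. a function on a two-dimensional torus with comparable energy \<open>E\<close>, and
  such a function oscillates by at most a constant times \<open>sqrt (E log n)\<close>. Hence
  \<open>(max h)\<^sup>2 \<le> C log n \<cdot> n\<^sup>4 \<cdot> max h\<close>.
\<close>

section \<open>Oscillation of functions on the discrete torus\<close>

text \<open>Summation by parts. It resolves the gap between the last value of a row and the average
  of the others into differences along the row, with the weights (up to normalisation) of the
  horizontal flow in the wedge below.\<close>

lemma sum_Suc_times_diff:
  fixes b :: "nat \<Rightarrow> real"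
  shows "(\<Sum>j\<le>r. real (Suc j) * (b (Suc j) - b j)) = real (Suc r) * b (Suc r) - (\<Sum>j\<le>r. b j)"
  by (induction r) (simp_all add: algebra_simps)

lemma square_sum_le:
  fixes f :: "'a \<Rightarrow> real"
  shows "(\<Sum>i\<in>A. f i)\<^sup>2 \<le> real (card A) * (\<Sum>i\<in>A. (f i)\<^sup>2)"
  using Cauchy_Schwarz_ineq_sum[of "\<lambda>_. 1" f A] by simp

lemma harmonic_sum_le:
  assumes "m \<ge> 1"
  shows "(\<Sum>r<m. 1 / real (Suc r)) \<le> 1 + ln (real m)"
  using assms
proof (induction m rule: nat_induct_at_least)
  case base
  then show ?case by simp
next
  case (Suc m)
  have "ln (real m / real (Suc m)) \<le> real m / real (Suc m) - 1"
    using Suc by (intro ln_le_minus_one) auto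
  then have "1 / real (Suc m) \<le> ln (real (Suc m)) - ln (real m)"
    using Suc by (simp add: ln_div field_simps)
  then show ?case using Suc by simp
qed

text \<open>Passing from a row of the wedge to the longer next row costs vertical differences plus a
  correction for the extra entry; the correction isolated here is the one that
  \<open>sum_Suc_times_diff\<close> resolves.\<close>

lemma average_step:
  fixes r S b :: real
  assumes "r \<ge> 0"
  shows "(S + b) / (r + 2) = S / (r + 1) + ((r + 1) * b - S) / ((r + 1) * (r + 2))"
proof -
  have nz: "r + 1 \<noteq> 0" "r + 2 \<noteq> 0" using assms by auto
  have "S / (r + 1) + ((r + 1) * b - S) / ((r + 1) * (r + 2))
      = (S * (r + 2) + ((r + 1) * b - S)) / ((r + 1) * (r + 2))"
    using nz by (simp add: add_divide_distrib)
  also have "S * (r + 2) + ((r + 1) * b - S) = (r + 1) * (S + b)" by algebra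
  finally show ?thesis using nz by simp
qed

text \<open>
  The unit flow that leaves the corner of the wedge \<open>{(r, j). j \<le> r}\<close> and is uniform on every row
  carries at most \<open>1 / (r + 1)\<close> over each edge of row \<open>r\<close>, so its energy is a harmonic sum.
\<close>

lemma wedge_bound:
  fixes g :: "nat \<Rightarrow> nat \<Rightarrow> real"
  assumes "m \<ge> 1"
  shows "(g 0 0 - (\<Sum>j\<le>m. g m j) / real (Suc m))\<^sup>2 \<le>
    2 * (1 + ln (real m)) *
      (\<Sum>r<m. \<Sum>j\<le>r. (g (Suc r) j - g r j)\<^sup>2 + (g (Suc r) (Suc j) - g (Suc r) j)\<^sup>2)"
proof -
  define A where "A r = (\<Sum>j\<le>r. g r j) / real (Suc r)" for r
  define e where "e r = (\<Sum>j\<le>r. (g (Suc r) j - g r j)\<^sup>2 + (g (Suc r) (Suc j) - g (Suc r) j)\<^sup>2)" for r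
  have e0: "e r \<ge> 0" for r unfolding e_def by (intro sum_nonneg) simp
  have step: "\<bar>A (Suc r) - A r\<bar> \<le> sqrt (2 / real (Suc r)) * sqrt (e r)" for r
  proof -
    let ?b = "g (Suc r)"
    let ?S = "\<Sum>j\<le>r. ?b j"
    have "(\<Sum>j\<le>r. real (Suc j) / (real (Suc r) * real (Suc (Suc r))) * (?b (Suc j) - ?b j))
        = (real (Suc r) * ?b (Suc r) - ?S) / (real (Suc r) * real (Suc (Suc r)))"
      unfolding sum_Suc_times_diff[symmetric] sum_divide_distrib by (intro sum.cong) auto
    note * = this
    \<comment> \<open>The flow from row \<open>r\<close> to row \<open>r + 1\<close>: each vertical
      edge carries \<open>1 / (r + 1)\<close>, and the horizontal edge after position
      \<open>j\<close> carries \<open>(j + 1) / ((r + 1) * (r + 2))\<close>, so that the longer row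
      is uniform again.\<close>
    have eq: "A (Suc r) - A r = (\<Sum>j\<le>r. (?b j - g r j) / real (Suc r)
        + real (Suc j) / (real (Suc r) * real (Suc (Suc r))) * (?b (Suc j) - ?b j))"
    proof -
      have sr: "real (Suc r) = real r + 1" "real (Suc (Suc r)) = real r + 2" by simp_all
      have 1: "A (Suc r) = (?S + ?b (Suc r)) / (real r + 2)" by (simp add: A_def add.commute)
      have 2: "A r = (\<Sum>j\<le>r. g r j) / (real r + 1)" by (simp add: A_def add.commute)
      have 3: "(\<Sum>j\<le>r. (?b j - g r j) / real (Suc r)) = ?S / (real r + 1) - (\<Sum>j\<le>r. g r j) / (real r + 1)"
        by (simp only: sum_divide_distrib[symmetric] sum_subtractf diff_divide_distrib sr)
      show ?thesis
        unfolding sum.distrib * 1 2 3 unfolding sr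
        using average_step[of "real r" ?S "?b (Suc r)"] by linarith
    qed
    have "\<bar>A (Suc r) - A r\<bar> \<le> (\<Sum>j\<le>r. \<bar>?b j - g r j\<bar> / real (Suc r)
        + \<bar>?b (Suc j) - ?b j\<bar> / real (Suc r))"
      unfolding eq
    proof (rule order_trans[OF sum_abs], rule sum_mono)
      fix j assume "j \<in> {..r}"
      then have "real (Suc j) / (real (Suc r) * real (Suc (Suc r))) \<le> 1 / real (Suc r)"
        by (simp add: divide_simps del: of_nat_Suc)
      then have "\<bar>real (Suc j) / (real (Suc r) * real (Suc (Suc r))) * (?b (Suc j) - ?b j)\<bar>
          \<le> 1 / real (Suc r) * \<bar>?b (Suc j) - ?b j\<bar>"
        unfolding abs_mult by (intro mult_right_mono) auto
      then show "\<bar>(?b j - g r j) / real (Suc r)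
        + real (Suc j) / (real (Suc r) * real (Suc (Suc r))) * (?b (Suc j) - ?b j)\<bar>
        \<le> \<bar>?b j - g r j\<bar> / real (Suc r) + \<bar>?b (Suc j) - ?b j\<bar> / real (Suc r)"
        by (intro order_trans[OF abs_triangle_ineq] add_mono) (simp_all add: abs_divide)
    qed
    also have "\<dots> = (\<Sum>j\<le>r. \<bar>?b j - g r j\<bar> + \<bar>?b (Suc j) - ?b j\<bar>) / real (Suc r)"
      by (simp add: sum_divide_distrib add_divide_distrib)
    finally have le: "\<bar>A (Suc r) - A r\<bar> \<le> (\<Sum>j\<le>r. \<bar>?b j - g r j\<bar> + \<bar>?b (Suc j) - ?b j\<bar>) / real (Suc r)" .
    have "(\<Sum>j\<le>r. \<bar>?b j - g r j\<bar> + \<bar>?b (Suc j) - ?b j\<bar>)\<^sup>2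
        \<le> real (Suc r) * (\<Sum>j\<le>r. (\<bar>?b j - g r j\<bar> + \<bar>?b (Suc j) - ?b j\<bar>)\<^sup>2)"
      using square_sum_le[of "\<lambda>j. \<bar>?b j - g r j\<bar> + \<bar>?b (Suc j) - ?b j\<bar>" "{..r}"] by simp
    also have "\<dots> \<le> real (Suc r) * (2 * e r)"
      unfolding e_def sum_distrib_left
    proof (intro mult_left_mono sum_mono)
      fix j
      show "(\<bar>?b j - g r j\<bar> + \<bar>?b (Suc j) - ?b j\<bar>)\<^sup>2 \<le> 2 * ((?b j - g r j)\<^sup>2 + (?b (Suc j) - ?b j)\<^sup>2)"
        using sum_squares_bound[of "\<bar>?b j - g r j\<bar>" "\<bar>?b (Suc j) - ?b j\<bar>"] by (simp add: power2_sum)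
    qed simp
    finally have sq: "(\<Sum>j\<le>r. \<bar>?b j - g r j\<bar> + \<bar>?b (Suc j) - ?b j\<bar>)\<^sup>2 \<le> real (Suc r) * (2 * e r)" .
    have "\<bar>A (Suc r) - A r\<bar>\<^sup>2 \<le> ((\<Sum>j\<le>r. \<bar>?b j - g r j\<bar> + \<bar>?b (Suc j) - ?b j\<bar>) / real (Suc r))\<^sup>2"
      using le by (intro power_mono) auto
    also have "\<dots> \<le> real (Suc r) * (2 * e r) / (real (Suc r))\<^sup>2"
      unfolding power_divide by (intro divide_right_mono sq) auto
    also have "\<dots> = 2 / real (Suc r) * e r" by (simp add: power2_eq_square)
    finally have "\<bar>A (Suc r) - A r\<bar> \<le> sqrt (2 / real (Suc r) * e r)"
      by (rule real_le_rsqrt)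
    then show ?thesis by (simp only: real_sqrt_mult)
  qed
  have "\<bar>A 0 - A m\<bar> \<le> (\<Sum>r<m. \<bar>A (Suc r) - A r\<bar>)"
  proof -
    have "A 0 - A m = - (\<Sum>r<m. A (Suc r) - A r)" by (simp add: sum_lessThan_telescope)
    then show ?thesis by (simp add: sum_abs)
  qed
  also have "\<dots> \<le> (\<Sum>r<m. sqrt (2 / real (Suc r)) * sqrt (e r))" by (intro sum_mono step)
  finally have "(A 0 - A m)\<^sup>2 \<le> (\<Sum>r<m. sqrt (2 / real (Suc r)) * sqrt (e r))\<^sup>2"
    by (simp add: abs_le_square_iff[symmetric])
  \<comment> \<open>Cauchy-Schwarz over the rows separates the weights \<open>2 / (r + 1)\<close>,
    whose sum is harmonic, from the energies \<open>e r\<close>.\<close>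
  also have "\<dots> \<le> (\<Sum>r<m. (sqrt (2 / real (Suc r)))\<^sup>2) * (\<Sum>r<m. (sqrt (e r))\<^sup>2)"
    by (rule Cauchy_Schwarz_ineq_sum)
  also have "\<dots> = 2 * (\<Sum>r<m. 1 / real (Suc r)) * (\<Sum>r<m. e r)"
    using e0 by (simp add: sum_distrib_left del: of_nat_Suc)
  also have "\<dots> \<le> 2 * (1 + ln (real m)) * (\<Sum>r<m. e r)"
    using harmonic_sum_le[OF assms] e0 by (intro mult_right_mono sum_nonneg) auto
  finally show ?thesis by (simp add: A_def e_def)
qed

lemma sum_periodic_shift:
  fixes f :: "int \<Rightarrow> 'a::comm_monoid_add"
  assumes "n > 0" and per: "\<And>i. f (i + n) = f i"
  shows "(\<Sum>i\<in>{0..<n}. f (i + c)) = (\<Sum>i\<in>{0..<n}. f i)"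
proof -
  have fm: "f (i mod n) = f i" for i
  proof -
    have k: "f (i + int m * n) = f i" for i m
    proof (induction m)
      case (Suc m)
      then show ?case using per[of "i + int m * n"] by (simp add: algebra_simps)
    qed simp
    have "f (i + q * n) = f i" for q i
    proof (cases "q \<ge> 0")
      case True
      then show ?thesis using k[of i "nat q"] by simp
    next
      case False
      then show ?thesis using k[of "i + q * n" "nat (- q)"] by simp
    qed
    from this[of "i mod n" "i div n"] show ?thesis by simp
  qed
  have "(\<Sum>i\<in>{0..<n}. f (i + c)) = (\<Sum>i\<in>{0..<n}. f ((i + c) mod n))" by (simp add: fm)
  also have "\<dots> = (\<Sum>i\<in>{0..<n}. f i)"
    using assms(1)
    by (intro sum.reindex_bij_witness[of _ "\<lambda>i. (i - c) mod n" "\<lambda>i. (i + c) mod n"])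
      (auto simp: mod_simps)
  finally show ?thesis .
qed

text \<open>Functions on the torus are represented as doubly periodic functions of two integers, so
  that wedges and paths can be drawn without reducing coordinates.\<close>

definition torus_energy :: "int \<Rightarrow> (int \<Rightarrow> int \<Rightarrow> real) \<Rightarrow> real" where
  "torus_energy n f = (\<Sum>i\<in>{0..<n}. \<Sum>j\<in>{0..<n}. (f (i + 1) j - f i j)\<^sup>2 + (f i (j + 1) - f i j)\<^sup>2)"

lemma torus_energy_nonneg: "torus_energy n f \<ge> 0"
  unfolding torus_energy_def by (intro sum_nonneg) simp

lemma torus_energy_shift:
  assumes "n > 0" and per: "\<And>i j. f (i + n) j = f i j" "\<And>i j. f i (j + n) = f i j"
  shows "torus_energy n (\<lambda>i j. f (i + a) (j + b)) = torus_energy n f"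
proof -
  define F where "F i j = (f (i + 1) j - f i j)\<^sup>2 + (f i (j + 1) - f i j)\<^sup>2" for i j
  have "f (i + n + 1) j = f (i + 1) j" "f i (j + n + 1) = f i (j + 1)" for i j
    using per(1)[of "i + 1" j] per(2)[of i "j + 1"] by (simp_all add: algebra_simps)
  then have F: "F (i + n) j = F i j" "F i (j + n) = F i j" for i j
    by (simp_all add: F_def per)
  have "torus_energy n (\<lambda>i j. f (i + a) (j + b)) = (\<Sum>i\<in>{0..<n}. \<Sum>j\<in>{0..<n}. F (i + a) (j + b))"
    by (simp add: torus_energy_def F_def algebra_simps)
  also have "\<dots> = (\<Sum>i\<in>{0..<n}. \<Sum>j\<in>{0..<n}. F (i + a) j)"
    by (intro sum.cong refl sum_periodic_shift assms(1) F)
  also have "\<dots> = (\<Sum>i\<in>{0..<n}. \<Sum>j\<in>{0..<n}. F i j)"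
    by (rule sum_periodic_shift[where f = "\<lambda>i. \<Sum>j\<in>{0..<n}. F i j"]) (simp_all add: assms(1) F)
  finally show ?thesis by (simp add: torus_energy_def F_def)
qed

lemma sum_int_nat: "(\<Sum>i\<in>{0..<int n}. f i) = (\<Sum>i<n. f (int i))"
proof -
  have "{0..<int n} = int ` {..<n}" by (simp add: lessThan_atLeast0 image_int_atLeastLessThan)
  then show ?thesis by (simp add: sum.reindex)
qed

text \<open>Place the tip of a wedge of height \<open>n - 1\<close> at \<open>(a, b)\<close>. Its
  last row has exactly \<open>n\<close> points and wraps once around the line with first coordinate
  \<open>a - 1\<close>. Its edges are distinct edges of the torus, so the wedge energy is at most
  the total one.\<close>

lemma point_column_average:
  assumes "n \<ge> 2" and per: "\<And>i j. f (i + int n) j = f i j" "\<And>i j. f i (j + int n) = f i j"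
  shows "(f a b - (\<Sum>j\<in>{0..<int n}. f (a - 1) j) / n)\<^sup>2 \<le> 2 * (1 + ln (real n)) * torus_energy n f"
proof -
  obtain m where n: "n = Suc m" and m: "m \<ge> 1" using assms(1) by (cases n) auto
  define g where "g r j = f (a + int r) (b + int j)" for r j
  have "f (a - 1) j = f (a + int m) j" for j
    using per(1)[of "a - 1" j] by (simp add: n)
  then have "(\<Sum>j\<in>{0..<int n}. f (a - 1) j) = (\<Sum>j\<in>{0..<int n}. f (a + int m) (j + b))"
    using sum_periodic_shift[of "int n" "\<lambda>j. f (a + int m) j" b] per(2) assms(1) by simp
  also have "\<dots> = (\<Sum>j\<le>m. g m j)"
    unfolding sum_int_nat by (simp add: g_def n lessThan_Suc_atMost add.commute)
  finally have avg: "(\<Sum>j\<in>{0..<int n}. f (a - 1) j) = (\<Sum>j\<le>m. g m j)" .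
  have "torus_energy n f = torus_energy n (\<lambda>i j. f (i + a) (j + b))"
    using assms by (simp add: torus_energy_shift)
  also have "\<dots> = (\<Sum>r<n. \<Sum>j<n. (g (Suc r) j - g r j)\<^sup>2 + (g r (Suc j) - g r j)\<^sup>2)"
    by (simp add: torus_energy_def sum_int_nat g_def algebra_simps)
  finally have E: "torus_energy n f = \<dots>" .
  have "(\<Sum>r<m. \<Sum>j\<le>r. (g (Suc r) j - g r j)\<^sup>2 + (g (Suc r) (Suc j) - g (Suc r) j)\<^sup>2)
      \<le> (\<Sum>r<m. \<Sum>j<n. (g (Suc r) j - g r j)\<^sup>2 + (g (Suc r) (Suc j) - g (Suc r) j)\<^sup>2)"
    by (intro sum_mono sum_mono2) (auto simp: n)
  also have "\<dots> = (\<Sum>r<m. \<Sum>j<n. (g (Suc r) j - g r j)\<^sup>2) + (\<Sum>r<m. \<Sum>j<n. (g (Suc r) (Suc j) - g (Suc r) j)\<^sup>2)"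
    by (simp add: sum.distrib)
  \<comment> \<open>The vertical terms are a partial sum of the torus energy; the horizontal ones
    live on the rows \<open>1\<close> to \<open>m\<close>, that is on all rows below
    \<open>n\<close> except row \<open>0\<close>.\<close>
  also have "\<dots> \<le> (\<Sum>r<n. \<Sum>j<n. (g (Suc r) j - g r j)\<^sup>2) + (\<Sum>r<n. \<Sum>j<n. (g r (Suc j) - g r j)\<^sup>2)"
  proof (intro add_mono)
    show "(\<Sum>r<m. \<Sum>j<n. (g (Suc r) j - g r j)\<^sup>2) \<le> (\<Sum>r<n. \<Sum>j<n. (g (Suc r) j - g r j)\<^sup>2)"
      by (intro sum_mono2) (auto simp: n intro!: sum_nonneg add_nonneg_nonneg)
    show "(\<Sum>r<m. \<Sum>j<n. (g (Suc r) (Suc j) - g (Suc r) j)\<^sup>2) \<le> (\<Sum>r<n. \<Sum>j<n. (g r (Suc j) - g r j)\<^sup>2)"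
      unfolding n sum.lessThan_Suc_shift[of _ m] comp_def
      by (auto simp: sum.lessThan_Suc_shift[of "\<lambda>i. \<Sum>j<Suc m. _ i j"] intro!: sum_nonneg add_nonneg_nonneg)
  qed
  also have "\<dots> = torus_energy n f" by (simp add: E sum.distrib)
  finally have le: "(\<Sum>r<m. \<Sum>j\<le>r. (g (Suc r) j - g r j)\<^sup>2 + (g (Suc r) (Suc j) - g (Suc r) j)\<^sup>2) \<le> torus_energy n f" .
  have "(f a b - (\<Sum>j\<in>{0..<int n}. f (a - 1) j) / n)\<^sup>2 = (g 0 0 - (\<Sum>j\<le>m. g m j) / real (Suc m))\<^sup>2"
    unfolding avg by (simp add: g_def n)
  also have "\<dots> \<le> 2 * (1 + ln (real m)) * (\<Sum>r<m. \<Sum>j\<le>r. (g (Suc r) j - g r j)\<^sup>2 + (g (Suc r) (Suc j) - g (Suc r) j)\<^sup>2)"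
    by (rule wedge_bound[OF m])
  also have "\<dots> \<le> 2 * (1 + ln (real n)) * torus_energy n f"
    using m le by (intro mult_mono) (auto simp: n intro!: sum_nonneg)
  finally show ?thesis .
qed

text \<open>Sum the increments of the column averages along fewer than \<open>n\<close> steps.
  Cauchy-Schwarz along the path costs a factor \<open>n\<close>, Cauchy-Schwarz inside each average
  gains \<open>1 / n\<close>, and the two cancel, so no logarithm appears.\<close>

lemma column_average_diff:
  assumes "n \<ge> 1" and per: "\<And>i j. f (i + int n) j = f i j" "\<And>i j. f i (j + int n) = f i j"
  shows "((\<Sum>j\<in>{0..<int n}. f a j) / n - (\<Sum>j\<in>{0..<int n}. f b j) / n)\<^sup>2 \<le> torus_energy n f"
proof -
  define c where "c i = (\<Sum>j\<in>{0..<int n}. f i j) / n" for i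
  have cper: "c (i + int n) = c i" for i by (simp add: c_def per)
  define k where "k = nat ((b - a) mod int n)"
  have k: "k < n" using assms(1) by (simp add: k_def nat_less_iff)
  have "c b = c (a + int k)"
  proof -
    have kk: "c (i + int m * int n) = c i" for i m
    proof (induction m)
      case (Suc m)
      then show ?case using cper[of "i + int m * int n"] by (simp add: algebra_simps)
    qed simp
    have ek: "int k = (b - a) - (b - a) div int n * int n"
      using assms(1) by (simp add: k_def minus_div_mult_eq_mod)
    show ?thesis
    proof (cases "(b - a) div int n \<ge> 0")
      case True
      then show ?thesis using kk[of "a + int k" "nat ((b - a) div int n)"] ek by simp
    next
      case False
      then show ?thesis using kk[of b "nat (- ((b - a) div int n))"] ek by simp
    qed
  qed
  also have "\<dots> = c a + (\<Sum>i<k. c (a + int (Suc i)) - c (a + int i))"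
    using sum_lessThan_telescope[of "\<lambda>i. c (a + int i)" k] by simp
  finally have "(c a - c b)\<^sup>2 = (\<Sum>i<k. c (a + int (Suc i)) - c (a + int i))\<^sup>2"
    by (simp add: power2_commute)
  also have "\<dots> \<le> real k * (\<Sum>i<k. (c (a + int (Suc i)) - c (a + int i))\<^sup>2)"
    using square_sum_le[of _ "{..<k}"] by simp
  also have "\<dots> \<le> real n * (\<Sum>i<n. (c (a + int (Suc i)) - c (a + int i))\<^sup>2)"
    using k by (intro mult_mono sum_mono2 sum_nonneg) auto
  also have "\<dots> \<le> real n * (\<Sum>i<n. (\<Sum>j\<in>{0..<int n}. (f (a + int (Suc i)) j - f (a + int i) j)\<^sup>2) / n)"
  proof (intro mult_left_mono sum_mono)
    fix i
    have "(c (a + int (Suc i)) - c (a + int i))\<^sup>2 = (\<Sum>j\<in>{0..<int n}. f (a + int (Suc i)) j - f (a + int i) j)\<^sup>2 / (real n)\<^sup>2"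
      by (simp add: c_def diff_divide_distrib[symmetric] sum_subtractf power_divide)
    also have "\<dots> \<le> (real n * (\<Sum>j\<in>{0..<int n}. (f (a + int (Suc i)) j - f (a + int i) j)\<^sup>2)) / (real n)\<^sup>2"
      using square_sum_le[of "\<lambda>j. f (a + int (Suc i)) j - f (a + int i) j" "{0..<int n}"]
      by (intro divide_right_mono) auto
    finally show "(c (a + int (Suc i)) - c (a + int i))\<^sup>2 \<le> (\<Sum>j\<in>{0..<int n}. (f (a + int (Suc i)) j - f (a + int i) j)\<^sup>2) / n"
      using assms(1) by (simp add: power2_eq_square)
  qed simp
  also have "\<dots> = (\<Sum>i<n. \<Sum>j\<in>{0..<int n}. (f (a + int (Suc i)) j - f (a + int i) j)\<^sup>2)"
    using assms(1) by (simp add: sum_divide_distrib[symmetric])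
  also have "\<dots> = (\<Sum>i\<in>{0..<int n}. \<Sum>j\<in>{0..<int n}. (f (i + a + 1) j - f (i + a) j)\<^sup>2)"
    by (simp add: sum_int_nat algebra_simps)
  also have "\<dots> \<le> torus_energy n (\<lambda>i j. f (i + a) (j + 0))"
    unfolding torus_energy_def by (intro sum_mono) (simp add: algebra_simps)
  also have "\<dots> = torus_energy n f"
    using assms by (intro torus_energy_shift) auto
  finally show ?thesis by (simp add: c_def)
qed

text \<open>Route the difference through the averages of two columns. The constant is
  \<open>3 * (2 + 1 + 2)\<close>: three squared summands, with \<open>1 \<le> 1 + ln n\<close>
  absorbing the middle one.\<close>

lemma torus_oscillation:
  assumes "n \<ge> 2" and per: "\<And>i j. f (i + int n) j = f i j" "\<And>i j. f i (j + int n) = f i j"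
  shows "(f a b - f a' b')\<^sup>2 \<le> 15 * (1 + ln (real n)) * torus_energy n f"
proof -
  let ?c = "\<lambda>i. (\<Sum>j\<in>{0..<int n}. f i j) / n"
  let ?L = "1 + ln (real n)"
  let ?E = "torus_energy n f"
  have L: "?L \<ge> 1" using assms(1) by simp
  have sq: "(x + y + z)\<^sup>2 \<le> 3 * (x\<^sup>2 + y\<^sup>2 + z\<^sup>2)" for x y z :: real
    using sum_squares_bound[of x y] sum_squares_bound[of y z] sum_squares_bound[of x z]
    by (simp add: power2_eq_square algebra_simps)
  have "(f a b - f a' b')\<^sup>2 = ((f a b - ?c (a - 1)) + (?c (a - 1) - ?c (a' - 1)) + (?c (a' - 1) - f a' b'))\<^sup>2"
    by simp
  also have "\<dots> \<le> 3 * ((f a b - ?c (a - 1))\<^sup>2 + (?c (a - 1) - ?c (a' - 1))\<^sup>2 + (?c (a' - 1) - f a' b')\<^sup>2)"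
    by (rule sq)
  also have "\<dots> \<le> 3 * (2 * ?L * ?E + ?E + 2 * ?L * ?E)"
  proof (intro mult_left_mono add_mono)
    show "(f a b - ?c (a - 1))\<^sup>2 \<le> 2 * ?L * ?E"
      using point_column_average[of n f a b] assms by simp
    show "(?c (a - 1) - ?c (a' - 1))\<^sup>2 \<le> ?E"
      using assms(1) by (intro column_average_diff per) simp
    show "(?c (a' - 1) - f a' b')\<^sup>2 \<le> 2 * ?L * ?E"
      using point_column_average[of n f a' b'] assms by (simp add: power2_commute)
  qed simp
  also have "\<dots> \<le> 15 * ?L * ?E"
    using mult_right_mono[OF L torus_energy_nonneg[of n f]] by (simp add: algebra_simps)
  finally show ?thesis .
qed

section \<open>Truncated hitting times\<close>

text \<open>The expectation of \<open>min \<tau> k\<close>, where \<open>\<tau>\<close> is the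
  hitting time of \<open>A\<close> by the chain that applies \<open>T w\<close> with
  \<open>w\<close> uniform in \<open>W\<close>. Truncation makes every quantity finite before any
  bound is known.\<close>

primrec trunc_time :: "'w set \<Rightarrow> ('w \<Rightarrow> 'z \<Rightarrow> 'z) \<Rightarrow> 'z set \<Rightarrow> nat \<Rightarrow> 'z \<Rightarrow> real" where
  "trunc_time W T A 0 z = 0"
| "trunc_time W T A (Suc k) z =
    (if z \<in> A then 0 else 1 + (\<Sum>w\<in>W. trunc_time W T A k (T w z)) / card W)"

lemma trunc_time_nonneg: "trunc_time W T A k z \<ge> 0"
  by (induction k arbitrary: z) (auto intro!: add_nonneg_nonneg divide_nonneg_nonneg sum_nonneg)

lemma trunc_time_target: "z \<in> A \<Longrightarrow> trunc_time W T A k z = 0"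
  by (cases k) auto

lemma trunc_time_Suc_mono: "trunc_time W T A k z \<le> trunc_time W T A (Suc k) z"
proof (induction k arbitrary: z)
  case 0
  show ?case using trunc_time_nonneg[of W T A "Suc 0" z] by simp
next
  case (Suc k)
  show ?case
    unfolding trunc_time.simps(2)[of W T A "Suc k"] trunc_time.simps(2)[of W T A k z]
    using Suc by (auto intro!: divide_right_mono sum_mono)
qed

lemma trunc_time_mono: "j \<le> k \<Longrightarrow> trunc_time W T A j z \<le> trunc_time W T A k z"
  by (rule lift_Suc_mono_le[of "\<lambda>k. trunc_time W T A k z"]) (auto simp: trunc_time_Suc_mono simp del: trunc_time.simps)

text \<open>Bijections preserve the counting measure, so expanding the squares turns the energy into
  \<open>2 * card W\<close> times the pairing of \<open>h\<close> with \<open>h - P h\<close>, where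
  \<open>P\<close> averages over \<open>W\<close>. Off the target \<open>h - P h\<close> is at most
  \<open>1\<close>, and on it \<open>h\<close> vanishes.\<close>

lemma trunc_time_dirichlet:
  fixes W :: "'w set" and V A :: "'z set" and k :: nat and h :: "'z \<Rightarrow> real"
  assumes "finite V" "finite W" "W \<noteq> {}" and bij: "\<And>w. w \<in> W \<Longrightarrow> bij_betw (T w) V V"
  defines "h \<equiv> trunc_time W T A k"
  shows "(\<Sum>z\<in>V. \<Sum>w\<in>W. (h (T w z) - h z)\<^sup>2) \<le> 2 * card W * (\<Sum>z\<in>V. h z)"
proof -
  have c: "real (card W) > 0" using assms by (simp add: card_gt_0_iff)
  have re: "(\<Sum>z\<in>V. (h (T w z))\<^sup>2) = (\<Sum>z\<in>V. (h z)\<^sup>2)" if "w \<in> W" for w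
    using sum.reindex_bij_betw[OF bij[OF that], of "\<lambda>z. (h z)\<^sup>2"] .
  have "(\<Sum>z\<in>V. \<Sum>w\<in>W. (h (T w z) - h z)\<^sup>2) =
      (\<Sum>w\<in>W. (\<Sum>z\<in>V. (h (T w z))\<^sup>2) + (\<Sum>z\<in>V. (h z)\<^sup>2) - (\<Sum>z\<in>V. 2 * h z * h (T w z)))"
    by (subst sum.swap) (simp add: power2_diff sum.distrib sum_subtractf mult_ac)
  also have "\<dots> = (\<Sum>w\<in>W. 2 * (\<Sum>z\<in>V. (h z)\<^sup>2) - (\<Sum>z\<in>V. 2 * h z * h (T w z)))"
    by (intro sum.cong) (simp_all add: re)
  also have "\<dots> = 2 * (\<Sum>z\<in>V. h z * (card W * h z - (\<Sum>w\<in>W. h (T w z))))"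
    by (simp add: sum_subtractf sum_distrib_left sum_distrib_right right_diff_distrib power2_eq_square
        sum.swap[of _ V W] mult_ac)
  also have "\<dots> \<le> 2 * (\<Sum>z\<in>V. h z * card W)"
  proof (rule mult_left_mono, rule sum_mono)
    fix z assume "z \<in> V"
    have "card W * h z - (\<Sum>w\<in>W. h (T w z)) \<le> real (card W)" if "z \<notin> A"
    proof -
      \<comment> \<open>Truncated times increase with \<open>k\<close>, so the recursion for level
        \<open>k + 1\<close> bounds level \<open>k\<close> from above.\<close>
      have "h z \<le> 1 + (\<Sum>w\<in>W. h (T w z)) / card W"
        using trunc_time_Suc_mono[of W T A k z] that by (simp add: h_def)
      then show ?thesis using c by (simp add: field_simps)
    qed
    then show "h z * (card W * h z - (\<Sum>w\<in>W. h (T w z))) \<le> h z * card W"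
      using trunc_time_target[of z A W T k] trunc_time_nonneg[of W T A k z]
      by (cases "z \<in> A") (auto simp: h_def intro!: mult_left_mono)
  qed auto
  finally show ?thesis by (simp add: sum_distrib_right[symmetric] mult_ac)
qed

text \<open>
  Here \<open>f\<close> may be an optimal cost, and the chain driven by \<open>T'\<close> need only agree with the projection
  \<open>g\<close> of the chain driven by \<open>T\<close> until the target is reached.
\<close>

lemma le_trunc_time:
  fixes f :: "nat \<Rightarrow> 'z \<Rightarrow> real"
  assumes W: "finite W" "W \<noteq> {}"
    and f0: "\<And>z. z \<in> U \<Longrightarrow> f 0 z \<le> M"
    and step: "\<And>j z. z \<in> U \<Longrightarrow> g z \<notin> A \<Longrightarrow> f (Suc j) z \<le> 1 + (\<Sum>w\<in>W. f j (T w z)) / card W"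
    and target: "\<And>j z. z \<in> U \<Longrightarrow> g z \<in> A \<Longrightarrow> j \<le> k \<Longrightarrow> f j z \<le> M"
    and closed: "\<And>w z. w \<in> W \<Longrightarrow> z \<in> U \<Longrightarrow> T w z \<in> U"
    and proj: "\<And>w z. w \<in> W \<Longrightarrow> z \<in> U \<Longrightarrow> g z \<notin> A \<Longrightarrow> g (T w z) = T' w (g z)"
    and "z \<in> U" "j \<le> k"
  shows "f j z \<le> trunc_time W T' A j (g z) + M"
  using assms(8,9)
proof (induction j arbitrary: z)
  case 0
  then show ?case using f0 by simp
next
  case (Suc j)
  show ?case
  proof (cases "g z \<in> A")
    case True
    then show ?thesis using target[OF Suc.prems(1) True Suc.prems(2)] by simp
  next
    case False
    have c: "real (card W) > 0" using W by (simp add: card_gt_0_iff)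
    have "f (Suc j) z \<le> 1 + (\<Sum>w\<in>W. f j (T w z)) / card W"
      by (rule step[OF Suc.prems(1) False])
    also have "\<dots> \<le> 1 + (\<Sum>w\<in>W. trunc_time W T' A j (T' w (g z)) + M) / card W"
    proof (intro add_mono divide_right_mono sum_mono order_refl)
      fix w assume w: "w \<in> W"
      show "f j (T w z) \<le> trunc_time W T' A j (T' w (g z)) + M"
        using Suc.IH[OF closed[OF w Suc.prems(1)]] Suc.prems(2) proj[OF w Suc.prems(1) False] by simp
    qed simp
    also have "\<dots> = trunc_time W T' A (Suc j) (g z) + M"
      using False c by (simp add: sum.distrib add_divide_distrib)
    finally show ?thesis .
  qed
qed

section \<open>Optimal choice between two kinds of moves\<close>

definition average :: "'w set \<Rightarrow> ('w \<Rightarrow> 'z \<Rightarrow> 'z) \<Rightarrow> ('z \<Rightarrow> real) \<Rightarrow> 'z \<Rightarrow> real" where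
  "average W T f z = (\<Sum>w\<in>W. f (T w z)) / card W"

text \<open>The Bellman recursion with a finite horizon: at every step the cheaper of the two
  averages is taken. Its value lies below the cost of any strategy, including one with
  memory.\<close>

primrec opt_time ::
  "'v set \<Rightarrow> ('v \<Rightarrow> 'z \<Rightarrow> 'z) \<Rightarrow> 'w set \<Rightarrow> ('w \<Rightarrow> 'z \<Rightarrow> 'z) \<Rightarrow> 'z set \<Rightarrow> nat \<Rightarrow> 'z \<Rightarrow> real" where
  "opt_time W1 T1 W2 T2 A 0 z = 0"
| "opt_time W1 T1 W2 T2 A (Suc k) z = (if z \<in> A then 0
    else 1 + min (average W1 T1 (opt_time W1 T1 W2 T2 A k) z) (average W2 T2 (opt_time W1 T1 W2 T2 A k) z))"

lemma average_nonneg: "(\<And>z. f z \<ge> 0) \<Longrightarrow> average W T f z \<ge> 0"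
  by (simp add: average_def sum_nonneg)

lemma average_mono: "(\<And>z. f z \<le> g z) \<Longrightarrow> average W T f z \<le> average W T g z"
  by (simp add: average_def sum_mono divide_right_mono)

lemma opt_time_nonneg: "opt_time W1 T1 W2 T2 A k z \<ge> 0"
proof (induction k arbitrary: z)
  case (Suc k)
  have "average W1 T1 (opt_time W1 T1 W2 T2 A k) z \<ge> 0" "average W2 T2 (opt_time W1 T1 W2 T2 A k) z \<ge> 0"
    by (rule average_nonneg, rule Suc)+
  then show ?case by simp
qed simp

lemma opt_time_Suc_mono: "opt_time W1 T1 W2 T2 A k z \<le> opt_time W1 T1 W2 T2 A (Suc k) z"
proof (induction k arbitrary: z)
  case 0
  show ?case using opt_time_nonneg[of W1 T1 W2 T2 A "Suc 0" z] by simp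
next
  case (Suc k)
  show ?case
    unfolding opt_time.simps(2)[of W1 T1 W2 T2 A "Suc k"] opt_time.simps(2)[of W1 T1 W2 T2 A k z]
    using min.mono[OF average_mono average_mono, of "opt_time W1 T1 W2 T2 A k" "opt_time W1 T1 W2 T2 A (Suc k)"
        "opt_time W1 T1 W2 T2 A k" "opt_time W1 T1 W2 T2 A (Suc k)" W1 T1 z W2 T2 z, OF Suc Suc]
    by (simp del: opt_time.simps)
qed

lemma opt_time_mono: "j \<le> k \<Longrightarrow> opt_time W1 T1 W2 T2 A j z \<le> opt_time W1 T1 W2 T2 A k z"
  by (rule lift_Suc_mono_le[of "\<lambda>k. opt_time W1 T1 W2 T2 A k z"]) (auto simp: opt_time_Suc_mono simp del: opt_time.simps)

lemma opt_time_target: "z \<in> A \<Longrightarrow> opt_time W1 T1 W2 T2 A k z = 0"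
  by (cases k) auto

lemma opt_time_le:
  "opt_time W1 T1 W2 T2 A (Suc k) z \<le> 1 + average W1 T1 (opt_time W1 T1 W2 T2 A k) z"
  "opt_time W1 T1 W2 T2 A (Suc k) z \<le> 1 + average W2 T2 (opt_time W1 T1 W2 T2 A k) z"
  using average_nonneg[of "opt_time W1 T1 W2 T2 A k" W1 T1 z, OF opt_time_nonneg]
    average_nonneg[of "opt_time W1 T1 W2 T2 A k" W2 T2 z, OF opt_time_nonneg] by auto

text \<open>The values increase with the horizon and are bounded, hence converge. Averages and
  \<open>min\<close> are continuous, so the limit solves the stationary Bellman equation.\<close>

lemma opt_time_limit:
  assumes Z: "\<And>v z. v \<in> W1 \<Longrightarrow> z \<in> Z \<Longrightarrow> T1 v z \<in> Z" "\<And>w z. w \<in> W2 \<Longrightarrow> z \<in> Z \<Longrightarrow> T2 w z \<in> Z"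
    and B: "\<And>k z. z \<in> Z \<Longrightarrow> opt_time W1 T1 W2 T2 A k z \<le> B"
  obtains f where "\<And>z. z \<in> Z \<Longrightarrow> 0 \<le> f z" "\<And>z. z \<in> Z \<Longrightarrow> f z \<le> B" "\<And>z. z \<in> Z \<Longrightarrow> z \<in> A \<Longrightarrow> f z = 0"
    "\<And>z. z \<in> Z \<Longrightarrow> z \<notin> A \<Longrightarrow> f z = 1 + min (average W1 T1 f z) (average W2 T2 f z)"
proof -
  let ?h = "opt_time W1 T1 W2 T2 A"
  have "\<exists>l. (\<lambda>k. ?h k z) \<longlonglongrightarrow> l" if "z \<in> Z" for z
  proof (rule incseq_convergent[of "\<lambda>k. ?h k z" B])
    show "incseq (\<lambda>k. ?h k z)" by (intro incseq_SucI opt_time_Suc_mono)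
    show "\<forall>i. ?h i z \<le> B" using B[OF that] by blast
    fix L assume "(\<lambda>k. ?h k z) \<longlonglongrightarrow> L"
    then show ?thesis by blast
  qed
  then obtain f where f: "\<And>z. z \<in> Z \<Longrightarrow> (\<lambda>k. ?h k z) \<longlonglongrightarrow> f z" by metis
  show ?thesis
  proof (rule that[of f])
    fix z assume z: "z \<in> Z"
    show "0 \<le> f z" by (rule LIMSEQ_le_const[OF f[OF z]]) (auto intro: opt_time_nonneg)
    show "f z \<le> B" by (rule LIMSEQ_le_const2[OF f[OF z]]) (auto intro: B[OF z])
    show "f z = 0" if "z \<in> A"
      using f[OF z] by (simp add: opt_time_target[OF that] LIMSEQ_const_iff)
    show "f z = 1 + min (average W1 T1 f z) (average W2 T2 f z)" if "z \<notin> A"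
    proof (rule LIMSEQ_unique)
      show "(\<lambda>k. ?h (Suc k) z) \<longlonglongrightarrow> f z" using f[OF z] by (rule LIMSEQ_Suc)
      have "(\<lambda>k. 1 + min (average W1 T1 (?h k) z) (average W2 T2 (?h k) z))
          \<longlonglongrightarrow> 1 + min (average W1 T1 f z) (average W2 T2 f z)"
        unfolding average_def divide_inverse
        by (intro tendsto_add tendsto_min tendsto_mult tendsto_sum tendsto_const f Z z)
      then show "(\<lambda>k. ?h (Suc k) z) \<longlonglongrightarrow> 1 + min (average W1 T1 f z) (average W2 T2 f z)"
        using that by simp
    qed
  qed
qed

section \<open>Shifts of the board and random walks on it\<close>

lemma shift_square_shift_square: "shift_square n v (shift_square n w p) = shift_square n (v + w) p"
  by (simp add: shift_square_def mod_simps algebra_simps)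

lemma shift_square_0: "p \<in> board n \<Longrightarrow> shift_square n 0 p = p"
  by (cases p) (auto simp: shift_square_def board_def)

lemma bij_betw_shift_square:
  assumes "n > 0"
  shows "bij_betw (shift_square n v) (board n) (board n)"
  by (rule bij_betw_byWitness[where f' = "shift_square n (- v)"])
    (simp_all add: shift_square_shift_square shift_square_0 image_subset_iff shift_square_in_board assms
      del: split_paired_All)

lemma shift_square_eq_iff:
  assumes "p \<in> board n" "q \<in> board n"
  shows "shift_square n v p = q \<longleftrightarrow> p = shift_square n (- v) q"
  using assms by (auto simp: shift_square_shift_square shift_square_0)

definition torus_fun :: "nat \<Rightarrow> (int \<times> int \<Rightarrow> real) \<Rightarrow> int \<Rightarrow> int \<Rightarrow> real" where
  "torus_fun n h i j = h (i mod int n, j mod int n)"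

lemma torus_energy_torus_fun:
  "torus_energy n (torus_fun n h) =
    (\<Sum>a\<in>board n. (h (shift_square n (1, 0) a) - h a)\<^sup>2 + (h (shift_square n (0, 1) a) - h a)\<^sup>2)"
  unfolding board_def torus_energy_def
  by (subst sum.cartesian_product) (auto simp: torus_fun_def shift_square_def intro!: sum.cong)

lemma board_oscillation:
  assumes "n \<ge> 2" "a \<in> board n" "b \<in> board n"
  shows "(h a - h b)\<^sup>2 \<le> 15 * (1 + ln (real n)) *
    (\<Sum>a\<in>board n. (h (shift_square n (1, 0) a) - h a)\<^sup>2 + (h (shift_square n (0, 1) a) - h a)\<^sup>2)"
proof -
  have "torus_fun n h (fst a) (snd a) = h a" "torus_fun n h (fst b) (snd b) = h b"
    using assms by (auto simp: torus_fun_def board_def)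
  then show ?thesis
    using torus_oscillation[of n "torus_fun n h" "fst a" "snd a" "fst b" "snd b"] assms(1)
    by (simp add: torus_energy_torus_fun) (simp add: torus_fun_def)
qed

text \<open>Let \<open>m\<close> be the maximum of \<open>h\<close>. Since \<open>h\<close> vanishes
  at \<open>a0\<close>, the oscillation bound gives \<open>m\<^sup>2 \<le> 15 (1 + ln n) E\<close>,
  while the energy of a hitting time is at most \<open>2 * card W * n\<^sup>2 * m\<close>. Dividing
  by \<open>m\<close> leaves the claim. The unit increments among the \<open>\<sigma> w\<close>
  dominate the torus energy \<open>E\<close>.\<close>

lemma torus_walk_bound:
  fixes \<sigma> :: "'w \<Rightarrow> int \<times> int"
  assumes n: "n \<ge> 2" and W: "finite W" "(1, 0) \<in> \<sigma> ` W" "(0, 1) \<in> \<sigma> ` W"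
    and A: "a0 \<in> A" "a0 \<in> board n" and a: "a \<in> board n"
  shows "trunc_time W (\<lambda>w. shift_square n (\<sigma> w)) A k a \<le> 30 * card W * (1 + ln (real n)) * n\<^sup>2"
proof -
  define h where "h = trunc_time W (\<lambda>w. shift_square n (\<sigma> w)) A k"
  define E where "E = (\<Sum>a\<in>board n. (h (shift_square n (1, 0) a) - h a)\<^sup>2 + (h (shift_square n (0, 1) a) - h a)\<^sup>2)"
  define m where "m = Max (h ` board n)"
  let ?L = "1 + ln (real n)"
  have L: "?L \<ge> 0" using n by simp
  have hm: "h b \<le> m" if "b \<in> board n" for b
    using that by (simp add: m_def)
  have "m \<in> h ` board n"
    unfolding m_def using a by (intro Max_in) auto
  then obtain b where b: "b \<in> board n" "m = h b" by blast
  have m0: "m \<ge> 0" unfolding b h_def by (rule trunc_time_nonneg)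
  obtain w1 w2 where w: "w1 \<in> W" "\<sigma> w1 = (1, 0)" "w2 \<in> W" "\<sigma> w2 = (0, 1)"
    using W by force
  have ne: "w1 \<noteq> w2" using w by auto
  have "E \<le> (\<Sum>a\<in>board n. \<Sum>w\<in>W. (h (shift_square n (\<sigma> w) a) - h a)\<^sup>2)"
    unfolding E_def
  proof (rule sum_mono)
    fix a
    have "(\<Sum>w\<in>{w1, w2}. (h (shift_square n (\<sigma> w) a) - h a)\<^sup>2) \<le> (\<Sum>w\<in>W. (h (shift_square n (\<sigma> w) a) - h a)\<^sup>2)"
      using W w by (intro sum_mono2) auto
    then show "(h (shift_square n (1, 0) a) - h a)\<^sup>2 + (h (shift_square n (0, 1) a) - h a)\<^sup>2
        \<le> (\<Sum>w\<in>W. (h (shift_square n (\<sigma> w) a) - h a)\<^sup>2)"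
      using w ne by simp
  qed
  also have "\<dots> \<le> 2 * card W * (\<Sum>z\<in>board n. h z)"
    unfolding h_def using n W by (intro trunc_time_dirichlet bij_betw_shift_square) auto
  also have "\<dots> \<le> 2 * card W * (n\<^sup>2 * m)"
    using sum_bounded_above[of "board n" h m] hm by (intro mult_left_mono) (auto simp: card_board)
  finally have E: "E \<le> 2 * card W * (n\<^sup>2 * m)" .
  have "h a0 = 0" unfolding h_def by (rule trunc_time_target[OF A(1)])
  then have "m * m \<le> 15 * ?L * E"
    using board_oscillation[OF n b(1) A(2), of h] b(2) by (simp add: E_def power2_eq_square)
  also have "\<dots> \<le> 15 * ?L * (2 * card W * (n\<^sup>2 * m))"
    using E L by (intro mult_left_mono) auto
  also have "\<dots> = (30 * card W * ?L * n\<^sup>2) * m" by simp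
  finally have "m * m \<le> (30 * card W * ?L * n\<^sup>2) * m" .
  then have "m \<le> 30 * card W * ?L * n\<^sup>2"
    using m0 L by (cases "m = 0") auto
  then show ?thesis using hm[OF a] by (simp add: h_def)
qed

section \<open>Two positions of a piece under common moves\<close>

text \<open>Coordinates are centred at the tracked piece in the first configuration:
  \<open>a\<close> is the common empty square, \<open>u\<close> the position of the piece in the
  second configuration. If the empty square hits the centre, the first copy of the piece moves to
  the old empty square \<open>-v\<close>, and recentring there adds \<open>v\<close> to
  everything.\<close>

definition rel_move :: "nat \<Rightarrow> int \<times> int \<Rightarrow> (int \<times> int) \<times> int \<times> int \<Rightarrow> (int \<times> int) \<times> int \<times> int" where
  "rel_move n v = (\<lambda>(a, u). let a' = shift_square n v a in
     if a' = 0 then (shift_square n v 0, shift_square n v u) else if a' = u then (a', a) else (a', u))"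

definition rel_states :: "nat \<Rightarrow> ((int \<times> int) \<times> int \<times> int) set" where
  "rel_states n = {(a, u) \<in> board n \<times> board n. a \<noteq> 0 \<and> u \<noteq> 0 \<and> a \<noteq> u}"

lemma finite_rel_states [simp]: "finite (rel_states n)"
  unfolding rel_states_def by (rule finite_subset[of _ "board n \<times> board n"]) auto

lemma zero_in_board: "n > 0 \<Longrightarrow> 0 \<in> board n"
  by (simp add: board_def zero_prod_def)

lemma rel_move_in_states:
  assumes z: "z \<in> rel_states n"
  shows "rel_move n v z \<in> rel_states n"
proof -
  obtain a u where z_eq: "z = (a, u)" by (cases z)
  have au: "a \<in> board n" "u \<in> board n" "a \<noteq> 0" "u \<noteq> 0" "a \<noteq> u"
    using z by (auto simp: rel_states_def z_eq)
  have n: "n > 0" using au(1) by (auto simp: board_def)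
  note iff = shift_square_eq_iff[OF _ zero_in_board[OF n]]
  have b: "shift_square n w p \<in> board n" for w p by (rule shift_square_in_board[OF n])
  have inj: "shift_square n w p = shift_square n w q \<longleftrightarrow> p = q" if "p \<in> board n" "q \<in> board n" for w p q
    using bij_betw_shift_square[OF n, of w] that by (auto simp: bij_betw_def inj_on_def)
  consider "shift_square n v a = 0" | "shift_square n v a \<noteq> 0" "shift_square n v a = u"
    | "shift_square n v a \<noteq> 0" "shift_square n v a \<noteq> u" by blast
  then show ?thesis
  proof cases
    case 1
    have "shift_square n v 0 \<noteq> 0"
    proof
      assume "shift_square n v 0 = 0"
      then have "shift_square n v a = shift_square n v 0" using 1 by simp
      then show False using inj[OF au(1) zero_in_board[OF n]] au by simp
    qed
    moreover have "shift_square n v u \<noteq> 0" using inj[OF au(1,2), of v] 1 au by auto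
    moreover have "shift_square n v 0 \<noteq> shift_square n v u" using inj[OF zero_in_board[OF n] au(2)] au by simp
    ultimately show ?thesis using 1 b by (simp add: z_eq rel_move_def rel_states_def)
  next
    case 2
    then show ?thesis using au by (auto simp: z_eq rel_move_def rel_states_def)
  next
    case 3
    then show ?thesis using b au by (simp add: z_eq rel_move_def rel_states_def)
  qed
qed

text \<open>Moving the empty square back undoes a step, recentring included. Hence each move
  permutes the relative states, as \<open>trunc_time_dirichlet\<close> demands.\<close>

lemma rel_move_inverse:
  assumes z: "z \<in> rel_states n"
  shows "rel_move n (- v) (rel_move n v z) = z"
proof -
  obtain a u where z_eq: "z = (a, u)" by (cases z)
  have au: "a \<in> board n" "u \<in> board n" "a \<noteq> 0" "u \<noteq> 0" "a \<noteq> u"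
    using z by (auto simp: rel_states_def z_eq)
  have n: "n > 0" using au(1) by (auto simp: board_def)
  have s: "shift_square n (- v) (shift_square n v p) = p" if "p \<in> board n" for p
    using that by (simp add: shift_square_shift_square shift_square_0)
  show ?thesis
  proof (cases "shift_square n v a = 0")
    case True
    then have "a = shift_square n (- v) 0" using s[OF au(1)] by simp
    then show ?thesis using True au s[OF zero_in_board[OF n]] by (simp add: z_eq rel_move_def Let_def s)
  next
    case False
    then show ?thesis using au s[OF au(1)] by (auto simp: z_eq rel_move_def Let_def)
  qed
qed

lemma bij_betw_rel_move: "bij_betw (rel_move n v) (rel_states n) (rel_states n)"
proof (rule bij_betw_byWitness[where f' = "rel_move n (- v)"])
  show "\<forall>z\<in>rel_states n. rel_move n (- v) (rel_move n v z) = z"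
    using rel_move_inverse[of _ n v] by blast
  show "\<forall>z\<in>rel_states n. rel_move n v (rel_move n (- v) z) = z"
    using rel_move_inverse[of _ n "- v"] by simp
qed (use rel_move_in_states in blast)+

section \<open>The ring of eight squares around the tracked piece\<close>

definition ring_offset :: "nat \<Rightarrow> int \<times> int" where
  "ring_offset i = [(1, 0), (1, 1), (0, 1), (-1, 1), (-1, 0), (-1, -1), (0, -1), (1, -1)] ! (i mod 8)"

lemma ring_mod: "ring_offset (i mod 8) = ring_offset i"
  by (simp add: ring_offset_def)

lemma less_8_cases:
  fixes m :: nat
  assumes "m < 8"
  shows "m \<in> {0, 1, 2, 3, 4, 5, 6, 7}"
  using assms unfolding insert_iff empty_iff by linarith

lemma ring_cases: "ring_offset i \<in> {(1, 0), (1, 1), (0, 1), (-1, 1), (-1, 0), (-1, -1), (0, -1), (1, -1)}"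
proof -
  have "i mod 8 \<in> {0, 1, 2, 3, 4, 5, 6, 7}" by (rule less_8_cases) simp
  then show ?thesis by (auto simp: ring_offset_def)
qed

text \<open>The offsets are listed in cyclic order, sides at even and corners at odd indices, so
  walking round the ring uses legal moves of the empty square.\<close>

lemma ring_Suc_diff: "ring_offset (Suc i) - ring_offset i \<in> moves"
proof -
  have "i mod 8 \<in> {0, 1, 2, 3, 4, 5, 6, 7}" by (rule less_8_cases) simp
  moreover have "Suc i mod 8 = Suc (i mod 8) mod 8" by (simp add: mod_Suc_eq)
  ultimately show ?thesis by (auto simp: ring_offset_def moves_def)
qed

definition near :: "nat \<Rightarrow> nat \<Rightarrow> int \<times> int" where
  "near n i = shift_square n (ring_offset i) 0"

lemma near_mod: "near n (i mod 8) = near n i"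
  by (simp add: near_def ring_mod)

lemma near_in_board: "n > 0 \<Longrightarrow> near n i \<in> board n"
  by (simp add: near_def shift_square_in_board)

lemma near_nonzero: "n \<ge> 3 \<Longrightarrow> near n i \<noteq> 0"
  using ring_cases[of i] by (auto simp: near_def shift_square_def zero_prod_def zmod_minus1)

lemma near_Suc: "near n (Suc i) = shift_square n (ring_offset (Suc i) - ring_offset i) (near n i)"
  by (simp add: near_def shift_square_shift_square)

lemma mod_eq_small:
  fixes x y n :: int
  assumes "x mod n = y mod n" "\<bar>x - y\<bar> < n"
  shows "x = y"
proof -
  have "n dvd x - y" using assms(1) by (simp add: mod_eq_dvd_iff)
  then show ?thesis using assms(2) dvd_imp_le_int[of "x - y" n] by fastforce
qed

text \<open>Offsets in the ring differ by at most \<open>2\<close> in each coordinate, so they stay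
  distinct modulo \<open>n \<ge> 3\<close>.\<close>

lemma inj_on_near:
  assumes "n \<ge> 3"
  shows "inj_on (near n) {..<8}"
proof (rule inj_onI)
  fix i j assume ij: "i \<in> {..<8}" "j \<in> {..<8}" "near n i = near n j"
  have "fst (ring_offset i) mod int n = fst (ring_offset j) mod int n" "snd (ring_offset i) mod int n = snd (ring_offset j) mod int n"
    using ij(3) by (simp_all add: near_def shift_square_def)
  moreover have "\<bar>fst (ring_offset i) - fst (ring_offset j)\<bar> < int n" "\<bar>snd (ring_offset i) - snd (ring_offset j)\<bar> < int n"
    using ring_cases[of i] ring_cases[of j] assms by auto
  ultimately have "ring_offset i = ring_offset j" by (auto intro: prod_eqI mod_eq_small)
  moreover have "distinct [(1, 0), (1, 1), (0, 1), (-1, 1), (-1, 0), (-1, -1), (0, -1), (1, -1 :: int) :: int \<times> int]"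
    (is "distinct ?xs") by simp
  ultimately show "i = j"
    using ij(1,2) nth_eq_iff_index_eq[of ?xs i j] by (simp add: ring_offset_def)
qed

lemma unit_near:
  assumes "v \<in> moves" "v \<noteq> 0"
  shows "\<exists>i<8. shift_square n v 0 = near n i"
proof -
  have "v \<in> {ring_offset 0, ring_offset 2, ring_offset 4, ring_offset 6}"
    using assms by (auto simp: moves_def ring_offset_def zero_prod_def)
  moreover have "ring_offset i \<in> ring_offset ` {..<8}" if "i < 8" for i using that by simp
  from this[of 0] this[of 2] this[of 4] this[of 6]
  have "{ring_offset 0, ring_offset 2, ring_offset 4, ring_offset 6} \<subseteq> ring_offset ` {..<8}" by simp
  ultimately obtain i where "i < 8" "v = ring_offset i" by blast
  then show ?thesis unfolding near_def by blast
qed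

lemma abs_diff_le_path:
  fixes g :: "nat \<Rightarrow> real" and K :: nat and \<delta> :: real
  assumes step: "\<And>k. k < K \<Longrightarrow> \<bar>g (Suc k) - g k\<bar> \<le> \<delta>" and "i \<le> K" "j \<le> K"
  shows "\<bar>g i - g j\<bar> \<le> K * \<delta>"
proof -
  have le: "\<bar>g b - g a\<bar> \<le> K * \<delta>" if "a \<le> b" "b \<le> K" for a b
  proof (cases "K = 0")
    case False
    then have d: "\<delta> \<ge> 0" using step[of 0] by linarith
    have "\<bar>g b - g a\<bar> = \<bar>\<Sum>k\<in>{a..<b}. g (Suc k) - g k\<bar>"
      using sum_Suc_diff'[of a b g] that by simp
    also have "\<dots> \<le> (\<Sum>k\<in>{a..<b}. \<delta>)"
      using that by (intro order_trans[OF sum_abs] sum_mono step) auto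
    also have "\<dots> \<le> K * \<delta>" using that d by (simp add: mult_right_mono)
    finally show ?thesis .
  qed (use that in auto)
  show ?thesis
    using le[of i j] le[of j i] assms(2,3) by (cases "i \<le> j") (auto simp: abs_minus_commute)
qed

text \<open>The square root makes one number dominate every single increment of \<open>h\<close>
  near level \<open>u\<close>, while its squares add up over the levels to at most the total energy.
  The square \<open>u\<close> is left out because the empty square cannot be there.\<close>

definition local_dev :: "nat \<Rightarrow> ((int \<times> int) \<times> int \<times> int \<Rightarrow> real) \<Rightarrow> int \<times> int \<Rightarrow> real" where
  "local_dev n h u = sqrt (\<Sum>a\<in>near n ` {..<8} - {u}. \<Sum>v\<in>moves. (h (rel_move n v (a, u)) - h (a, u))\<^sup>2)"

definition rel_energy :: "nat \<Rightarrow> ((int \<times> int) \<times> int \<times> int \<Rightarrow> real) \<Rightarrow> real" where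
  "rel_energy n h = (\<Sum>z\<in>rel_states n. \<Sum>v\<in>moves. (h (rel_move n v z) - h z)\<^sup>2)"

lemma finite_moves [simp]: "finite moves" by (simp add: moves_def)

lemma card_moves [simp]: "card moves = 5" by (simp add: moves_def)

lemma local_dev_nonneg: "local_dev n h u \<ge> 0"
  unfolding local_dev_def by (intro real_sqrt_ge_zero sum_nonneg) simp

lemma local_dev_bound:
  assumes "near n i \<noteq> u" "v \<in> moves"
  shows "\<bar>h (rel_move n v (near n i, u)) - h (near n i, u)\<bar> \<le> local_dev n h u"
proof -
  let ?f = "\<lambda>a v. (h (rel_move n v (a, u)) - h (a, u))\<^sup>2"
  have i: "near n i \<in> near n ` {..<8}"
    using near_mod[of n i, symmetric] by (intro image_eqI[of _ _ "i mod 8"]) auto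
  have "?f (near n i) v \<le> (\<Sum>v\<in>moves. ?f (near n i) v)"
    using assms by (intro member_le_sum) auto
  also have "\<dots> \<le> (\<Sum>a\<in>near n ` {..<8} - {u}. \<Sum>v\<in>moves. ?f a v)"
    using assms i by (intro member_le_sum[where f = "\<lambda>a. \<Sum>v\<in>moves. ?f a v"]) (auto intro: sum_nonneg)
  finally have "\<bar>h (rel_move n v (near n i, u)) - h (near n i, u)\<bar>\<^sup>2
      \<le> (\<Sum>a\<in>near n ` {..<8} - {u}. \<Sum>v\<in>moves. ?f a v)" by simp
  then show ?thesis unfolding local_dev_def by (rule real_le_rsqrt)
qed

text \<open>States of different levels \<open>u\<close> are different, so the squared deviations
  collect disjoint parts of the energy.\<close>

lemma sum_local_dev_le:
  assumes "n \<ge> 3"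
  shows "(\<Sum>u\<in>board n - {0}. (local_dev n h u)\<^sup>2) \<le> rel_energy n h"
proof -
  let ?f = "\<lambda>z. \<Sum>v\<in>moves. (h (rel_move n v z) - h z)\<^sup>2"
  have "(\<Sum>u\<in>board n - {0}. (local_dev n h u)\<^sup>2) = (\<Sum>u\<in>board n - {0}. \<Sum>a\<in>near n ` {..<8} - {u}. ?f (a, u))"
    unfolding local_dev_def by (intro sum.cong refl real_sqrt_pow2 sum_nonneg) simp
  also have "\<dots> = (\<Sum>(u, a)\<in>(SIGMA u:board n - {0}. near n ` {..<8} - {u}). ?f (a, u))"
    by (rule sum.Sigma) auto
  also have "\<dots> = (\<Sum>z\<in>prod.swap ` (SIGMA u:board n - {0}. near n ` {..<8} - {u}). ?f z)"
    by (subst sum.reindex) (auto simp: case_prod_beta prod.swap_def)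
  also have "\<dots> \<le> (\<Sum>z\<in>rel_states n. ?f z)"
  proof (rule sum_mono2)
    show "prod.swap ` (SIGMA u:board n - {0}. near n ` {..<8} - {u}) \<subseteq> rel_states n"
    proof (rule image_subsetI)
      fix p assume p: "p \<in> (SIGMA u:board n - {0}. near n ` {..<8} - {u})"
      then obtain u i where "p = (u, near n i)" "u \<in> board n" "u \<noteq> 0" "near n i \<noteq> u" by blast
      then show "prod.swap p \<in> rel_states n"
        using assms near_in_board[of n i] near_nonzero[of n i] by (simp add: rel_states_def)
    qed
  qed (simp_all add: sum_nonneg)
  finally show ?thesis by (simp add: rel_energy_def)
qed

lemma local_dev_le:
  assumes "n \<ge> 3" "u \<in> board n" "u \<noteq> 0"
  shows "(local_dev n h u)\<^sup>2 \<le> rel_energy n h"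
proof -
  have "(local_dev n h u)\<^sup>2 \<le> (\<Sum>u\<in>board n - {0}. (local_dev n h u)\<^sup>2)"
    using assms by (intro member_le_sum) auto
  with sum_local_dev_le[OF assms(1), of h] show ?thesis by linarith
qed

text \<open>The cycle of eight squares around the tracked piece minus the square of the other piece is a path.\<close>

lemma near_connected:
  assumes n: "n \<ge> 3" and "near n i \<noteq> u" "near n j \<noteq> u" "u \<noteq> 0"
  shows "\<bar>h (near n i, u) - h (near n j, u)\<bar> \<le> 7 * local_dev n h u"
proof -
  have step: "\<bar>h (near n (Suc i), u) - h (near n i, u)\<bar> \<le> local_dev n h u"
    if "near n i \<noteq> u" "near n (Suc i) \<noteq> u" for i
  proof -
    have "rel_move n (ring_offset (Suc i) - ring_offset i) (near n i, u) = (near n (Suc i), u)"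
      using that near_nonzero[OF n] by (simp add: rel_move_def near_Suc[symmetric])
    then show ?thesis using local_dev_bound[OF that(1) ring_Suc_diff, of h i] by simp
  qed
  obtain m K where K: "K \<le> 7" and ok: "\<And>k. k \<le> K \<Longrightarrow> near n (m + k) \<noteq> u"
    and m: "\<And>i. near n i \<noteq> u \<Longrightarrow> \<exists>k\<le>K. near n i = near n (m + k)"
  proof (cases "\<exists>m<8. near n m = u")
    case True
    then obtain m where m: "m < 8" "near n m = u" by blast
    have eq: "near n i = u \<longleftrightarrow> i mod 8 = m" for i :: nat
    proof
      assume "near n i = u"
      then have "near n (i mod 8) = near n m" by (simp only: near_mod m(2))
      then show "i mod 8 = m" using inj_onD[OF inj_on_near[OF n], of "i mod 8" m] m(1) by simp
    next
      assume "i mod 8 = m"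
      then show "near n i = u" by (simp only: m(2) flip: near_mod[of n i])
    qed
    have cyc: "near n i = near n j" if "i mod 8 = j mod 8" for i j :: nat
      by (simp only: that near_mod[of n i, symmetric] near_mod[of n j, symmetric])
    show ?thesis
    \<comment> \<open>If \<open>u\<close> is square \<open>m\<close> of the ring, the other seven
      squares form a path of six steps that starts right after it.\<close>
    proof (rule that[of 6 "Suc m"])
      fix k :: nat assume "k \<le> 6"
      then have "(Suc m + k) mod 8 \<noteq> m" using m(1) by (cases "Suc m + k < 8") (auto simp: mod_if)
      then show "near n (Suc m + k) \<noteq> u" by (simp only: eq not_False_eq_True)
    next
      fix i :: nat assume "near n i \<noteq> u"
      then have ne: "i mod 8 \<noteq> m" by (simp only: eq not_False_eq_True)
      define r where "r = i mod 8"
      have r: "r < 8" "r \<noteq> m" using ne by (auto simp: r_def)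
      define k where "k = (if m < r then r - Suc m else r + 7 - m)"
      have "k \<le> 6" "(Suc m + k) mod 8 = r" using r m(1) by (auto simp: k_def mod_if)
      then have "near n i = near n (Suc m + k)" by (intro cyc) (simp only: r_def)
      then show "\<exists>k\<le>6. near n i = near n (Suc m + k)" using \<open>k \<le> 6\<close> by blast
    qed simp
  next
    case False
    show ?thesis
    \<comment> \<open>Otherwise the cycle is cut open at index \<open>0\<close>, which gives a path
      of seven steps.\<close>
    proof (rule that[of 7 0])
      fix k :: nat assume "k \<le> 7"
      then have "k < 8" by simp
      then show "near n (0 + k) \<noteq> u" using False by (simp only: add_0) blast
    next
      fix i :: nat
      have "i mod 8 \<le> 7" using mod_less_divisor[of 8 i] by linarith
      moreover have "near n i = near n (0 + i mod 8)" by (simp only: add_0 near_mod)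
      ultimately show "\<exists>k\<le>7. near n i = near n (0 + k)" by blast
    qed simp
  qed
  obtain k where k: "k \<le> K" "near n i = near n (m + k)" using m assms by blast
  obtain l where l: "l \<le> K" "near n j = near n (m + l)" using m assms by blast
  have "\<bar>h (near n (m + k), u) - h (near n (m + l), u)\<bar> \<le> K * local_dev n h u"
  proof (rule abs_diff_le_path[where g = "\<lambda>k. h (near n (m + k), u)", OF _ k(1) l(1)])
    fix p assume "p < K"
    then show "\<bar>h (near n (m + Suc p), u) - h (near n (m + p), u)\<bar> \<le> local_dev n h u"
      using step[of "m + p"] ok[of p] ok[of "Suc p"] by simp
  qed
  also have "\<dots> \<le> 7 * local_dev n h u"
    using K local_dev_nonneg by (intro mult_right_mono) auto
  finally show ?thesis by (simp add: k l)
qed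

text \<open>A representative value of \<open>h\<close> on level \<open>u\<close>, taken with the
  empty square at a fixed place of the ring, or at the opposite place if \<open>u\<close> occupies
  it. The missing level \<open>0\<close> borrows the value of a neighbouring level.\<close>

definition level_fun :: "nat \<Rightarrow> ((int \<times> int) \<times> int \<times> int \<Rightarrow> real) \<Rightarrow> int \<times> int \<Rightarrow> real" where
  "level_fun n h u = (let u' = if u = 0 then near n 0 else u in
     h (if u' = near n 0 then near n 4 else near n 0, u'))"

lemma level_fun_near:
  assumes "n \<ge> 3" "u \<noteq> 0" "near n i \<noteq> u"
  shows "\<bar>h (near n i, u) - level_fun n h u\<bar> \<le> 7 * local_dev n h u"
proof -
  have "near n 4 \<noteq> near n 0"
    using inj_onD[OF inj_on_near[OF assms(1)], of 4 0] by auto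
  then show ?thesis
    using near_connected[OF assms(1,3) _ assms(2), of 4 h] near_connected[OF assms(1,3) _ assms(2), of 0 h] assms
    by (auto simp: level_fun_def Let_def)
qed

text \<open>Put the empty square at \<open>- v\<close> from the tracked piece. The move
  \<open>v\<close> swaps the two, and after recentring the other position has moved by
  \<open>v\<close>: one step of the chain changes the level like a step on the torus. Reaching the
  representatives costs seven deviations on each side.\<close>

lemma level_fun_step:
  assumes n: "n \<ge> 3" and u: "u \<in> board n" "u \<noteq> 0" and v: "v \<in> moves" and u': "shift_square n v u \<noteq> 0"
  shows "\<bar>level_fun n h (shift_square n v u) - level_fun n h u\<bar>
    \<le> 8 * (local_dev n h u + local_dev n h (shift_square n v u))"
proof (cases "v = 0")
  case True
  then show ?thesis using u local_dev_nonneg[of n h u] by (simp add: shift_square_0)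
next
  case False
  let ?u' = "shift_square n v u"
  have z: "0 \<in> board n" using n by (intro zero_in_board) simp
  have mv: "- v \<in> moves" "- v \<noteq> 0" using v False by (auto simp: moves_def zero_prod_def)
  obtain i where i: "shift_square n (- v) 0 = near n i" using unit_near[OF mv] by blast
  obtain j where j: "shift_square n v 0 = near n j" using unit_near[OF v False] by blast
  \<comment> \<open>The starting square \<open>- v\<close> differs from \<open>u\<close> because the
    new level is not \<open>0\<close>.\<close>
  have iu: "near n i \<noteq> u" using u' i shift_square_eq_iff[OF u(1) z, of v] by auto
  have inj: "shift_square n v 0 \<noteq> shift_square n v u"
    using bij_betw_shift_square[of n v] n u z by (auto simp: bij_betw_def inj_on_def)
  have "shift_square n v (near n i) = 0"
    unfolding i[symmetric] using z by (simp add: shift_square_shift_square shift_square_0)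
  then have "rel_move n v (near n i, u) = (near n j, ?u')" by (simp add: rel_move_def j)
  then have 1: "\<bar>h (near n j, ?u') - h (near n i, u)\<bar> \<le> local_dev n h u"
    using local_dev_bound[OF iu v, of h] by simp
  have 2: "\<bar>h (near n i, u) - level_fun n h u\<bar> \<le> 7 * local_dev n h u"
    by (rule level_fun_near[OF n u(2) iu])
  have 3: "\<bar>h (near n j, ?u') - level_fun n h ?u'\<bar> \<le> 7 * local_dev n h ?u'"
    using inj j by (intro level_fun_near[OF n u']) auto
  from 1 2 3 local_dev_nonneg[of n h ?u'] show ?thesis
    unfolding abs_le_iff distrib_left by linarith
qed

text \<open>
  The level \<open>u = 0\<close> does not exist; it is filled in with the value at a neighbour, which costs the
  deviations on the eight levels around it.
\<close>

definition ext_dev :: "nat \<Rightarrow> ((int \<times> int) \<times> int \<times> int \<Rightarrow> real) \<Rightarrow> int \<times> int \<Rightarrow> real" where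
  "ext_dev n h u = (if u = 0 then 14 * sqrt (\<Sum>i<8. (local_dev n h (near n i))\<^sup>2) else local_dev n h u)"

lemma ext_dev_nonneg: "ext_dev n h u \<ge> 0"
  using local_dev_nonneg by (simp add: ext_dev_def sum_nonneg)

text \<open>Go round the ring of levels, none of which is \<open>0\<close>. Each step costs
  \<open>8\<close> times the sum of two deviations, hence at most \<open>16\<close> times their
  common bound.\<close>

lemma level_fun_near_near:
  assumes n: "n \<ge> 3" and i: "i < 8"
  shows "\<bar>level_fun n h (near n i) - level_fun n h (near n 0)\<bar> \<le> 8 * ext_dev n h 0"
proof -
  let ?\<Delta> = "sqrt (\<Sum>i<8. (local_dev n h (near n i))\<^sup>2)"
  have dev: "local_dev n h (near n k) \<le> ?\<Delta>" for k
  proof -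
    have "(local_dev n h (near n (k mod 8)))\<^sup>2 \<le> (\<Sum>i<8. (local_dev n h (near n i))\<^sup>2)"
      by (intro member_le_sum) auto
    then show ?thesis by (intro real_le_rsqrt) (simp add: near_mod)
  qed
  have "\<bar>level_fun n h (near n (Suc k)) - level_fun n h (near n k)\<bar> \<le> 16 * ?\<Delta>" for k
    using level_fun_step[OF n near_in_board[of n k] near_nonzero[OF n] ring_Suc_diff[of k], of h]
      near_nonzero[OF n] dev[of k] dev[of "Suc k"] n
    by (simp add: near_Suc[symmetric])
  \<comment> \<open>Seven steps of \<open>16 * ?\<Delta>\<close> make
    \<open>8 * 14 * ?\<Delta>\<close>, which explains the factor \<open>14\<close> in
    \<open>ext_dev\<close>.\<close>
  then have "\<bar>level_fun n h (near n i) - level_fun n h (near n 0)\<bar> \<le> real 7 * (16 * ?\<Delta>)"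
    using i by (intro abs_diff_le_path[where g = "\<lambda>k. level_fun n h (near n k)"]) auto
  then show ?thesis by (simp add: ext_dev_def)
qed

lemma level_fun_step_ext:
  assumes n: "n \<ge> 3" and u: "u \<in> board n" and v: "v \<in> moves" "v \<noteq> 0"
  shows "\<bar>level_fun n h (shift_square n v u) - level_fun n h u\<bar>
    \<le> 8 * (ext_dev n h u + ext_dev n h (shift_square n v u))"
proof -
  have z: "0 \<in> board n" using n by (intro zero_in_board) simp
  have l0: "level_fun n h 0 = level_fun n h (near n 0)"
    using near_nonzero[OF n, of 0] by (simp add: level_fun_def Let_def)
  have mv: "- v \<in> moves" "- v \<noteq> 0" using v by (auto simp: moves_def zero_prod_def)
  consider "u = 0" | "u \<noteq> 0" "shift_square n v u = 0" | "u \<noteq> 0" "shift_square n v u \<noteq> 0" by blast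
  then show ?thesis
  proof cases
    case 1
    obtain i where "i < 8" "shift_square n v 0 = near n i" using unit_near[OF v] by blast
    then show ?thesis
      using level_fun_near_near[OF n, of i h] ext_dev_nonneg[of n h "near n i"] 1 l0 by simp
  next
    case 2
    obtain i where i: "i < 8" "shift_square n (- v) 0 = near n i" using unit_near[OF mv] by blast
    have "u = near n i" using 2 i shift_square_eq_iff[OF u z, of v] by simp
    then show ?thesis
      using level_fun_near_near[OF n i(1), of h] ext_dev_nonneg[of n h "near n i"] 2(2) l0
      by (simp add: abs_minus_commute)
  next
    case 3
    then show ?thesis using level_fun_step[OF n u 3(1) v(1) 3(2), of h] by (simp add: ext_dev_def)
  qed
qed

text \<open>Since \<open>14\<^sup>2 = 196\<close>, filling in level \<open>0\<close> costs at most
  \<open>196\<close> times the energy, and the remaining levels cost it at most once more.\<close>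

lemma sum_ext_dev_le:
  assumes n: "n \<ge> 3"
  shows "(\<Sum>u\<in>board n. (ext_dev n h u)\<^sup>2) \<le> 197 * rel_energy n h"
proof -
  have z: "0 \<in> board n" using n by (intro zero_in_board) simp
  have "(\<Sum>i<8. (local_dev n h (near n i))\<^sup>2) = (\<Sum>u\<in>near n ` {..<8}. (local_dev n h u)\<^sup>2)"
    by (simp add: sum.reindex[OF inj_on_near[OF n]])
  also have "\<dots> \<le> (\<Sum>u\<in>board n - {0}. (local_dev n h u)\<^sup>2)"
    using n near_in_board[of n] near_nonzero[OF n] by (intro sum_mono2) auto
  also have "\<dots> \<le> rel_energy n h" by (rule sum_local_dev_le[OF n])
  finally have 1: "(\<Sum>i<8. (local_dev n h (near n i))\<^sup>2) \<le> rel_energy n h" .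
  have "(\<Sum>u\<in>board n. (ext_dev n h u)\<^sup>2) = (ext_dev n h 0)\<^sup>2 + (\<Sum>u\<in>board n - {0}. (ext_dev n h u)\<^sup>2)"
    using z by (intro sum.remove) auto
  also have "(ext_dev n h 0)\<^sup>2 = 196 * (\<Sum>i<8. (local_dev n h (near n i))\<^sup>2)"
    by (simp add: ext_dev_def power_mult_distrib sum_nonneg)
  also have "(\<Sum>u\<in>board n - {0}. (ext_dev n h u)\<^sup>2) = (\<Sum>u\<in>board n - {0}. (local_dev n h u)\<^sup>2)"
    by (intro sum.cong) (auto simp: ext_dev_def)
  finally show ?thesis using 1 sum_local_dev_le[OF n, of h] by linarith
qed

text \<open>Here the energy on pairs of squares becomes an oscillation on a two-dimensional torus.
  Every squared step is at most \<open>128\<close> times two squared deviations, so both directions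
  together give \<open>512 * 197 = 100864\<close> times the energy, and \<open>15 * 100864\<close>
  is below the constant chosen.\<close>

lemma level_fun_oscillation:
  assumes n: "n \<ge> 3" and "u \<in> board n" "w \<in> board n"
  shows "(level_fun n h u - level_fun n h w)\<^sup>2 \<le> 1600000 * (1 + ln (real n)) * rel_energy n h"
proof -
  let ?H = "level_fun n h"
  have sq: "(?H (shift_square n v u) - ?H u)\<^sup>2 \<le> 128 * ((ext_dev n h u)\<^sup>2 + (ext_dev n h (shift_square n v u))\<^sup>2)"
    if "u \<in> board n" "v \<in> moves" "v \<noteq> 0" for u v
  proof -
    let ?x = "ext_dev n h u" and ?y = "ext_dev n h (shift_square n v u)"
    have "(?H (shift_square n v u) - ?H u)\<^sup>2 \<le> (8 * (?x + ?y))\<^sup>2"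
      using level_fun_step_ext[OF n that, of h] ext_dev_nonneg[of n h]
      by (simp add: abs_le_square_iff[symmetric])
    also have "\<dots> \<le> 128 * (?x\<^sup>2 + ?y\<^sup>2)"
      using sum_squares_bound[of ?x ?y] by (simp add: power2_sum power_mult_distrib)
    finally show ?thesis .
  qed
  have re: "(\<Sum>u\<in>board n. (ext_dev n h (shift_square n v u))\<^sup>2) = (\<Sum>u\<in>board n. (ext_dev n h u)\<^sup>2)" for v
    using n by (intro sum.reindex_bij_betw bij_betw_shift_square) simp
  have m: "(1, 0) \<in> moves" "(1, 0) \<noteq> (0 :: int \<times> int)" "(0, 1) \<in> moves" "(0, 1) \<noteq> (0 :: int \<times> int)"
    by (auto simp: moves_def zero_prod_def)
  have "(\<Sum>a\<in>board n. (?H (shift_square n (1, 0) a) - ?H a)\<^sup>2 + (?H (shift_square n (0, 1) a) - ?H a)\<^sup>2)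
      \<le> (\<Sum>a\<in>board n. 128 * ((ext_dev n h a)\<^sup>2 + (ext_dev n h (shift_square n (1, 0) a))\<^sup>2)
          + 128 * ((ext_dev n h a)\<^sup>2 + (ext_dev n h (shift_square n (0, 1) a))\<^sup>2))"
    by (intro sum_mono add_mono sq m)
  also have "\<dots> = 512 * (\<Sum>a\<in>board n. (ext_dev n h a)\<^sup>2)"
    by (simp add: sum.distrib sum_distrib_left[symmetric] re)
  also have "\<dots> \<le> 512 * (197 * rel_energy n h)"
    using sum_ext_dev_le[OF n, of h] by simp
  finally have E: "(\<Sum>a\<in>board n. (?H (shift_square n (1, 0) a) - ?H a)\<^sup>2 + (?H (shift_square n (0, 1) a) - ?H a)\<^sup>2)
      \<le> 100864 * rel_energy n h" by simp
  have e0: "rel_energy n h \<ge> 0" unfolding rel_energy_def by (intro sum_nonneg) simp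
  have L: "1 + ln (real n) \<ge> 0" using n by simp
  have "(?H u - ?H w)\<^sup>2 \<le> 15 * (1 + ln (real n)) * (100864 * rel_energy n h)"
    using n L by (intro order_trans[OF board_oscillation[OF _ assms(2,3), of ?H]] mult_left_mono E) auto
  also have "\<dots> = 1512960 * ((1 + ln (real n)) * rel_energy n h)" by simp
  also have "\<dots> \<le> 1600000 * ((1 + ln (real n)) * rel_energy n h)"
    using L e0 by (intro mult_right_mono) auto
  finally show ?thesis by (simp add: mult_ac)
qed

text \<open>The pattern in which rotating a single \<open>2 \<times> 2\<close> block of one configuration matches the tracked piece.\<close>

definition pattern :: "nat \<Rightarrow> (int \<times> int) \<times> int \<times> int" where
  "pattern n = (near n 4, near n 2)"

definition pattern_time :: "nat \<Rightarrow> nat \<Rightarrow> (int \<times> int) \<times> int \<times> int \<Rightarrow> real" where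
  "pattern_time n = trunc_time moves (rel_move n) {pattern n}"

text \<open>As long as the empty square is outside the ring, its relative position is a plain random
  walk on the torus: stepping onto \<open>u\<close> changes only \<open>u\<close>. Once it is in the
  ring, at most \<open>M\<close> more is expected.\<close>

lemma pattern_time_far:
  assumes n: "n \<ge> 3" and M: "\<And>i u. (near n i, u) \<in> rel_states n \<Longrightarrow> pattern_time n k (near n i, u) \<le> M"
    and M0: "M \<ge> 0" and z: "z \<in> rel_states n"
  shows "pattern_time n k z \<le> trunc_time moves (shift_square n) (insert 0 (range (near n))) k (fst z) + M"
proof (rule le_trunc_time[where T = "rel_move n" and U = "rel_states n" and g = fst and k = k])
  fix j z assume z: "z \<in> rel_states n" "fst z \<in> insert 0 (range (near n))" "j \<le> k"
  obtain i where "z = (near n i, snd z)" using z by (cases z) (auto simp: rel_states_def)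
  then have "pattern_time n k z \<le> M" using M z(1) by metis
  then show "pattern_time n j z \<le> M"
    using z(3) trunc_time_mono[of j k moves "rel_move n" "{pattern n}" z] by (simp add: pattern_time_def)
next
  fix v z assume v: "v \<in> moves" and z: "z \<in> rel_states n" "fst z \<notin> insert 0 (range (near n))"
  obtain a u where au: "z = (a, u)" by (cases z)
  have a: "a \<in> board n" "a \<noteq> 0" "a \<notin> range (near n)" using z by (auto simp: au rel_states_def)
  have zb: "0 \<in> board n" using n by (intro zero_in_board) simp
  \<comment> \<open>Recentring happens only when the empty square steps onto the centre, which it
    can do only from a ring square.\<close>
  have "shift_square n v a \<noteq> 0"
  proof
    assume eq: "shift_square n v a = 0"
    then have "v \<noteq> 0" using a shift_square_0[of a n] by auto
    then have "- v \<in> moves" "- v \<noteq> 0" using v by (auto simp: moves_def zero_prod_def)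
    then have "shift_square n (- v) 0 \<in> range (near n)" using unit_near by blast
    then show False using a(3) eq shift_square_eq_iff[OF a(1) zb, of v] by simp
  qed
  then show "fst (rel_move n v z) = shift_square n v (fst z)" by (simp add: au rel_move_def Let_def)
qed (use M0 z in \<open>auto simp: pattern_time_def moves_def rel_move_in_states
    intro!: add_nonneg_nonneg sum_nonneg divide_nonneg_nonneg trunc_time_nonneg\<close>)

lemma card_rel_states_le: "card (rel_states n) \<le> n ^ 4"
proof -
  have "card (rel_states n) \<le> card (board n \<times> board n)"
    by (intro card_mono) (auto simp: rel_states_def)
  then show ?thesis by (simp add: card_cartesian_product card_board power2_eq_square eval_nat_numeral)
qed

text \<open>A self-bounding argument for the maximum \<open>M\<close> over the states with the empty
  square in the ring. The walk towards the ring adds at most \<open>B\<close>; energy and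
  oscillation turn this into \<open>M\<^sup>2 \<le> B * (B + M)\<close>, hence
  \<open>M \<le> 2 * B\<close>.\<close>

lemma pattern_time_bound:
  assumes n: "n \<ge> 3" and z: "z \<in> rel_states n"
  shows "pattern_time n k z \<le> 2 * 10 ^ 8 * (1 + ln (real n)) * real n ^ 4"
proof -
  let ?h = "pattern_time n k"
  let ?L = "1 + ln (real n)"
  let ?N = "{z \<in> rel_states n. fst z \<in> range (near n)}"
  let ?D = "rel_energy n ?h"
  \<comment> \<open>The constant is \<open>5 * 10 ^ 6\<close> from the oscillation times
    \<open>10\<close> from the energy, so that the quadratic inequality involves \<open>B\<close>
    and \<open>M\<close> alone; it also covers the cheaper walk towards the ring.\<close>
  define B where "B = 5 * 10 ^ 7 * (?L * real n ^ 4)"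
  define M where "M = Max (?h ` ?N)"
  have L: "?L \<ge> 1" using n by simp
  have n4: "real n ^ 4 \<ge> (real n)\<^sup>2" using n by (intro power_increasing) auto
  have near_ne: "near n 4 \<noteq> near n 2" "near n 2 \<noteq> 0" "near n 4 \<noteq> 0"
    using inj_onD[OF inj_on_near[OF n], of 4 2] near_nonzero[OF n] by auto
  have pN: "pattern n \<in> ?N" using near_ne n near_in_board[of n] by (auto simp: pattern_def rel_states_def)
  have M_ge: "?h z \<le> M" if "z \<in> ?N" for z unfolding M_def using that by (intro Max_ge) auto
  have "M \<in> ?h ` ?N" unfolding M_def
  proof (rule Max_in)
    show "?h ` ?N \<noteq> {}" using pN by blast
  qed simp
  then obtain z' where z': "z' \<in> rel_states n" "fst z' \<in> range (near n)" "M = ?h z'" by blast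
  then obtain i u where "z' = (near n i, u)" by (cases z') auto
  with z' have z1: "(near n i, u) \<in> rel_states n" "M = ?h (near n i, u)" by simp_all
  have h0: "?h z \<ge> 0" for z unfolding pattern_time_def by (rule trunc_time_nonneg)
  have M0: "M \<ge> 0" using z1 h0 by simp
  have e0: "?D \<ge> 0" unfolding rel_energy_def by (intro sum_nonneg) simp
  have all: "?h z \<le> B + M" if "z \<in> rel_states n" for z
  proof -
    have "?h z \<le> trunc_time moves (shift_square n) (insert 0 (range (near n))) k (fst z) + M"
    proof (rule pattern_time_far[OF n _ M0 that])
      fix i u assume "(near n i, u) \<in> rel_states n"
      then show "?h (near n i, u) \<le> M" by (intro M_ge) simp
    qed
    also have "trunc_time moves (shift_square n) (insert 0 (range (near n))) k (fst z)
        \<le> 30 * card moves * ?L * (real n)\<^sup>2"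
      using n that torus_walk_bound[of n moves id 0 "insert 0 (range (near n))" "fst z" k] zero_in_board[of n]
      by (auto simp: moves_def rel_states_def)
    also have "\<dots> = 150 * (?L * (real n)\<^sup>2)" by simp
    also have "\<dots> \<le> 5 * 10 ^ 7 * (?L * (real n)\<^sup>2)"
      using L by (intro mult_right_mono) auto
    also have "\<dots> \<le> B" unfolding B_def using L n4 by (intro mult_left_mono) auto
    finally show ?thesis by simp
  qed
  have "?D \<le> 2 * card moves * (\<Sum>z\<in>rel_states n. ?h z)"
    unfolding rel_energy_def pattern_time_def
    by (intro trunc_time_dirichlet bij_betw_rel_move) (auto simp: moves_def)
  also have "(\<Sum>z\<in>rel_states n. ?h z) \<le> real (card (rel_states n)) * (B + M)"
    using all by (intro sum_bounded_above) auto
  also have "\<dots> \<le> real n ^ 4 * (B + M)"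
    using card_rel_states_le[of n] M0 L unfolding B_def
    by (intro mult_right_mono) (auto simp flip: of_nat_power)
  finally have D: "?D \<le> 10 * (real n ^ 4 * (B + M))" by simp
  have "M\<^sup>2 \<le> 5 * 10 ^ 6 * (?L * ?D)"
  proof -
    have u: "u \<in> board n" "u \<noteq> 0" "near n i \<noteq> u" using z1 by (auto simp: rel_states_def)
    have nb: "near n 2 \<in> board n" using n by (intro near_in_board) simp
    define x where "x = local_dev n ?h u"
    define y where "y = local_dev n ?h (near n 2)"
    define w where "w = \<bar>level_fun n ?h u - level_fun n ?h (near n 2)\<bar>"
    have "?h (pattern n) = 0" unfolding pattern_time_def by (intro trunc_time_target) simp
    \<comment> \<open>From the worst state to the representative of its level, across the levels,
      and then to the pattern, where the hitting time is \<open>0\<close>.\<close>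
    then have "M \<le> 7 * x + w + 7 * y"
      using level_fun_near[OF n u(2,3), of ?h] level_fun_near[OF n near_ne(2) near_ne(1), of ?h] z1(2)
      unfolding x_def y_def w_def pattern_def by linarith
    then have "M\<^sup>2 \<le> (7 * x + w + 7 * y)\<^sup>2" using M0 by (intro power_mono)
    also have "\<dots> \<le> 3 * (49 * x\<^sup>2 + w\<^sup>2 + 49 * y\<^sup>2)"
      using sum_squares_bound[of "7 * x" w] sum_squares_bound[of w "7 * y"] sum_squares_bound[of "7 * x" "7 * y"]
      by (simp add: power2_eq_square algebra_simps)
    also have "\<dots> \<le> 3 * (49 * ?D + 1600000 * ?L * ?D + 49 * ?D)"
      using local_dev_le[OF n u(1,2), of ?h] local_dev_le[OF n nb near_ne(2), of ?h]
        level_fun_oscillation[OF n u(1) nb, of ?h]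
      unfolding x_def y_def w_def by simp
    \<comment> \<open>The number is \<open>3 * (49 + 1600000 + 49)\<close>, after the two energy
      terms are enlarged by the factor \<open>1 + ln n\<close>.\<close>
    also have "\<dots> \<le> 4800294 * (?L * ?D)"
    proof -
      define LD where "LD = ?L * ?D"
      have le: "?D \<le> LD" using mult_right_mono[OF L e0] by (simp add: LD_def)
      have eq: "1600000 * ?L * ?D = 1600000 * LD" by (simp only: LD_def mult.assoc)
      show ?thesis unfolding LD_def[symmetric] eq using le by simp
    qed
    also have "\<dots> \<le> 5 * 10 ^ 6 * (?L * ?D)" using L e0 by (intro mult_right_mono) auto
    finally show ?thesis .
  qed
  also have "\<dots> \<le> 5 * 10 ^ 6 * (?L * (10 * (real n ^ 4 * (B + M))))"
    using D L by (intro mult_left_mono) auto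
  also have "\<dots> = B * (B + M)" by (simp add: B_def)
  finally have M2: "M * M \<le> B * B + B * M" by (simp add: power2_eq_square algebra_simps)
  have B0: "B \<ge> 0" unfolding B_def using L by simp
  have "M \<le> 2 * B"
  proof (rule ccontr)
    assume "\<not> M \<le> 2 * B"
    then have "0 < (M - 2 * B) * (M + B)" using B0 by (intro mult_pos_pos) auto
    moreover have "0 \<le> B * B" by simp
    ultimately show False using M2 by (simp add: algebra_simps)
  qed
  then have "?h z \<le> 3 * B" using all[OF z] by linarith
  also have "\<dots> \<le> 2 * 10 ^ 8 * (?L * real n ^ 4)" using L by (simp add: B_def)
  finally show ?thesis by (simp only: mult.assoc)
qed

section \<open>The coupling cost\<close>

definition square_diff :: "nat \<Rightarrow> int \<times> int \<Rightarrow> int \<times> int \<Rightarrow> int \<times> int" where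
  "square_diff n p q = shift_square n (- q) p"

lemma square_diff_eq_0: "p \<in> board n \<Longrightarrow> q \<in> board n \<Longrightarrow> square_diff n p q = 0 \<longleftrightarrow> p = q"
proof -
  assume b: "p \<in> board n" "q \<in> board n"
  then have "shift_square n q 0 = q" by (cases q) (auto simp: shift_square_def board_def)
  moreover have "0 \<in> board n" using b by (intro zero_in_board) (auto simp: board_def)
  ultimately show ?thesis using shift_square_eq_iff[OF b(1), of 0 "- q"] by (simp add: square_diff_def)
qed

lemma square_diff_shift_left: "square_diff n (shift_square n v p) q = shift_square n v (square_diff n p q)"
  by (simp add: square_diff_def shift_square_shift_square add.commute)

lemma shift_square_diff_shift: "shift_square n (v - shift_square n w q) p = shift_square n (v - (w + q)) p"
  by (simp add: shift_square_def add_diff_eq mod_diff_right_eq) (simp add: algebra_simps)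

lemma square_diff_shift: "square_diff n (shift_square n v p) (shift_square n w q) = shift_square n (v - w) (square_diff n p q)"
  using shift_square_diff_shift[of n v w q p]
  by (simp add: square_diff_def shift_square_shift_square algebra_simps)

lemma square_diff_shift_right: "shift_square n v (square_diff n p (shift_square n v q)) = square_diff n p q"
  using shift_square_diff_shift[of n v v q p]
  by (simp add: square_diff_def shift_square_shift_square)

lemma square_diff_self: "square_diff n p p = 0"
  by (simp add: square_diff_def shift_square_def zero_prod_def)

lemma square_diff_inj:
  assumes "p \<in> board n" "q \<in> board n"
  shows "square_diff n p r = square_diff n q r \<longleftrightarrow> p = q"
proof -
  have "n > 0" using assms by (auto simp: board_def)
  from bij_betw_shift_square[OF this, of "- r"] show ?thesis
    using assms by (auto simp: square_diff_def bij_betw_def inj_on_def)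
qed

lemma square_diff_in_board: "n > 0 \<Longrightarrow> square_diff n p q \<in> board n"
  by (simp add: square_diff_def shift_square_in_board)

lemma square_diff_eq_shift:
  assumes "p \<in> board n" "q \<in> board n" "square_diff n p q = shift_square n w 0"
  shows "p = shift_square n w q"
proof -
  have "p = shift_square n q (square_diff n p q)"
    using assms(1) by (simp add: square_diff_def shift_square_shift_square shift_square_0)
  also have "\<dots> = shift_square n w (shift_square n q 0)"
    by (simp add: assms(3) shift_square_shift_square add.commute)
  also have "shift_square n q 0 = q" using assms(2) by (cases q) (auto simp: shift_square_def board_def)
  finally show ?thesis .
qed

lemma shift_square_offset_inj:
  assumes "shift_square n v p = shift_square n w p" "\<bar>fst v - fst w\<bar> < int n" "\<bar>snd v - snd w\<bar> < int n"
  shows "v = w"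
proof -
  have "(fst p + fst v) mod int n = (fst p + fst w) mod int n" "(snd p + snd v) mod int n = (snd p + snd w) mod int n"
    using assms(1) by (auto simp: shift_square_def)
  then have "fst p + fst v = fst p + fst w" "snd p + snd v = snd p + snd w"
    using mod_eq_small[of "fst p + fst v" "int n" "fst p + fst w"]
      mod_eq_small[of "snd p + snd v" "int n" "snd p + snd w"] assms(2,3) by simp_all
  then show ?thesis by (auto intro: prod_eqI)
qed

text \<open>The size condition leaves room for a strip of \<open>card D + 1\<close> columns next to
  one further column without wrapping around the board.\<close>

locale puzzle_pair =
  fixes n :: nat and D :: "nat set"
  assumes n_ge: "n \<ge> card D + 3" and finite_D: "finite D" and zero_D: "0 \<notin> D"
begin

abbreviation "A \<equiv> insert 0 D"
abbreviation "S \<equiv> puzzle_states n A"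
abbreviation "mv \<equiv> puzzle_move n A"

definition same_move :: "int \<times> int \<Rightarrow> (nat \<Rightarrow> int \<times> int) \<times> (nat \<Rightarrow> int \<times> int) \<Rightarrow> (nat \<Rightarrow> int \<times> int) \<times> (nat \<Rightarrow> int \<times> int)" where
  "same_move v = map_prod (mv v) (mv v)"

definition sep_move :: "(int \<times> int) \<times> int \<times> int \<Rightarrow> (nat \<Rightarrow> int \<times> int) \<times> (nat \<Rightarrow> int \<times> int) \<Rightarrow> (nat \<Rightarrow> int \<times> int) \<times> (nat \<Rightarrow> int \<times> int)" where
  "sep_move w = map_prod (mv (fst w)) (mv (snd w))"

definition meet_time :: "nat \<Rightarrow> (nat \<Rightarrow> int \<times> int) \<times> (nat \<Rightarrow> int \<times> int) \<Rightarrow> real" where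
  "meet_time = opt_time moves same_move (moves \<times> moves) sep_move {z. fst z = snd z}"

lemma meet_time_nonneg: "meet_time k z \<ge> 0"
  unfolding meet_time_def by (rule opt_time_nonneg)

lemma meet_time_mono: "j \<le> k \<Longrightarrow> meet_time j z \<le> meet_time k z"
  unfolding meet_time_def by (rule opt_time_mono)

lemma meet_time_eq: "meet_time k (x, x) = 0"
  unfolding meet_time_def by (rule opt_time_target) simp

lemma meet_time_same: "meet_time (Suc k) z \<le> 1 + (\<Sum>v\<in>moves. meet_time k (same_move v z)) / card moves"
  using opt_time_le(1) unfolding meet_time_def average_def .

lemma meet_time_sep: "meet_time (Suc k) z \<le> 1 + (\<Sum>w\<in>moves \<times> moves. meet_time k (sep_move w z)) / card (moves \<times> moves)"
  using opt_time_le(2) unfolding meet_time_def average_def .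

lemma n_pos: "n > 0" using n_ge by simp

lemma state_board: "x \<in> S \<Longrightarrow> j \<in> A \<Longrightarrow> x j \<in> board n"
  by (auto simp: puzzle_states_def)

lemma state_inj: "x \<in> S \<Longrightarrow> i \<in> A \<Longrightarrow> j \<in> A \<Longrightarrow> x i = x j \<longleftrightarrow> i = j"
  by (auto simp: puzzle_states_def inj_on_def)

lemma state_eqI:
  assumes "x \<in> S" "y \<in> S" "\<And>j. j \<in> A \<Longrightarrow> x j = y j"
  shows "x = y"
  using assms by (auto simp: puzzle_states_def intro: PiE_ext)

lemma mv_in_S: "x \<in> S \<Longrightarrow> mv v x \<in> S"
  by (intro puzzle_move_in_states) auto

lemma mv_empty: "mv v x 0 = shift_square n v (x 0)"
  by (simp add: puzzle_move_def)

lemma mv_piece: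
  assumes "x \<in> S" "j \<in> D"
  shows "mv v x j = (if x j = shift_square n v (x 0) then x 0 else x j)"
proof -
  have "j \<noteq> 0" using assms(2) zero_D by metis
  then have "x j \<noteq> x 0" using state_inj[OF assms(1), of j 0] assms(2) by simp
  then show ?thesis using assms(2) by (simp add: puzzle_move_def Transposition.transpose_def)
qed

lemma same_move_in: "z \<in> S \<times> S \<Longrightarrow> same_move v z \<in> S \<times> S"
  by (auto simp: same_move_def mv_in_S)

lemma sep_move_in: "z \<in> S \<times> S \<Longrightarrow> sep_move w z \<in> S \<times> S"
  by (auto simp: sep_move_def mv_in_S)

definition matched :: "(nat \<Rightarrow> int \<times> int) \<times> (nat \<Rightarrow> int \<times> int) \<Rightarrow> nat set" where
  "matched z = {j \<in> D. fst z j = snd z j}"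

definition common_empty :: "((nat \<Rightarrow> int \<times> int) \<times> (nat \<Rightarrow> int \<times> int)) set" where
  "common_empty = {z \<in> S \<times> S. fst z 0 = snd z 0}"

lemma same_move_common_empty: "z \<in> common_empty \<Longrightarrow> same_move v z \<in> common_empty"
  by (auto simp: common_empty_def same_move_def mv_in_S mv_empty)

text \<open>With equal empty squares the same transposition of squares acts on both configurations,
  so agreement of a piece is neither created nor destroyed.\<close>

lemma same_move_eq_iff:
  assumes "z \<in> common_empty" "j \<in> D"
  shows "fst (same_move v z) j = snd (same_move v z) j \<longleftrightarrow> fst z j = snd z j"
proof -
  have "j \<noteq> 0" using assms(2) zero_D by metis
  then have "fst z j \<noteq> fst z 0" "snd z j \<noteq> snd z 0"
    using assms state_inj[of "fst z" j 0] state_inj[of "snd z" j 0] by (auto simp: common_empty_def)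
  then show ?thesis
    using assms by (auto simp: common_empty_def same_move_def mv_piece split: if_splits)
qed

lemma matched_same_move: "z \<in> common_empty \<Longrightarrow> matched (same_move v z) = matched z"
  by (auto simp: matched_def same_move_eq_iff)

text \<open>Under separate moves the difference of the empty squares is a random walk on the torus
  with increments \<open>fst w - snd w\<close>. The constant is \<open>30 * 25\<close>, as there are
  \<open>25\<close> pairs of moves.\<close>

lemma meet_time_common_empty:
  assumes M: "\<And>z. z \<in> common_empty \<Longrightarrow> meet_time k z \<le> M" and z: "z \<in> S \<times> S"
  shows "meet_time k z \<le> 750 * (1 + ln (real n)) * (real n)\<^sup>2 + M"
proof -
  define g where "g = (\<lambda>z :: (nat \<Rightarrow> int \<times> int) \<times> (nat \<Rightarrow> int \<times> int). square_diff n (fst z 0) (snd z 0))"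
  define \<sigma> where "\<sigma> = (\<lambda>w :: (int \<times> int) \<times> int \<times> int. fst w - snd w)"
  have zeroM: "(0, 0) \<in> moves" by (simp add: moves_def)
  have M0: "0 \<le> M"
  proof -
    have "(fst z, fst z) \<in> common_empty" using z by (auto simp: common_empty_def)
    from M[OF this] show ?thesis by (simp add: meet_time_eq)
  qed
  have "meet_time k z \<le> trunc_time (moves \<times> moves) (\<lambda>w. shift_square n (\<sigma> w)) {0} k (g z) + M"
  proof (rule le_trunc_time[where T = sep_move and U = "S \<times> S" and k = k])
    fix j z assume z: "z \<in> S \<times> S" "g z \<in> {0}" "j \<le> k"
    then have "fst z 0 = snd z 0"
      using square_diff_eq_0[of "fst z 0" n "snd z 0"] state_board[of _ 0] by (auto simp: g_def)
    then have "z \<in> common_empty" using z by (simp add: common_empty_def)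
    then show "meet_time j z \<le> M" using M[of z] meet_time_mono[OF z(3), of z] by linarith
  next
    fix w z
    show "g (sep_move w z) = shift_square n (\<sigma> w) (g z)"
      by (simp add: g_def \<sigma>_def sep_move_def mv_empty square_diff_shift)
    show "meet_time 0 z \<le> M" for z using M0 by (simp add: meet_time_def)
    show "finite (moves \<times> moves)" by simp
    show "moves \<times> moves \<noteq> {}" using zeroM by blast
  qed (rule z sep_move_in meet_time_sep order_refl | assumption)+
  also have "trunc_time (moves \<times> moves) (\<lambda>w. shift_square n (\<sigma> w)) {0} k (g z)
      \<le> 30 * card (moves \<times> moves) * (1 + ln (real n)) * (real n)\<^sup>2"
  proof (rule torus_walk_bound[where ?a0.0 = 0])
    show "(1, 0) \<in> \<sigma> ` (moves \<times> moves)"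
      by (rule image_eqI[of _ _ "((1, 0), (0, 0))"]) (auto simp: \<sigma>_def moves_def)
    show "(0, 1) \<in> \<sigma> ` (moves \<times> moves)"
      by (rule image_eqI[of _ _ "((0, 1), (0, 0))"]) (auto simp: \<sigma>_def moves_def)
  qed (use n_ge in \<open>auto simp: zero_in_board g_def square_diff_in_board\<close>)
  finally show ?thesis by (simp add: card_cartesian_product)
qed

definition piece_rel :: "nat \<Rightarrow> (nat \<Rightarrow> int \<times> int) \<times> (nat \<Rightarrow> int \<times> int) \<Rightarrow> (int \<times> int) \<times> int \<times> int" where
  "piece_rel i z = (square_diff n (fst z 0) (fst z i), square_diff n (snd z i) (fst z i))"

lemma piece_rel_in:
  assumes z: "z \<in> common_empty" and i: "i \<in> D" "fst z i \<noteq> snd z i"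
  shows "piece_rel i z \<in> rel_states n"
proof -
  have S: "fst z \<in> S" "snd z \<in> S" "fst z 0 = snd z 0" using z by (auto simp: common_empty_def)
  have i0: "i \<noteq> 0" using i(1) zero_D by metis
  have b: "fst z 0 \<in> board n" "fst z i \<in> board n" "snd z i \<in> board n"
    using S i state_board by auto
  have ne: "fst z 0 \<noteq> fst z i" "fst z 0 \<noteq> snd z i"
    using state_inj[OF S(1), of 0 i] state_inj[OF S(2), of 0 i] S(3) i i0 by auto
  show ?thesis
    using b ne i n_pos
    by (simp add: piece_rel_def rel_states_def square_diff_in_board square_diff_eq_0 square_diff_inj)
qed

text \<open>This identifies the motion of an unmatched piece under common moves with the relative
  chain, so the bound on its hitting time applies.\<close>

lemma piece_rel_same_move:
  assumes z: "z \<in> common_empty" and i: "i \<in> D" "fst z i \<noteq> snd z i"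
  shows "piece_rel i (same_move v z) = rel_move n v (piece_rel i z)"
proof -
  obtain x y where xy: "z = (x, y)" by (cases z)
  have S: "x \<in> S" "y \<in> S" "y 0 = x 0" using z by (auto simp: common_empty_def xy)
  let ?e = "x 0" and ?e' = "shift_square n v (x 0)"
  have b: "x i \<in> board n" "y i \<in> board n" using S i state_board by auto
  have e': "?e' \<in> board n" using n_pos by (rule shift_square_in_board)
  have ne: "x i \<noteq> y i" using i by (simp add: xy)
  have rel: "rel_move n v (piece_rel i z) = (if ?e' = x i then (shift_square n v 0, shift_square n v (square_diff n (y i) (x i)))
      else if ?e' = y i then (square_diff n ?e' (x i), square_diff n ?e (x i))
      else (square_diff n ?e' (x i), square_diff n (y i) (x i)))"
    using b e' by (simp add: rel_move_def piece_rel_def xy Let_def square_diff_shift_left[symmetric]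
        square_diff_eq_0 square_diff_inj)
  have "piece_rel i (same_move v z) = (square_diff n ?e' (if x i = ?e' then ?e else x i),
      square_diff n (if y i = ?e' then ?e else y i) (if x i = ?e' then ?e else x i))"
    using S i by (simp add: piece_rel_def same_move_def xy mv_empty mv_piece)
  also have "\<dots> = rel_move n v (piece_rel i z)"
  proof (cases "?e' = x i")
    case True
    \<comment> \<open>The first copy of the piece moves to the old empty square, which becomes the
      new centre.\<close>
    then have "shift_square n v (square_diff n (y i) (x i)) = square_diff n (y i) ?e"
      using square_diff_shift_right[of n v "y i" ?e] by simp
    moreover have "square_diff n ?e' ?e = shift_square n v 0"
      by (simp add: square_diff_shift_left square_diff_self)
    ultimately show ?thesis using True ne unfolding rel by auto
  next
    case False
    then show ?thesis unfolding rel by auto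
  qed
  finally show ?thesis .
qed

text \<open>The strategy is to use common moves until the pattern appears. They preserve the matched
  pieces, so the count \<open>q\<close> is still available when \<open>N\<close> is applied.\<close>

lemma meet_time_pattern:
  assumes N: "\<And>z. z \<in> common_empty \<Longrightarrow> fst z i \<noteq> snd z i \<Longrightarrow> q \<le> card (matched z) \<Longrightarrow>
      piece_rel i z = pattern n \<Longrightarrow> meet_time k z \<le> N"
    and N0: "0 \<le> N" and i: "i \<in> D" "fst z i \<noteq> snd z i" and z: "z \<in> common_empty" "q \<le> card (matched z)"
  shows "meet_time k z \<le> 2 * 10 ^ 8 * (1 + ln (real n)) * real n ^ 4 + N"
proof -
  define U where "U = {z \<in> common_empty. fst z i \<noteq> snd z i \<and> q \<le> card (matched z)}"
  have "meet_time k z \<le> trunc_time moves (rel_move n) {pattern n} k (piece_rel i z) + N"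
  proof (rule le_trunc_time[where T = same_move and U = U and k = k])
    fix j z assume z: "z \<in> U" "piece_rel i z \<in> {pattern n}" "j \<le> k"
    then have "meet_time k z \<le> N" by (intro N) (auto simp: U_def)
    then show "meet_time j z \<le> N" using meet_time_mono[OF z(3), of z] by linarith
  next
    fix v z assume z: "z \<in> U"
    then show "same_move v z \<in> U"
      using i(1) by (simp add: U_def same_move_common_empty matched_same_move same_move_eq_iff)
    show "piece_rel i (same_move v z) = rel_move n v (piece_rel i z)"
      using z i(1) by (intro piece_rel_same_move) (auto simp: U_def)
  next
    show "z \<in> U" using z i by (simp add: U_def)
    show "meet_time 0 z \<le> N" for z using N0 by (simp add: meet_time_def)
    show "moves \<noteq> {}" by (simp add: moves_def)
  qed (rule finite_moves meet_time_same order_refl)+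
  also have "trunc_time moves (rel_move n) {pattern n} k (piece_rel i z) \<le> 2 * 10 ^ 8 * (1 + ln (real n)) * real n ^ 4"
    using pattern_time_bound[OF _ piece_rel_in[OF z(1) i], of k] n_ge by (simp add: pattern_time_def)
  finally show ?thesis by simp
qed

section \<open>Prescribed walks of the empty squares\<close>

definition walk :: "(int \<times> int) list \<Rightarrow> (nat \<Rightarrow> int \<times> int) \<Rightarrow> nat \<Rightarrow> int \<times> int" where
  "walk = fold mv"

lemma walk_simps [simp]: "walk [] x = x" "walk (v # ws) x = walk ws (mv v x)"
  "walk (vs @ ws) x = walk ws (walk vs x)"
  by (simp_all add: walk_def)

lemma walk_in_S: "x \<in> S \<Longrightarrow> walk ws x \<in> S"
  by (induction ws arbitrary: x) (auto intro: mv_in_S)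

text \<open>Under separate moves a desired pair of moves has probability \<open>1 / 25\<close>; for
  every other pair the worst value \<open>M\<close> is charged.\<close>

lemma meet_time_sep_step:
  assumes M: "\<And>z. z \<in> S \<times> S \<Longrightarrow> meet_time k z \<le> M" and xy: "x \<in> S" "y \<in> S"
    and v: "v \<in> moves" "w \<in> moves"
  shows "meet_time k (x, y) \<le> 1 + M - (M - meet_time k (mv v x, mv w y)) / 25"
proof -
  let ?f = "\<lambda>p. meet_time k (sep_move p (x, y))"
  \<comment> \<open>Monotonicity lets the same horizon \<open>k\<close> serve on both sides, so that
    the estimate can be iterated.\<close>
  have "meet_time k (x, y) \<le> meet_time (Suc k) (x, y)" by (rule meet_time_mono) simp
  also have "\<dots> \<le> 1 + (\<Sum>p\<in>moves \<times> moves. ?f p) / card (moves \<times> moves)" by (rule meet_time_sep)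
  also have "(\<Sum>p\<in>moves \<times> moves. ?f p) = ?f (v, w) + (\<Sum>p\<in>moves \<times> moves - {(v, w)}. ?f p)"
    using v by (intro sum.remove) auto
  also have "\<dots> \<le> ?f (v, w) + of_nat (card (moves \<times> moves - {(v, w)})) * M"
    using xy by (intro add_left_mono sum_bounded_above M sep_move_in) auto
  also have "card (moves \<times> moves - {(v, w)}) = 24"
    using v by (simp add: card_Diff_subset card_cartesian_product)
  finally show ?thesis
    by (simp add: card_cartesian_product sep_move_def divide_right_mono) (simp add: field_simps)
qed

lemma meet_time_walk:
  fixes M :: real
  assumes M: "\<And>z. z \<in> S \<times> S \<Longrightarrow> meet_time k z \<le> M"
    and "length ws = length ws'" "x \<in> S" "y \<in> S" "set ws \<subseteq> moves" "set ws' \<subseteq> moves"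
  shows "meet_time k (x, y) \<le> length ws + M - (1 / 25) ^ length ws * (M - meet_time k (walk ws x, walk ws' y))"
  using assms(2-)
proof (induction ws ws' arbitrary: x y rule: list_induct2)
  case (Cons v ws w ws')
  define Q where "Q = (1 / 25) ^ length ws * (M - meet_time k (walk ws (mv v x), walk ws' (mv w y)))"
  have "meet_time k (x, y) \<le> 1 + M - (M - meet_time k (mv v x, mv w y)) / 25"
    using Cons.prems by (intro meet_time_sep_step M) auto
  moreover have "meet_time k (mv v x, mv w y) \<le> length ws + M - Q"
    unfolding Q_def using Cons.prems by (intro Cons.IH mv_in_S) auto
  ultimately have "meet_time k (x, y) \<le> 1 + real (length ws) + M - Q / 25"
    using of_nat_0_le_iff[of "length ws", where 'a = real] unfolding diff_divide_distrib by argo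
  then show ?case by (simp add: Q_def)
qed simp

text \<open>Since the path does not meet itself, the empty square enters each of its squares once,
  so a piece is pulled back by one place at most once.\<close>

lemma walk_path:
  assumes x: "x \<in> S" "x 0 = c 0" and c: "inj_on c {..m}" "\<And>i. i < m \<Longrightarrow> shift_square n (v i) (c i) = c (Suc i)"
    and "r \<le> m"
  shows "walk (map v [0..<r]) x 0 = c r \<and>
    (\<forall>j\<in>D. (\<forall>t<r. x j = c (Suc t) \<longrightarrow> walk (map v [0..<r]) x j = c t) \<and>
      ((\<forall>t<r. x j \<noteq> c (Suc t)) \<longrightarrow> walk (map v [0..<r]) x j = x j))"
  using \<open>r \<le> m\<close>
proof (induction r)
  case 0
  then show ?case by (simp add: x)
next
  case (Suc r)
  let ?x = "walk (map v [0..<r]) x"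
  have IH: "?x 0 = c r" "\<And>j t. j \<in> D \<Longrightarrow> t < r \<Longrightarrow> x j = c (Suc t) \<Longrightarrow> ?x j = c t"
    "\<And>j. j \<in> D \<Longrightarrow> \<forall>t<r. x j \<noteq> c (Suc t) \<Longrightarrow> ?x j = x j"
    using Suc by auto
  have xS: "?x \<in> S" by (rule walk_in_S[OF x(1)])
  have next_c: "shift_square n (v r) (c r) = c (Suc r)" using Suc.prems by (intro c) simp
  have c_eq: "c i = c j \<longleftrightarrow> i = j" if "i \<le> Suc r" "j \<le> Suc r" for i j
    using c(1) that Suc.prems by (auto simp: inj_on_def)
  have eq: "walk (map v [0..<Suc r]) x = mv (v r) ?x" by simp
  have step: "mv (v r) ?x j = (if ?x j = c (Suc r) then c r else ?x j)" if "j \<in> D" for j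
    using mv_piece[OF xS that, of "v r"] by (simp add: IH(1) next_c)
  show ?case
    unfolding eq
  proof (intro conjI ballI allI impI)
    show "mv (v r) ?x 0 = c (Suc r)" by (simp add: mv_empty IH(1) next_c)
  next
    fix j t assume j: "j \<in> D" and t: "t < Suc r" "x j = c (Suc t)"
    show "mv (v r) ?x j = c t"
    proof (cases "t = r")
      case True
      then have "?x j = c (Suc r)" using IH(3)[OF j] t c_eq by auto
      then show ?thesis using step[OF j] True by simp
    next
      case False
      then show ?thesis using step[OF j] IH(2)[OF j _ t(2)] t c_eq[of t "Suc r"] by simp
    qed
  next
    fix j assume j: "j \<in> D" and t: "\<forall>t<Suc r. x j \<noteq> c (Suc t)"
    then have "?x j = x j" "x j \<noteq> c (Suc r)" using IH(3)[OF j] by auto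
    then show "mv (v r) ?x j = x j" using step[OF j] by simp
  qed
qed

text \<open>Closing the path: the piece from \<open>c 1\<close>, pulled to \<open>c 0\<close>, is
  swapped once more by the last move and lands on \<open>c m\<close>. One round thus rotates the
  pieces of the loop by one place, skipping the empty square.\<close>

lemma walk_loop:
  assumes x: "x \<in> S" "x 0 = c 0" and m: "1 \<le> m" and inj: "inj_on c {..m}"
    and c: "\<And>i. i < m \<Longrightarrow> shift_square n (v i) (c i) = c (Suc i)" "shift_square n (v m) (c m) = c 0"
  defines "x' \<equiv> walk (map v [0..<Suc m]) x"
  shows "x' 0 = c 0"
    and "\<And>j t. j \<in> D \<Longrightarrow> 2 \<le> t \<Longrightarrow> t \<le> m \<Longrightarrow> x j = c t \<Longrightarrow> x' j = c (t - 1)"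
    and "\<And>j. j \<in> D \<Longrightarrow> x j = c 1 \<Longrightarrow> x' j = c m"
    and "\<And>j. j \<in> D \<Longrightarrow> x j \<notin> c ` {..m} \<Longrightarrow> x' j = x j"
proof -
  let ?x = "walk (map v [0..<m]) x"
  have P: "?x 0 = c m" "\<And>j t. j \<in> D \<Longrightarrow> t < m \<Longrightarrow> x j = c (Suc t) \<Longrightarrow> ?x j = c t"
    "\<And>j. j \<in> D \<Longrightarrow> \<forall>t<m. x j \<noteq> c (Suc t) \<Longrightarrow> ?x j = x j"
    using walk_path[OF x inj c(1) order_refl] by auto
  have c_eq: "c i = c j \<longleftrightarrow> i = j" if "i \<le> m" "j \<le> m" for i j
    using inj that by (auto simp: inj_on_def)
  have x': "x' = mv (v m) ?x" by (simp add: x'_def)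
  have xS: "?x \<in> S" by (rule walk_in_S[OF x(1)])
  show "x' 0 = c 0" by (simp add: x' mv_empty P(1) c(2))
  have step: "x' j = (if ?x j = c 0 then c m else ?x j)" if "j \<in> D" for j
    using mv_piece[OF xS that, of "v m"] by (simp add: x' P(1) c(2))
  fix j assume j: "j \<in> D"
  show "x' j = c (t - 1)" if t: "2 \<le> t" "t \<le> m" "x j = c t" for t
    using step[OF j] P(2)[OF j, of "t - 1"] t c_eq[of "t - 1" 0] by simp
  show "x' j = c m" if "x j = c 1"
    using step[OF j] P(2)[OF j, of 0] that m by simp
  show "x' j = x j" if "x j \<notin> c ` {..m}"
  proof -
    have "\<forall>i<m. x j \<noteq> c (Suc i)" "x j \<noteq> c 0" using that by (auto simp: Suc_le_eq)
    then show ?thesis using step[OF j] P(3)[OF j] by simp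
  qed
qed

lemma walk_common_empty:
  assumes "(x, y) \<in> common_empty"
  shows "(walk ws x, walk ws y) \<in> common_empty \<and> matched (walk ws x, walk ws y) = matched (x, y)"
  using assms
proof (induction ws arbitrary: x y)
  case (Cons v ws)
  have "(mv v x, mv v y) = same_move v (x, y)" by (simp add: same_move_def)
  then show ?case
    using Cons.IH[of "mv v x" "mv v y"] same_move_common_empty[OF Cons.prems, of v]
      matched_same_move[OF Cons.prems, of v] by simp
qed simp

text \<open>A cycle through a block of \<open>2\<close> by \<open>card D + 1\<close> squares that
  starts at the empty square: up, along the upper row to the left, and back along the lower row.
  \<open>strip 1\<close> is the square above the start, the fourth corner of the block in the
  pattern.\<close>

definition strip :: "nat \<Rightarrow> int \<times> int" where
  "strip t = (if t = 0 then (0, 0) else if t \<le> card D + 1 then (1 - int t, 1)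
    else (int t - 2 * int (card D) - 2, 0))"

definition strip_move :: "nat \<Rightarrow> int \<times> int" where
  "strip_move t = (if t = 0 then (0, 1) else if t \<le> card D then (-1, 0)
    else if t = card D + 1 then (0, -1) else (1, 0))"

lemma strip_bounds:
  assumes "t \<le> 2 * card D + 1"
  shows "- int (card D) \<le> fst (strip t)" "fst (strip t) \<le> 0" "0 \<le> snd (strip t)" "snd (strip t) \<le> 1"
  using assms by (simp_all add: strip_def)

lemma strip_inj:
  assumes "t \<le> 2 * card D + 1" "s \<le> 2 * card D + 1" "strip t = strip s"
  shows "t = s"
proof -
  consider "t = 0" | "1 \<le> t" "t \<le> card D + 1" | "card D + 1 < t" by linarith
  moreover consider "s = 0" | "1 \<le> s" "s \<le> card D + 1" | "card D + 1 < s" by linarith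
  ultimately show ?thesis using assms by cases (simp_all add: strip_def split: if_splits)
qed

lemma strip_step:
  assumes "s < 2 * card D + 1"
  shows "strip (Suc s) = strip_move s + strip s"
proof -
  consider "s = 0" | "1 \<le> s" "s \<le> card D" | "s = card D + 1" | "card D + 1 < s" by linarith
  then show ?thesis using assms by cases (simp_all add: strip_def strip_move_def)
qed

lemma strip_distinct:
  assumes "t \<le> 2 * card D + 1" "s \<le> 2 * card D + 1" "shift_square n (strip t) e = shift_square n (strip s) e"
  shows "t = s"
proof -
  have "strip t = strip s"
  proof (rule shift_square_offset_inj[OF assms(3)])
    show "\<bar>fst (strip t) - fst (strip s)\<bar> < int n" "\<bar>snd (strip t) - snd (strip s)\<bar> < int n"
      using strip_bounds[OF assms(1)] strip_bounds[OF assms(2)] n_ge by linarith+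
  qed
  then show ?thesis by (rule strip_inj[OF assms(1,2)])
qed

text \<open>Offsets with first coordinate \<open>1\<close> are where the two copies of the tracked
  piece sit, so circling the strip does not touch them.\<close>

lemma strip_avoids:
  assumes "t \<le> 2 * card D + 1" "fst w = 1" "0 \<le> snd w" "snd w \<le> 1"
  shows "shift_square n (strip t) e \<noteq> shift_square n w e"
proof
  assume eq: "shift_square n (strip t) e = shift_square n w e"
  have "strip t = w"
  proof (rule shift_square_offset_inj[OF eq])
    show "\<bar>fst (strip t) - fst w\<bar> < int n" "\<bar>snd (strip t) - snd w\<bar> < int n"
      using strip_bounds[OF assms(1)] assms(2-) n_ge by linarith+
  qed
  then show False using strip_bounds(2)[OF assms(1)] assms(2) by simp
qed

text \<open>Each round of the strip moves its contents one place back, so if place \<open>t\<close>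
  has no matched piece, then afterwards place \<open>t - 1\<close> has none. After
  \<open>t - 1\<close> rounds this is the square above the empty one. Both copies of piece
  \<open>i\<close> lie off the strip and stay put.\<close>

lemma free_square_walk:
  assumes "(x, y) \<in> common_empty" "i \<in> D"
    and "x i = shift_square n (1, 0) (x 0)" "y i = shift_square n (1, 1) (x 0)"
    and "1 \<le> t" "t \<le> 2 * card D + 1"
    and "\<And>j. j \<in> matched (x, y) \<Longrightarrow> x j \<noteq> shift_square n (strip t) (x 0)"
  shows "\<exists>ws. set ws \<subseteq> moves \<and> length ws \<le> (t - 1) * (2 * card D + 2) \<and>
    walk ws x 0 = x 0 \<and> walk ws x i = x i \<and> walk ws y i = y i \<and>
    (\<forall>j\<in>matched (x, y). walk ws x j \<noteq> shift_square n (0, 1) (x 0))"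
  using assms(1,3-)
proof (induction t arbitrary: x y)
  case (Suc t)
  show ?case
  proof (cases "t = 0")
    case True
    then show ?thesis using Suc.prems(6) by (intro exI[of _ "[]"]) (simp add: strip_def)
  next
    case False
    let ?e = "x 0"
    let ?m = "2 * card D + 1"
    define c where "c s = shift_square n (strip s) ?e" for s
    define ws where "ws = map strip_move [0..<Suc ?m]"
    have S: "x \<in> S" "y \<in> S" "y 0 = ?e" using Suc.prems(1) by (auto simp: common_empty_def)
    have "card D \<noteq> 0" using assms(2) finite_D by auto
      then have "strip_move ?m + strip ?m = strip 0" by (simp add: strip_def strip_move_def)
    then have c_step: "\<And>s. s < ?m \<Longrightarrow> shift_square n (strip_move s) (c s) = c (Suc s)"
      "shift_square n (strip_move ?m) (c ?m) = c 0"
      by (simp_all only: c_def shift_square_shift_square strip_step)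
    have inj: "inj_on c {..?m}" unfolding c_def by (intro inj_onI strip_distinct) auto
    have c0: "?e = c 0"
      using state_board[OF S(1), of 0] by (simp add: c_def strip_def shift_square_0 flip: zero_prod_def)
    note Lx = walk_loop[OF S(1) c0 _ inj c_step, folded ws_def]
    note Ly = walk_loop[OF S(2) S(3)[unfolded c0] _ inj c_step, folded ws_def]
    have off: "x i \<notin> c ` {..?m}" "y i \<notin> c ` {..?m}"
      using strip_avoids[of _ "(1, 0)" ?e, symmetric] strip_avoids[of _ "(1, 1)" ?e, symmetric]
      unfolding Suc.prems(2,3) c_def by auto
    have fix_i: "walk ws x 0 = ?e" "walk ws x i = x i" "walk ws y i = y i"
      using Lx(1,4) Ly(4) assms(2) off c0 by simp_all
    have comm: "(walk ws x, walk ws y) \<in> common_empty" "matched (walk ws x, walk ws y) = matched (x, y)"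
      using walk_common_empty[OF Suc.prems(1), of ws] by auto
    have free: "walk ws x j \<noteq> shift_square n (strip t) (walk ws x 0)" if j: "j \<in> matched (walk ws x, walk ws y)" for j
    proof -
      have jm: "j \<in> matched (x, y)" using j unfolding comm(2) .
      have jD: "j \<in> D" "x j \<noteq> c (Suc t)"
        using jm Suc.prems(6)[OF jm] by (simp_all add: c_def matched_def)
      have c_eq: "c s = c t \<longleftrightarrow> s = t" if "s \<le> ?m" for s
        using inj that Suc.prems(5) by (auto simp: inj_on_def)
      consider "x j \<notin> c ` {..?m}" | "x j = c 1" | s where "2 \<le> s" "s \<le> ?m" "x j = c s" | "x j = c 0"
      proof (cases "x j \<in> c ` {..?m}")
        case True
        then obtain s where s: "s \<le> ?m" "x j = c s" by blast
        consider "s = 0" | "s = 1" | "2 \<le> s" by linarith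
        then show ?thesis using s that(2,4) that(3)[of s] by cases simp_all
      qed (use that(1) in blast)
      then have "walk ws x j \<noteq> c t"
      proof cases
        case 1
        then show ?thesis using Lx(4)[OF _ _ jD(1)] Suc.prems(5) by auto
      next
        case 2
        \<comment> \<open>This piece wraps round to the last place, and
          \<open>Suc t \<le> ?m\<close> excludes \<open>t = ?m\<close>.\<close>
        then show ?thesis using Lx(3)[OF _ _ jD(1)] c_eq[of ?m] Suc.prems(5) by simp
      next
        case 3
        have "s - 1 \<noteq> t" using 3 jD(2) by auto
        then show ?thesis using Lx(2)[OF _ _ jD(1) 3] c_eq[of "s - 1"] 3 by simp
      next
        case 4
        then show ?thesis using state_inj[OF S(1), of j 0] jD(1) zero_D c0 by auto
      qed
      then show ?thesis by (simp add: fix_i c_def)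
    qed
    have prem: "walk ws x i = shift_square n (1, 0) (walk ws x 0)" "walk ws y i = shift_square n (1, 1) (walk ws x 0)"
      using fix_i Suc.prems(2,3) by simp_all
    obtain ws' where ws': "set ws' \<subseteq> moves" "length ws' \<le> (t - 1) * (2 * card D + 2)"
      "walk ws' (walk ws x) 0 = ?e" "walk ws' (walk ws x) i = x i" "walk ws' (walk ws y) i = y i"
      "\<forall>j\<in>matched (x, y). walk ws' (walk ws x) j \<noteq> shift_square n (0, 1) ?e"
      using Suc.IH[OF comm(1) prem _ _ free] False Suc.prems(5) unfolding comm(2) fix_i by auto
    have len: "length ws = 2 * card D + 2" by (simp add: ws_def)
    have "set ws \<subseteq> moves" by (auto simp: ws_def strip_move_def moves_def)
    moreover have "length ws + length ws' \<le> t * (2 * card D + 2)"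
      using ws'(2) False unfolding len by (cases t) auto
    ultimately show ?thesis
      using ws' by (intro exI[of _ "ws @ ws'"]) (simp add: add.commute)
  qed
qed simp

section \<open>Matching one more piece\<close>

lemma mv_0:
  assumes "y \<in> S"
  shows "mv 0 y = y"
proof (rule state_eqI[OF mv_in_S[OF assms] assms])
  fix j assume "j \<in> A"
  have e: "shift_square n 0 (y 0) = y 0" using assms by (intro shift_square_0 state_board) auto
  show "mv 0 y j = y j"
  proof (cases "j = 0")
    case True
    then show ?thesis by (simp only: mv_empty e)
  next
    case False
    then show ?thesis using mv_piece[OF assms, of j 0] \<open>j \<in> A\<close> unfolding e by simp
  qed
qed

text \<open>The first empty square circles the \<open>2 \<times> 2\<close> block, which carries
  piece \<open>i\<close> to its square in the second configuration. No matched piece lies in the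
  block: two of its squares hold \<open>i\<close> in one of the configurations, one is empty, and
  the last is free by assumption.\<close>

lemma rotation_gain:
  assumes z: "(x, y) \<in> common_empty" and i: "i \<in> D"
    and xi: "x i = shift_square n (1, 0) (x 0)" and yi: "y i = shift_square n (1, 1) (x 0)"
    and free: "\<And>j. j \<in> matched (x, y) \<Longrightarrow> x j \<noteq> shift_square n (0, 1) (x 0)"
  defines "x' \<equiv> walk [(0, 1), (1, 0), (0, -1), (-1, 0)] x"
  shows "(x', y) \<in> common_empty \<and> card (matched (x, y)) < card (matched (x', y))"
proof -
  let ?e = "x 0"
  define off :: "nat \<Rightarrow> int \<times> int" where "off t = [(0, 0), (0, 1), (1, 1), (1, 0)] ! t" for t
  define v :: "nat \<Rightarrow> int \<times> int" where "v t = [(0, 1), (1, 0), (0, -1), (-1, 0)] ! t" for t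
  define c where "c t = shift_square n (off t) ?e" for t
  have S: "x \<in> S" "y \<in> S" "y 0 = ?e" using z by (auto simp: common_empty_def)
  have c0: "?e = c 0"
    using state_board[OF S(1), of 0] by (simp add: c_def off_def shift_square_0 flip: zero_prod_def)
  have "v s + off s = off (Suc s)" if "s < 3" for s
  proof -
    have "s \<in> {0, 1, 2}" using that unfolding insert_iff empty_iff by linarith
    then show ?thesis by (auto simp: off_def v_def)
  qed
  moreover have "v 3 + off 3 = off 0" by (simp add: off_def v_def)
  ultimately have c_step: "\<And>s. s < 3 \<Longrightarrow> shift_square n (v s) (c s) = c (Suc s)" "shift_square n (v 3) (c 3) = c 0"
    by (simp_all only: c_def shift_square_shift_square)
  have off3: "off s \<in> {(0, 0), (0, 1), (1, 1), (1, 0)}" "off s = off t \<longleftrightarrow> s = t" if "s \<le> 3" "t \<le> 3" for s t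
  proof -
    have "s \<in> {0, 1, 2, 3}" "t \<in> {0, 1, 2, 3}" using that unfolding insert_iff empty_iff by linarith+
    then show "off s \<in> {(0, 0), (0, 1), (1, 1), (1, 0)}" "off s = off t \<longleftrightarrow> s = t" by (auto simp: off_def)
  qed
  have inj: "inj_on c {..3}"
  proof (rule inj_onI)
    fix s t :: nat assume st: "s \<in> {..3}" "t \<in> {..3}" "c s = c t"
    have "off s = off t"
    proof (rule shift_square_offset_inj[OF st(3)[unfolded c_def]])
      show "\<bar>fst (off s) - fst (off t)\<bar> < int n" "\<bar>snd (off s) - snd (off t)\<bar> < int n"
        using off3(1)[of s s] off3(1)[of t t] st(1,2) n_ge by auto
    qed
    then show "s = t" using off3(2) st(1,2) by simp
  qed
  have c_eq: "c s = c t \<longleftrightarrow> s = t" if "s \<le> 3" "t \<le> 3" for s t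
    using inj that by (auto simp: inj_on_def)
  have cs: "c 1 = shift_square n (0, 1) ?e" "c 2 = y i" "c 3 = x i"
    by (simp_all add: c_def off_def xi yi)
  have map_v: "map v [0..<Suc 3] = [(0, 1), (1, 0), (0, -1), (-1, 0)]"
    by (simp add: v_def upt_conv_Cons numeral_3_eq_3)
  note L = walk_loop[OF S(1) c0 _ inj c_step, unfolded map_v, folded x'_def]
  have x': "x' 0 = ?e" "x' i = y i"
    using L(1) L(2)[of i 3] i cs c0 by simp_all
  have ne: "x i \<noteq> y i" using c_eq[of 3 2] by (simp add: cs)
  have "(x', y) \<in> common_empty" using S x' by (simp add: common_empty_def x'_def mv_in_S)
  moreover have "insert i (matched (x, y)) \<subseteq> matched (x', y)"
  proof -
    have "x' j = y j" if j: "j \<in> matched (x, y)" for j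
    proof -
      have jD: "j \<in> D" "x j = y j" using j by (auto simp: matched_def)
      have "j \<noteq> i" using jD ne by auto
      moreover have "j \<noteq> 0" using jD(1) zero_D by metis
      ultimately have "x j \<noteq> x i" "x j \<noteq> y i" "x j \<noteq> ?e"
        using state_inj[OF S(1), of j i] state_inj[OF S(2), of j i] state_inj[OF S(1), of j 0] jD i by auto
      have "x j \<noteq> c t" if "t \<le> 3" for t
      proof -
        have "t \<in> {0, 1, 2, 3}" using that unfolding insert_iff empty_iff by linarith
        then show ?thesis using free[OF j] \<open>x j \<noteq> x i\<close> \<open>x j \<noteq> y i\<close> \<open>x j \<noteq> ?e\<close> cs c0 by auto
      qed
      then have "x j \<notin> c ` {..3}" by blast
      then show ?thesis using L(4)[OF _ _ jD(1)] jD(2) by simp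
    qed
    then show ?thesis using i x' by (auto simp: matched_def)
  qed
  moreover have "finite (matched (x', y))" "i \<notin> matched (x, y)" "finite (matched (x, y))"
    using finite_D ne by (auto simp: matched_def)
  ultimately show ?thesis using card_mono[of "matched (x', y)" "insert i (matched (x, y))"] by simp
qed

text \<open>At most \<open>2 * card D\<close> rounds of the strip, each of
  \<open>2 * card D + 2\<close> moves, and four moves for the rotation.\<close>

definition gain_length :: nat where
  "gain_length = 2 * card D * (2 * card D + 2) + 4"

text \<open>By the pigeonhole principle one of the \<open>2 * card D + 1\<close> strip squares other
  than the empty one carries no matched piece; rounds of the strip turn this into a free fourth
  corner of the block, and the rotation then matches piece \<open>i\<close>.\<close>

lemma pattern_gain:
  assumes z: "(x, y) \<in> common_empty" and i: "i \<in> D" "x i \<noteq> y i" and pat: "piece_rel i (x, y) = pattern n"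
  shows "\<exists>ws ws'. length ws = length ws' \<and> set ws \<subseteq> moves \<and> set ws' \<subseteq> moves \<and> length ws \<le> gain_length \<and>
    (walk ws x, walk ws' y) \<in> common_empty \<and> card (matched (x, y)) < card (matched (walk ws x, walk ws' y))"
proof -
  let ?e = "x 0"
  have S: "x \<in> S" "y \<in> S" "y 0 = ?e" using z by (auto simp: common_empty_def)
  have b: "?e \<in> board n" "x i \<in> board n" "y i \<in> board n" using S i state_board by auto
  have "square_diff n ?e (x i) = shift_square n (-1, 0) 0" "square_diff n (y i) (x i) = shift_square n (0, 1) 0"
    using pat by (auto simp: piece_rel_def pattern_def near_def ring_offset_def)
  then have "?e = shift_square n (-1, 0) (x i)" and y1: "y i = shift_square n (0, 1) (x i)"
    using b by (auto intro: square_diff_eq_shift)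
  then have xi: "x i = shift_square n (1, 0) ?e"
    using b by (simp add: shift_square_shift_square shift_square_0 flip: zero_prod_def)
  then have yi: "y i = shift_square n (1, 1) ?e" using y1 by (simp add: shift_square_shift_square)
  obtain t where t: "1 \<le> t" "t \<le> 2 * card D + 1" "\<And>j. j \<in> matched (x, y) \<Longrightarrow> x j \<noteq> shift_square n (strip t) ?e"
  proof -
    let ?c = "\<lambda>t. shift_square n (strip t) ?e"
    have fm: "finite (matched (x, y))" using finite_D by (simp add: matched_def)
    have "card (?c ` {1..2 * card D + 1}) = 2 * card D + 1"
      by (subst card_image) (auto intro!: inj_onI strip_distinct)
    moreover have "card (x ` matched (x, y)) \<le> card D"
      using card_image_le[OF fm, of x] card_mono[OF finite_D, of "matched (x, y)"] by (auto simp: matched_def)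
    ultimately have "\<not> ?c ` {1..2 * card D + 1} \<subseteq> x ` matched (x, y)"
      using card_mono[of "x ` matched (x, y)" "?c ` {1..2 * card D + 1}"] fm by auto
    then obtain s where s: "s \<in> {1..2 * card D + 1}" "?c s \<notin> x ` matched (x, y)" by blast
    show ?thesis by (rule that[of s]) (use s in \<open>auto simp: image_iff\<close>)
  qed
  obtain ws where ws: "set ws \<subseteq> moves" "length ws \<le> (t - 1) * (2 * card D + 2)"
    "walk ws x 0 = ?e" "walk ws x i = x i" "walk ws y i = y i"
    "\<forall>j\<in>matched (x, y). walk ws x j \<noteq> shift_square n (0, 1) ?e"
    using free_square_walk[OF z i(1) xi yi t] by blast
  have comm: "(walk ws x, walk ws y) \<in> common_empty" "matched (walk ws x, walk ws y) = matched (x, y)"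
    using walk_common_empty[OF z, of ws] by auto
  define rot :: "(int \<times> int) list" where "rot = [(0, 1), (1, 0), (0, -1), (-1, 0)]"
  have gain: "(walk rot (walk ws x), walk ws y) \<in> common_empty \<and>
      card (matched (x, y)) < card (matched (walk rot (walk ws x), walk ws y))"
    using rotation_gain[OF comm(1) i(1)] ws xi yi unfolding comm(2) rot_def by auto
  \<comment> \<open>The null moves let the second configuration wait during the rotation and make
    the two move lists equally long.\<close>
  have stay: "walk [0, 0, 0, 0] (walk ws y) = walk ws y"
    using walk_in_S[OF S(2), of ws] by (simp add: mv_0)
  have "(t - 1) * (2 * card D + 2) \<le> 2 * card D * (2 * card D + 2)"
    using t(2) by (intro mult_le_mono1) simp
  then have "length ws + 4 \<le> gain_length"
    using ws(2) unfolding gain_length_def by linarith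
  moreover have "set (ws @ rot) \<subseteq> moves" "set (ws @ [0, 0, 0, 0]) \<subseteq> moves"
    using ws(1) by (auto simp: rot_def moves_def zero_prod_def)
  ultimately show ?thesis
    using gain stay by (intro exI[of _ "ws @ rot"] exI[of _ "ws @ [0, 0, 0, 0]"]) (simp add: rot_def)
qed

definition gain_prob :: real where
  "gain_prob = (1 / 25) ^ gain_length"

lemma gain_prob: "0 < gain_prob" "gain_prob \<le> 1"
  by (simp_all add: gain_prob_def power_le_one)

text \<open>The prescribed lists are followed with probability at least \<open>gain_prob\<close>,
  and then the cost drops from \<open>M\<close> to \<open>b\<close>; any deviation from them is
  charged with \<open>M\<close>.\<close>

lemma meet_time_gain:
  fixes M b :: real
  assumes M: "\<And>z. z \<in> S \<times> S \<Longrightarrow> meet_time k z \<le> M"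
    and b: "\<And>z. z \<in> common_empty \<Longrightarrow> q < card (matched z) \<Longrightarrow> meet_time k z \<le> b"
    and z: "z \<in> common_empty" "q \<le> card (matched z)" and i: "i \<in> D" "fst z i \<noteq> snd z i"
    and pat: "piece_rel i z = pattern n"
  shows "meet_time k z \<le> gain_length + M - gain_prob * (M - b)"
proof -
  obtain x y where xy: "z = (x, y)" by (cases z)
  obtain ws ws' where ws: "length ws = length ws'" "set ws \<subseteq> moves" "set ws' \<subseteq> moves" "length ws \<le> gain_length"
    "(walk ws x, walk ws' y) \<in> common_empty" "card (matched (x, y)) < card (matched (walk ws x, walk ws' y))"
    using pattern_gain[of x y i] z i pat by (auto simp: xy)
  define V where "V = meet_time k (walk ws x, walk ws' y)"
  have VM: "V \<le> M" unfolding V_def using ws(5) by (intro M) (simp add: common_empty_def)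
  have Vb: "V \<le> b" unfolding V_def using ws(5,6) z(2) by (intro b) (simp_all add: xy)
  have "meet_time k (x, y) \<le> length ws + M - (1 / 25) ^ length ws * (M - V)"
    unfolding V_def using ws z by (intro meet_time_walk M) (auto simp: xy common_empty_def)
  \<comment> \<open>Shorter lists are followed with larger probability; the sign condition is
    \<open>V \<le> M\<close>.\<close>
  moreover have "gain_prob * (M - V) \<le> (1 / 25) ^ length ws * (M - V)"
    unfolding gain_prob_def using ws(4) VM by (intro mult_right_mono power_decreasing) auto
  moreover have "gain_prob * (M - b) \<le> gain_prob * (M - V)"
    using Vb gain_prob by (intro mult_left_mono) auto
  moreover have "real (length ws) \<le> gain_length" using ws(4) by simp
  ultimately show ?thesis unfolding xy by linarith
qed

text \<open>Induction on a bound \<open>r\<close> for the number of unmatched pieces. A stage costs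
  at most \<open>G\<close>, for the wait and the move lists, and passes to the next one with chance
  at least \<open>gain_prob\<close>; a failure is charged with \<open>M\<close>. So
  \<open>gain_prob ^ r\<close> bounds from below the chance of never failing.\<close>

lemma meet_time_matched:
  fixes M G :: real
  assumes M: "\<And>z. z \<in> S \<times> S \<Longrightarrow> meet_time k z \<le> M" and "0 \<le> M"
    and G: "G = 2 * 10 ^ 8 * (1 + ln (real n)) * real n ^ 4 + gain_length"
    and "z \<in> common_empty" "card D \<le> card (matched z) + r"
  shows "meet_time k z \<le> r * G + (1 - gain_prob ^ r) * M"
  using assms(4,5)
proof (induction r arbitrary: z)
  case 0
  have "matched z \<subseteq> D" by (auto simp: matched_def)
  then have eq: "matched z = D" using 0 finite_D by (intro card_subset_eq) (auto dest: card_mono)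
  have "fst z = snd z"
  proof (rule state_eqI)
    show "fst z j = snd z j" if "j \<in> A" for j
      using that 0(1) eq by (auto simp: common_empty_def matched_def)
  qed (use 0(1) in \<open>auto simp: common_empty_def\<close>)
  then show ?case using meet_time_eq[of k "fst z"] by (cases z) simp
next
  case (Suc r)
  let ?b = "r * G + (1 - gain_prob ^ r) * M"
  \<comment> \<open>The cost once the pattern has appeared: \<open>meet_time_gain\<close> with the
    induction hypothesis supplying \<open>b\<close>.\<close>
  let ?N = "gain_length + M - gain_prob * (M - ?b)"
  have G0: "0 \<le> G" unfolding G using n_pos by simp
  have p: "0 \<le> gain_prob ^ r" "gain_prob ^ r \<le> 1" "0 \<le> gain_prob ^ Suc r" "gain_prob ^ Suc r \<le> 1"
    using gain_prob by (auto intro!: power_le_one mult_le_one)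
  have "gain_prob * (r * G) \<le> 1 * (r * G)"
    using gain_prob G0 by (intro mult_right_mono) auto
  then have N: "?N \<le> gain_length + r * G + (1 - gain_prob ^ Suc r) * M"
    by (simp add: algebra_simps)
  have b0: "0 \<le> ?b" using G0 p \<open>0 \<le> M\<close> by (intro add_nonneg_nonneg mult_nonneg_nonneg) auto
  have "gain_prob * (M - ?b) \<le> 1 * M"
  proof (cases "?b \<le> M")
    case True
    then show ?thesis using gain_prob b0 by (intro mult_mono) auto
  next
    case False
    then have "gain_prob * (M - ?b) \<le> 0" using gain_prob by (intro mult_nonneg_nonpos) auto
    then show ?thesis using \<open>0 \<le> M\<close> by linarith
  qed
  then have N0: "0 \<le> ?N" by simp
  show ?case
  proof (cases "\<exists>i\<in>D. fst z i \<noteq> snd z i")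
    case True
    then obtain i where i: "i \<in> D" "fst z i \<noteq> snd z i" by blast
    have "meet_time k z \<le> 2 * 10 ^ 8 * (1 + ln (real n)) * real n ^ 4 + ?N"
    proof (rule meet_time_pattern[where q = "card D - Suc r", OF _ N0 i Suc.prems(1)])
      fix z assume z: "z \<in> common_empty" "fst z i \<noteq> snd z i" "card D - Suc r \<le> card (matched z)" "piece_rel i z = pattern n"
      show "meet_time k z \<le> ?N"
      proof (rule meet_time_gain[OF M _ z(1,3) i(1) z(2,4)])
        fix z assume "z \<in> common_empty" "card D - Suc r < card (matched z)"
        then show "meet_time k z \<le> ?b" by (intro Suc.IH) auto
      qed
    qed (use Suc.prems in auto)
    also have "\<dots> \<le> Suc r * G + (1 - gain_prob ^ Suc r) * M"
      using N unfolding G by (simp add: algebra_simps)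
    finally show ?thesis .
  next
    case False
    have "fst z = snd z"
    proof (rule state_eqI)
      show "fst z j = snd z j" if "j \<in> A" for j
        using that Suc.prems(1) False by (auto simp: common_empty_def)
    qed (use Suc.prems(1) in \<open>auto simp: common_empty_def\<close>)
    then have "meet_time k z = 0" using meet_time_eq[of k "fst z"] by (cases z) simp
    also have "0 \<le> Suc r * G + (1 - gain_prob ^ Suc r) * M"
      using G0 p \<open>0 \<le> M\<close> by (intro add_nonneg_nonneg mult_nonneg_nonneg) auto
    finally show ?thesis .
  qed
qed

text \<open>The maximum \<open>M\<close> over the finitely many pairs satisfies
  \<open>M \<le> R + card D * G + (1 - Q) * M\<close> with \<open>Q > 0\<close>, which can be solved
  for \<open>M\<close>. The resulting bound does not depend on \<open>k\<close>.\<close>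

lemma meet_time_bound:
  assumes z: "z \<in> S \<times> S"
  shows "meet_time k z \<le> (750 * (1 + ln (real n)) * (real n)\<^sup>2
      + card D * (2 * 10 ^ 8 * (1 + ln (real n)) * real n ^ 4 + gain_length)) / gain_prob ^ card D"
proof -
  define G where "G = 2 * 10 ^ 8 * (1 + ln (real n)) * real n ^ 4 + gain_length"
  define M where "M = Max (meet_time k ` (S \<times> S))"
  define R where "R = 750 * (1 + ln (real n)) * (real n)\<^sup>2"
  define Q where "Q = gain_prob ^ card D"
  have fin: "finite (meet_time k ` (S \<times> S))" using finite_D by auto
  have M: "meet_time k z \<le> M" if "z \<in> S \<times> S" for z
    unfolding M_def using fin that by (intro Max_ge) auto
  have "M \<in> meet_time k ` (S \<times> S)" unfolding M_def by (rule Max_in[OF fin]) (use z in blast)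
  then obtain z0 where z0: "z0 \<in> S \<times> S" "M = meet_time k z0" by blast
  have M0: "0 \<le> M" unfolding z0 by (rule meet_time_nonneg)
  have "meet_time k z \<le> card D * G + (1 - Q) * M" if "z \<in> common_empty" for z
    unfolding Q_def using that by (intro meet_time_matched[OF M M0 G_def]) auto
  then have "M \<le> R + (card D * G + (1 - Q) * M)"
    unfolding R_def using meet_time_common_empty[OF _ z0(1)] unfolding z0(2) by blast
  then have "M * Q \<le> R + card D * G" by (simp add: algebra_simps)
  moreover have "0 < Q" unfolding Q_def using gain_prob by simp
  ultimately have "M \<le> (R + card D * G) / Q" by (simp add: pos_le_divide_eq)
  with M[OF z] show ?thesis unfolding R_def G_def Q_def by linarith
qed

end

section \<open>Projections and hitting times of Markov chains\<close>

lemma sets_Collect_both: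
  assumes "{\<omega> \<in> space M. P \<omega>} \<in> sets M" "{\<omega> \<in> space M. R \<omega>} \<in> sets M"
  shows "{\<omega> \<in> space M. P \<omega> \<and> R \<omega>} \<in> sets M"
  using assms by (rule sets.sets_Collect_conj[rotated])

lemma markov_chainD:
  assumes "markov_chain M S K Z"
  shows "prob_space M" "Z t \<in> M \<rightarrow>\<^sub>M count_space S"
    and "\<P>(\<omega> in M. \<forall>i\<le>t. Z i \<omega> = x i) > 0 \<Longrightarrow>
      \<P>(\<omega> in M. Z (Suc t) \<omega> = y \<bar> \<forall>i\<le>t. Z i \<omega> = x i) = pmf (K (x t)) y"
  using assms unfolding markov_chain_def by blast+

lemma markov_chain_sets:
  assumes "markov_chain M S K Z"
  shows "{\<omega> \<in> space M. R (Z t \<omega>)} \<in> sets M"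
proof -
  note Z = markov_chainD(2)[OF assms]
  have "{\<omega> \<in> space M. R (Z t \<omega>)} = Z t -` {s \<in> S. R s} \<inter> space M"
    using measurable_space[OF Z] by auto
  then show ?thesis using measurable_sets[OF Z, of "{s \<in> S. R s}"] by simp
qed

lemma markov_chain_sets_all:
  assumes "markov_chain M S K Z"
  shows "{\<omega> \<in> space M. \<forall>i\<le>t. R i (Z i \<omega>)} \<in> sets M"
proof -
  have "{\<omega> \<in> space M. \<forall>i\<in>{..t}. R i (Z i \<omega>)} \<in> sets M"
  proof (rule sets.sets_Collect_finite_All)
    show "{\<omega> \<in> space M. R i (Z i \<omega>)} \<in> sets M" for i by (rule markov_chain_sets[OF assms])
  qed simp
  then show ?thesis by (simp only: Ball_def atMost_iff)
qed

lemma markov_chain_in: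
  assumes "markov_chain M S K Z" "\<omega> \<in> space M"
  shows "Z t \<omega> \<in> S"
  using measurable_space[OF markov_chainD(2)[OF assms(1)] assms(2)] by simp

text \<open>The Markov property in product form, which also covers histories of probability
  \<open>0\<close>.\<close>

lemma markov_chain_history_step:
  assumes mc: "markov_chain M S K Z"
  shows "measure M {\<omega> \<in> space M. (\<forall>i\<le>t. Z i \<omega> = z i) \<and> Z (Suc t) \<omega> = y} =
    measure M {\<omega> \<in> space M. \<forall>i\<le>t. Z i \<omega> = z i} * pmf (K (z t)) y"
proof -
  interpret prob_space M by (rule markov_chainD(1)[OF mc])
  let ?E = "{\<omega> \<in> space M. \<forall>i\<le>t. Z i \<omega> = z i}"
  let ?F = "{\<omega> \<in> space M. (\<forall>i\<le>t. Z i \<omega> = z i) \<and> Z (Suc t) \<omega> = y}"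
  show ?thesis
  proof (cases "measure M ?E > 0")
    case True
    then have cp: "\<P>(\<omega> in M. Z (Suc t) \<omega> = y \<bar> \<forall>i\<le>t. Z i \<omega> = z i) = pmf (K (z t)) y"
      by (rule markov_chainD(3)[OF mc])
    have swap: "{\<omega> \<in> space M. Z (Suc t) \<omega> = y \<and> (\<forall>i\<le>t. Z i \<omega> = z i)} = ?F"
      by (rule Collect_cong) (simp only: conj_commute)
    have "measure M ?F / measure M ?E = pmf (K (z t)) y"
      using cp unfolding cond_prob_def swap .
    then show ?thesis using True by (simp only: divide_eq_eq mult.commute split: if_splits)
  next
    case False
    then have 0: "measure M ?E = 0" using measure_nonneg[of M ?E] by linarith
    have "?E \<in> sets M" by (rule markov_chain_sets_all[OF mc])
    moreover have "?F \<subseteq> ?E" by blast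
    ultimately have "measure M ?F \<le> measure M ?E" by (rule finite_measure_mono[rotated])
    then have "measure M ?F = 0" using 0 measure_nonneg[of M ?F] by linarith
    then show ?thesis by (simp only: 0 mult_zero_left)
  qed
qed

text \<open>On a finite state space an event of the past is a finite disjoint union of complete
  histories, here all ending in \<open>x\<close>. The hypothesis on \<open>Q\<close> expresses that
  it looks at times up to \<open>t\<close> only.\<close>

lemma markov_chain_step:
  fixes Q :: "(nat \<Rightarrow> 's) \<Rightarrow> bool" and Z :: "nat \<Rightarrow> 'w \<Rightarrow> 's"
  assumes mc: "markov_chain M S K Z" and fin: "finite S"
    and Q: "\<And>f g. (\<And>i. i \<le> t \<Longrightarrow> f i = g i) \<Longrightarrow> Q f = Q g"
  shows "measure M {\<omega> \<in> space M. Q (\<lambda>i. Z i \<omega>) \<and> Z t \<omega> = x \<and> Z (Suc t) \<omega> = y} =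
    measure M {\<omega> \<in> space M. Q (\<lambda>i. Z i \<omega>) \<and> Z t \<omega> = x} * pmf (K x) y"
proof -
  interpret prob_space M by (rule markov_chainD(1)[OF mc])
  \<comment> \<open>Histories are restricted to \<open>{..t}\<close> so that there are finitely many
    of them.\<close>
  define H where "H = {z \<in> {..t} \<rightarrow>\<^sub>E S. Q z \<and> z t = x}"
  have finH: "finite H" unfolding H_def
    by (rule finite_subset[OF _ finite_PiE[of "{..t}" "\<lambda>_. S"]]) (use fin in auto)
  have union: "{\<omega> \<in> space M. Q (\<lambda>i. Z i \<omega>) \<and> Z t \<omega> = x \<and> R \<omega>} =
      (\<Union>z\<in>H. {\<omega> \<in> space M. (\<forall>i\<le>t. Z i \<omega> = z i) \<and> R \<omega>})" for R
  proof (intro equalityI subsetI)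
    fix \<omega> assume w: "\<omega> \<in> {\<omega> \<in> space M. Q (\<lambda>i. Z i \<omega>) \<and> Z t \<omega> = x \<and> R \<omega>}"
    have "Q (restrict (\<lambda>i. Z i \<omega>) {..t}) = Q (\<lambda>i. Z i \<omega>)" by (rule Q) simp
    then have "restrict (\<lambda>i. Z i \<omega>) {..t} \<in> H"
      using w markov_chain_in[OF mc, of \<omega>] by (simp add: H_def)
    moreover have "\<forall>i\<le>t. Z i \<omega> = restrict (\<lambda>i. Z i \<omega>) {..t} i" by simp
    ultimately show "\<omega> \<in> (\<Union>z\<in>H. {\<omega> \<in> space M. (\<forall>i\<le>t. Z i \<omega> = z i) \<and> R \<omega>})"
      using w by blast
  next
    fix \<omega> assume "\<omega> \<in> (\<Union>z\<in>H. {\<omega> \<in> space M. (\<forall>i\<le>t. Z i \<omega> = z i) \<and> R \<omega>})"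
    then obtain z where z: "z \<in> H" "\<omega> \<in> space M" "\<forall>i\<le>t. Z i \<omega> = z i" "R \<omega>" by blast
    have "Q (\<lambda>i. Z i \<omega>) = Q z" by (rule Q) (use z(3) in blast)
    moreover have "Z t \<omega> = x" using z(1,3) by (simp add: H_def)
    moreover have "Q z" using z(1) by (simp add: H_def)
    ultimately show "\<omega> \<in> {\<omega> \<in> space M. Q (\<lambda>i. Z i \<omega>) \<and> Z t \<omega> = x \<and> R \<omega>}"
      using z(2,4) by simp
  qed
  have disj: "disjoint_family_on (\<lambda>z. {\<omega> \<in> space M. (\<forall>i\<le>t. Z i \<omega> = z i) \<and> R \<omega>}) H" for R
  proof (unfold disjoint_family_on_def, intro ballI impI)
    fix z z' assume z: "z \<in> H" "z' \<in> H" "z \<noteq> z'"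
    then have "z \<in> {..t} \<rightarrow>\<^sub>E S" "z' \<in> {..t} \<rightarrow>\<^sub>E S" by (simp_all add: H_def)
    then obtain i where i: "i \<le> t" "z i \<noteq> z' i"
      using PiE_ext[of z "{..t}" "\<lambda>_. S" z'] z(3) by (meson atMost_iff)
    show "{\<omega> \<in> space M. (\<forall>i\<le>t. Z i \<omega> = z i) \<and> R \<omega>} \<inter> {\<omega> \<in> space M. (\<forall>i\<le>t. Z i \<omega> = z' i) \<and> R \<omega>} = {}"
    proof (rule Int_emptyI)
      fix \<omega> assume "\<omega> \<in> {\<omega> \<in> space M. (\<forall>i\<le>t. Z i \<omega> = z i) \<and> R \<omega>}"
        "\<omega> \<in> {\<omega> \<in> space M. (\<forall>i\<le>t. Z i \<omega> = z' i) \<and> R \<omega>}"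
      then have "Z i \<omega> = z i" "Z i \<omega> = z' i" using i(1) by blast+
      then show False using i(2) by simp
    qed
  qed
  have meas_hist: "{\<omega> \<in> space M. \<forall>i\<le>t. Z i \<omega> = z i} \<in> sets M" for z
    by (rule markov_chain_sets_all[OF mc])
  have meas: "{\<omega> \<in> space M. (\<forall>i\<le>t. Z i \<omega> = z i) \<and> Z (Suc t) \<omega> = y} \<in> sets M" for z
    by (rule sets_Collect_both[OF meas_hist markov_chain_sets[OF mc, of "\<lambda>s. s = y" "Suc t"]])
  have "measure M (\<Union>z\<in>H. {\<omega> \<in> space M. (\<forall>i\<le>t. Z i \<omega> = z i) \<and> True}) =
      (\<Sum>z\<in>H. measure M {\<omega> \<in> space M. (\<forall>i\<le>t. Z i \<omega> = z i) \<and> True})"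
    by (intro finite_measure_finite_Union finH disj image_subsetI) (simp add: meas_hist)
  then have total: "(\<Sum>z\<in>H. measure M {\<omega> \<in> space M. \<forall>i\<le>t. Z i \<omega> = z i}) =
      measure M {\<omega> \<in> space M. Q (\<lambda>i. Z i \<omega>) \<and> Z t \<omega> = x}"
    using union[of "\<lambda>_. True"] by simp
  have "measure M {\<omega> \<in> space M. Q (\<lambda>i. Z i \<omega>) \<and> Z t \<omega> = x \<and> Z (Suc t) \<omega> = y} =
      (\<Sum>z\<in>H. measure M {\<omega> \<in> space M. (\<forall>i\<le>t. Z i \<omega> = z i) \<and> Z (Suc t) \<omega> = y})"
    unfolding union[of "\<lambda>\<omega>. Z (Suc t) \<omega> = y"]
    by (intro finite_measure_finite_Union finH disj image_subsetI meas)
  also have "\<dots> = (\<Sum>z\<in>H. measure M {\<omega> \<in> space M. \<forall>i\<le>t. Z i \<omega> = z i} * pmf (K x) y)"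
  proof (rule sum.cong)
    fix z assume "z \<in> H"
    then have "z t = x" by (simp add: H_def)
    then show "measure M {\<omega> \<in> space M. (\<forall>i\<le>t. Z i \<omega> = z i) \<and> Z (Suc t) \<omega> = y} =
        measure M {\<omega> \<in> space M. \<forall>i\<le>t. Z i \<omega> = z i} * pmf (K x) y"
      using markov_chain_history_step[OF mc, of t z y] by simp
  qed simp
  also have "\<dots> = (\<Sum>z\<in>H. measure M {\<omega> \<in> space M. \<forall>i\<le>t. Z i \<omega> = z i}) * pmf (K x) y"
    by (simp add: sum_distrib_right)
  also have "\<dots> = measure M {\<omega> \<in> space M. Q (\<lambda>i. Z i \<omega>) \<and> Z t \<omega> = x} * pmf (K x) y"
    unfolding total ..
  finally show ?thesis .
qed

lemma measure_eq_sum_values: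
  assumes "prob_space M" "finite S" and Z: "\<And>\<omega>. \<omega> \<in> space M \<Longrightarrow> Z \<omega> \<in> S"
    and "\<And>x. {\<omega> \<in> space M. E \<omega> \<and> Z \<omega> = x} \<in> sets M"
  shows "measure M {\<omega> \<in> space M. E \<omega>} = (\<Sum>x\<in>S. measure M {\<omega> \<in> space M. E \<omega> \<and> Z \<omega> = x})"
proof -
  interpret prob_space M by fact
  have "{\<omega> \<in> space M. E \<omega>} = (\<Union>x\<in>S. {\<omega> \<in> space M. E \<omega> \<and> Z \<omega> = x})" using Z by auto
  then show ?thesis
    using assms by (simp only:) (intro finite_measure_finite_Union, auto simp: disjoint_family_on_def)
qed

lemma map_pmf_eq_sum:
  assumes "finite S" "set_pmf p \<subseteq> S"
  shows "pmf (map_pmf \<pi> p) y = (\<Sum>z\<in>S. if \<pi> z = y then pmf p z else 0)"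
proof -
  have "(\<Sum>z\<in>S. if \<pi> z = y then pmf p z else 0) = (\<Sum>z\<in>S \<inter> \<pi> -` {y}. pmf p z)"
    using assms(1) by (simp add: sum.inter_restrict)
  also have "\<dots> = measure (measure_pmf p) (S \<inter> \<pi> -` {y})"
    using assms(1) by (simp add: measure_measure_pmf_finite)
  also have "\<dots> = measure (measure_pmf p) (\<pi> -` {y})"
    by (rule measure_pmf.finite_measure_eq_AE) (use assms(2) in \<open>auto simp: AE_measure_pmf_iff\<close>)
  finally show ?thesis by (simp add: pmf_map)
qed

text \<open>Lumping: given the current state \<open>z\<close>, the projected next state has law
  \<open>P (\<pi> z)\<close>, which is the same for all \<open>z\<close> with the observed
  projection. Summing over \<open>z\<close> gives the Markov property.\<close>

lemma markov_chain_projection: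
  assumes mc: "markov_chain M S K Z" and fin: "finite S" and \<pi>: "\<pi> ` S \<subseteq> S'"
    and K: "\<And>z. z \<in> S \<Longrightarrow> set_pmf (K z) \<subseteq> S" "\<And>z. z \<in> S \<Longrightarrow> map_pmf \<pi> (K z) = P (\<pi> z)"
  shows "markov_chain M S' P (\<lambda>t \<omega>. \<pi> (Z t \<omega>))"
proof -
  interpret prob_space M by (rule markov_chainD(1)[OF mc])
  have meas: "(\<lambda>\<omega>. \<pi> (Z t \<omega>)) \<in> M \<rightarrow>\<^sub>M count_space S'" for t
    by (rule measurable_compose[OF markov_chainD(2)[OF mc]]) (use \<pi> in auto)
  have "\<P>(\<omega> in M. \<pi> (Z (Suc t) \<omega>) = y \<bar> \<forall>i\<le>t. \<pi> (Z i \<omega>) = x i) = pmf (P (x t)) y"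
    if pos: "\<P>(\<omega> in M. \<forall>i\<le>t. \<pi> (Z i \<omega>) = x i) > 0" for t x y
  proof -
    define E where "E = (\<lambda>\<omega>. \<forall>i\<le>t. \<pi> (Z i \<omega>) = x i)"
    have setE: "{\<omega> \<in> space M. E \<omega>} \<in> sets M"
      unfolding E_def by (rule markov_chain_sets_all[OF mc])
    have single: "{\<omega> \<in> space M. E \<omega> \<and> R (Z s \<omega>)} \<in> sets M" for R s
      by (rule sets_Collect_both[OF setE markov_chain_sets[OF mc, of R s]])
    have pair: "{\<omega> \<in> space M. (E \<omega> \<and> R (Z s \<omega>)) \<and> R' (Z r \<omega>)} \<in> sets M" for R R' s r
      by (rule sets_Collect_both[OF single[of R s] markov_chain_sets[OF mc, of R' r]])
    have total: "(\<Sum>z\<in>S. measure M {\<omega> \<in> space M. E \<omega> \<and> Z t \<omega> = z}) = measure M {\<omega> \<in> space M. E \<omega>}"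
      by (rule measure_eq_sum_values[symmetric, OF prob_space_axioms fin])
        (erule markov_chain_in[OF mc], rule single)
    have "measure M {\<omega> \<in> space M. E \<omega> \<and> \<pi> (Z (Suc t) \<omega>) = y} =
        (\<Sum>z\<in>S. measure M {\<omega> \<in> space M. (E \<omega> \<and> \<pi> (Z (Suc t) \<omega>) = y) \<and> Z t \<omega> = z})"
      by (rule measure_eq_sum_values[OF prob_space_axioms fin])
        (erule markov_chain_in[OF mc], rule pair[of "\<lambda>z. \<pi> z = y" "Suc t" "\<lambda>z. z = _" t])
    also have "\<dots> = (\<Sum>z\<in>S. measure M {\<omega> \<in> space M. E \<omega> \<and> Z t \<omega> = z} * pmf (P (x t)) y)"
    proof (intro sum.cong refl)
      fix z assume z: "z \<in> S"
      show "measure M {\<omega> \<in> space M. (E \<omega> \<and> \<pi> (Z (Suc t) \<omega>) = y) \<and> Z t \<omega> = z} =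
          measure M {\<omega> \<in> space M. E \<omega> \<and> Z t \<omega> = z} * pmf (P (x t)) y"
      \<comment> \<open>The event \<open>E\<close> fixes the projection at time \<open>t\<close>, so
        other values of \<open>z\<close> contribute nothing.\<close>
      proof (cases "\<pi> z = x t")
        case False
        then have none: "\<not> (E \<omega> \<and> Z t \<omega> = z)" for \<omega> by (auto simp: E_def)
        then have "{\<omega> \<in> space M. (E \<omega> \<and> \<pi> (Z (Suc t) \<omega>) = y) \<and> Z t \<omega> = z} = {}"
          "{\<omega> \<in> space M. E \<omega> \<and> Z t \<omega> = z} = {}" by blast+
        then show ?thesis by (simp only: measure_empty mult_zero_left)
      next
        case True
        have "measure M {\<omega> \<in> space M. (E \<omega> \<and> \<pi> (Z (Suc t) \<omega>) = y) \<and> Z t \<omega> = z} =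
            (\<Sum>z'\<in>S. measure M {\<omega> \<in> space M. ((E \<omega> \<and> \<pi> (Z (Suc t) \<omega>) = y) \<and> Z t \<omega> = z) \<and> Z (Suc t) \<omega> = z'})"
          by (rule measure_eq_sum_values[OF prob_space_axioms fin])
            (erule markov_chain_in[OF mc],
              rule sets_Collect_both[OF pair[of "\<lambda>z. \<pi> z = y" "Suc t" "\<lambda>z. z = _" t]
                markov_chain_sets[OF mc, of "\<lambda>z. z = _" "Suc t"]])
        also have "\<dots> = (\<Sum>z'\<in>S. measure M {\<omega> \<in> space M. E \<omega> \<and> Z t \<omega> = z} * (if \<pi> z' = y then pmf (K z) z' else 0))"
        proof (intro sum.cong refl)
          fix z'
          show "measure M {\<omega> \<in> space M. ((E \<omega> \<and> \<pi> (Z (Suc t) \<omega>) = y) \<and> Z t \<omega> = z) \<and> Z (Suc t) \<omega> = z'} =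
              measure M {\<omega> \<in> space M. E \<omega> \<and> Z t \<omega> = z} * (if \<pi> z' = y then pmf (K z) z' else 0)"
          proof (cases "\<pi> z' = y")
            case True
            then have "{\<omega> \<in> space M. ((E \<omega> \<and> \<pi> (Z (Suc t) \<omega>) = y) \<and> Z t \<omega> = z) \<and> Z (Suc t) \<omega> = z'} =
                {\<omega> \<in> space M. E \<omega> \<and> Z t \<omega> = z \<and> Z (Suc t) \<omega> = z'}" by auto
            then show ?thesis
              using markov_chain_step[OF mc fin, of t "\<lambda>f. \<forall>i\<le>t. \<pi> (f i) = x i" z z'] True by (simp add: E_def)
          next
            case False
            then have "{\<omega> \<in> space M. ((E \<omega> \<and> \<pi> (Z (Suc t) \<omega>) = y) \<and> Z t \<omega> = z) \<and> Z (Suc t) \<omega> = z'} = {}" by auto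
            with False show ?thesis by (simp only: measure_empty if_False mult_zero_right)
          qed
        qed
        also have "\<dots> = measure M {\<omega> \<in> space M. E \<omega> \<and> Z t \<omega> = z} * (\<Sum>z'\<in>S. if \<pi> z' = y then pmf (K z) z' else 0)"
          by (simp add: sum_distrib_left)
        also have "\<dots> = measure M {\<omega> \<in> space M. E \<omega> \<and> Z t \<omega> = z} * pmf (P (x t)) y"
          unfolding True[symmetric] map_pmf_eq_sum[OF fin K(1)[OF z], of \<pi> y, symmetric] K(2)[OF z] ..
        finally show ?thesis .
      qed
    qed
    also have "\<dots> = (\<Sum>z\<in>S. measure M {\<omega> \<in> space M. E \<omega> \<and> Z t \<omega> = z}) * pmf (P (x t)) y"
      by (simp add: sum_distrib_right)
    also have "\<dots> = measure M {\<omega> \<in> space M. E \<omega>} * pmf (P (x t)) y"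
      unfolding total ..
    finally have eq: "measure M {\<omega> \<in> space M. E \<omega> \<and> \<pi> (Z (Suc t) \<omega>) = y} = measure M {\<omega> \<in> space M. E \<omega>} * pmf (P (x t)) y" .
    have swap: "{\<omega> \<in> space M. \<pi> (Z (Suc t) \<omega>) = y \<and> (\<forall>i\<le>t. \<pi> (Z i \<omega>) = x i)} = {\<omega> \<in> space M. E \<omega> \<and> \<pi> (Z (Suc t) \<omega>) = y}"
      by (auto simp: E_def)
    show ?thesis
      unfolding cond_prob_def swap eq using pos by (simp add: E_def)
  qed
  then show ?thesis using meas prob_space_axioms unfolding markov_chain_def by blast
qed

text \<open>Tail summation for a first time. If \<open>R\<close> never holds, the infimum over the
  empty set is infinite, and so is the series.\<close>

lemma INF_le_suminf_indicator:
  "(INF t\<in>{t. R t}. of_nat t :: ennreal) \<le> (\<Sum>t. if \<forall>i\<le>t. \<not> R i then 1 else 0)"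
proof -
  let ?f = "\<lambda>t. if \<forall>i\<le>t. \<not> R i then 1 else 0 :: ennreal"
  have ge: "of_nat T \<le> suminf ?f" if "\<forall>i<T. \<not> R i" for T
  proof -
    have "?f t = 1" if "t < T" for t
      using \<open>\<forall>i<T. \<not> R i\<close> that by (meson le_less_trans)
    then have "of_nat T = (\<Sum>t<T. ?f t)" by simp
    also have "\<dots> \<le> suminf ?f" by (intro sum_le_suminf) auto
    finally show ?thesis .
  qed
  show ?thesis
  proof (cases "\<exists>t. R t")
    case True
    then have "R (LEAST t. R t)" by (rule LeastI_ex)
    then have "(INF t\<in>{t. R t}. of_nat t :: ennreal) \<le> of_nat (LEAST t. R t)" by (intro INF_lower) simp
    also have "\<dots> \<le> suminf ?f" by (intro ge) (blast dest: not_less_Least)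
    finally show ?thesis .
  next
    case False
    have "suminf ?f = top"
    proof (rule ccontr)
      assume "suminf ?f \<noteq> top"
      then have "suminf ?f < top" by (simp add: top.not_eq_extremum)
      then obtain N where "suminf ?f < of_nat N" using ennreal_Ex_less_of_nat by blast
      moreover have "of_nat N \<le> suminf ?f" using ge[of N] False by blast
      ultimately show False by (simp add: not_less[symmetric])
    qed
    then show ?thesis by (simp only: top_greatest)
  qed
qed

text \<open>A Lyapunov argument: let \<open>a t\<close> be the expectation of \<open>f\<close> on
  the event that \<open>D\<close> has not been hit up to time \<open>t\<close>. By the drift
  condition each step lowers \<open>a\<close> by at least the probability of that event, and
  telescoping bounds the sum of the tails by \<open>a 0 \<le> B\<close>.\<close>

lemma expected_hitting_time_le:
  fixes f :: "'s \<Rightarrow> real"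
  assumes mc: "markov_chain M S K Z" and fin: "finite S"
    and f: "\<And>z. z \<in> S \<Longrightarrow> 0 \<le> f z" "\<And>z. z \<in> S \<Longrightarrow> f z \<le> B"
    and drift: "\<And>z. z \<in> S - D \<Longrightarrow> 1 + (\<Sum>z'\<in>S - D. pmf (K z) z' * f z') \<le> f z"
  shows "(\<integral>\<^sup>+ \<omega>. (INF t\<in>{t. Z t \<omega> \<in> D}. of_nat t) \<partial>M) \<le> ennreal B"
proof -
  interpret prob_space M by (rule markov_chainD(1)[OF mc])
  define E where "E t = {\<omega> \<in> space M. \<forall>i\<le>t. Z i \<omega> \<notin> D}" for t
  have setE: "E t \<in> sets M" for t
    unfolding E_def by (rule markov_chain_sets_all[OF mc])
  \<comment> \<open>The law at time \<open>t\<close> of the chain killed on entering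
    \<open>D\<close>.\<close>
  define m where "m t z = measure M {\<omega> \<in> space M. (\<forall>i\<le>t. Z i \<omega> \<notin> D) \<and> Z t \<omega> = z}" for t z
  have m0: "m t z \<ge> 0" for t z by (simp add: m_def)
  have mE: "{\<omega> \<in> space M. (\<forall>i\<le>t. Z i \<omega> \<notin> D) \<and> Z s \<omega> = z} \<in> sets M" for t s z
    by (rule sets_Collect_both[OF setE[of t, unfolded E_def] markov_chain_sets[OF mc, of "\<lambda>z'. z' = z" s]])
  have PE: "measure M (E t) = (\<Sum>z\<in>S - D. m t z)" for t
  proof -
    have "measure M (E t) = (\<Sum>z\<in>S. m t z)"
      unfolding E_def m_def 
      by (rule measure_eq_sum_values[OF prob_space_axioms fin]) (erule markov_chain_in[OF mc], rule mE)
    also have "\<dots> = (\<Sum>z\<in>S - D. m t z)"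
    proof (rule sum.mono_neutral_right)
      show "\<forall>z\<in>S - (S - D). m t z = 0"
      proof
        fix z assume "z \<in> S - (S - D)"
        then have "{\<omega> \<in> space M. (\<forall>i\<le>t. Z i \<omega> \<notin> D) \<and> Z t \<omega> = z} = {}" by auto
        then show "m t z = 0" unfolding m_def by (simp only: measure_empty)
      qed
    qed (use fin in auto)
    finally show ?thesis .
  qed
  have m_Suc: "m (Suc t) z' = (\<Sum>z\<in>S - D. m t z * pmf (K z) z')" if z': "z' \<in> S - D" for t z'
  proof -
    have "{\<omega> \<in> space M. (\<forall>i\<le>Suc t. Z i \<omega> \<notin> D) \<and> Z (Suc t) \<omega> = z'} =
        {\<omega> \<in> space M. (\<forall>i\<le>t. Z i \<omega> \<notin> D) \<and> Z (Suc t) \<omega> = z'}"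
      using z' by (auto simp: le_Suc_eq)
    then have "m (Suc t) z' = measure M {\<omega> \<in> space M. (\<forall>i\<le>t. Z i \<omega> \<notin> D) \<and> Z (Suc t) \<omega> = z'}"
      by (simp only: m_def)
    also have "\<dots> = (\<Sum>z\<in>S. measure M {\<omega> \<in> space M. ((\<forall>i\<le>t. Z i \<omega> \<notin> D) \<and> Z (Suc t) \<omega> = z') \<and> Z t \<omega> = z})"
      by (rule measure_eq_sum_values[OF prob_space_axioms fin])
        (erule markov_chain_in[OF mc], rule sets_Collect_both[OF mE markov_chain_sets[OF mc, of "\<lambda>z. z = _" t]])
    also have "\<dots> = (\<Sum>z\<in>S. m t z * pmf (K z) z')"
    proof (intro sum.cong refl)
      fix z
      have "{\<omega> \<in> space M. ((\<forall>i\<le>t. Z i \<omega> \<notin> D) \<and> Z (Suc t) \<omega> = z') \<and> Z t \<omega> = z} =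
          {\<omega> \<in> space M. (\<forall>i\<le>t. Z i \<omega> \<notin> D) \<and> Z t \<omega> = z \<and> Z (Suc t) \<omega> = z'}" by auto
      then show "measure M {\<omega> \<in> space M. ((\<forall>i\<le>t. Z i \<omega> \<notin> D) \<and> Z (Suc t) \<omega> = z') \<and> Z t \<omega> = z} = m t z * pmf (K z) z'"
        using markov_chain_step[OF mc fin, of t "\<lambda>f. \<forall>i\<le>t. f i \<notin> D" z z'] by (simp add: m_def)
    qed
    also have "\<dots> = (\<Sum>z\<in>S - D. m t z * pmf (K z) z')"
    proof (rule sum.mono_neutral_right)
      show "\<forall>z\<in>S - (S - D). m t z * pmf (K z) z' = 0"
      proof
        fix z assume "z \<in> S - (S - D)"
        then have "{\<omega> \<in> space M. (\<forall>i\<le>t. Z i \<omega> \<notin> D) \<and> Z t \<omega> = z} = {}" by auto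
        then show "m t z * pmf (K z) z' = 0" unfolding m_def by (simp only: measure_empty mult_zero_left)
      qed
    qed (use fin in auto)
    finally show ?thesis .
  qed
  define a where "a t = (\<Sum>z\<in>S - D. m t z * f z)" for t
  have dec: "measure M (E t) + a (Suc t) \<le> a t" for t
  proof -
    have "a (Suc t) = (\<Sum>z'\<in>S - D. \<Sum>z\<in>S - D. m t z * (pmf (K z) z' * f z'))"
      unfolding a_def by (intro sum.cong refl) (simp add: m_Suc sum_distrib_right mult.assoc)
    also have "\<dots> = (\<Sum>z\<in>S - D. m t z * (\<Sum>z'\<in>S - D. pmf (K z) z' * f z'))"
      by (subst sum.swap) (simp add: sum_distrib_left)
    finally have "measure M (E t) + a (Suc t) = (\<Sum>z\<in>S - D. m t z * (1 + (\<Sum>z'\<in>S - D. pmf (K z) z' * f z')))"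
      by (simp add: PE distrib_left sum.distrib)
    also have "\<dots> \<le> a t" unfolding a_def by (intro sum_mono mult_left_mono drift m0)
    finally show ?thesis .
  qed
  have a0: "a t \<ge> 0" for t unfolding a_def using m0 f(1) by (intro sum_nonneg mult_nonneg_nonneg) auto
  have telescope: "(\<Sum>t<T. measure M (E t)) + a T \<le> a 0" for T
  proof (induction T)
    case (Suc T)
    then show ?case using dec[of T] by simp
  qed simp
  have aB: "a 0 \<le> B"
  proof -
    obtain z where "z \<in> S" using markov_chain_in[OF mc] not_empty by blast
    then have B0: "0 \<le> B" using f[of z] by linarith
    have "a 0 \<le> (\<Sum>z\<in>S - D. m 0 z * B)"
      unfolding a_def using f m0 by (intro sum_mono mult_left_mono) auto
    also have "\<dots> = measure M (E 0) * B" by (simp add: PE sum_distrib_right)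
    also have "\<dots> \<le> B" using mult_right_mono[OF prob_le_1[of "E 0"] B0] by simp
    finally show ?thesis .
  qed
  have partial: "(\<Sum>t<T. measure M (E t)) \<le> B" for T
    using telescope[of T] aB a0[of T] by linarith
  have "(\<integral>\<^sup>+ \<omega>. (INF t\<in>{t. Z t \<omega> \<in> D}. of_nat t) \<partial>M) \<le> (\<integral>\<^sup>+ \<omega>. (\<Sum>t. indicator (E t) \<omega>) \<partial>M)"
  proof (rule nn_integral_mono)
    fix \<omega> assume w: "\<omega> \<in> space M"
    have "(\<lambda>t. if \<forall>i\<le>t. Z i \<omega> \<notin> D then 1 else 0) = (\<lambda>t. indicator (E t) \<omega> :: ennreal)"
      using w by (intro ext) (simp add: E_def indicator_def)
    then show "(INF t\<in>{t. Z t \<omega> \<in> D}. of_nat t) \<le> (\<Sum>t. indicator (E t) \<omega> :: ennreal)"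
      using INF_le_suminf_indicator[of "\<lambda>t. Z t \<omega> \<in> D"] by (simp only:)
  qed
  also have "\<dots> = (\<Sum>t. emeasure M (E t))"
    using setE by (subst nn_integral_suminf) auto
  also have "\<dots> \<le> ennreal B"
  proof (rule suminf_le_const)
    fix T
    have "(\<Sum>t<T. emeasure M (E t)) = ennreal (\<Sum>t<T. measure M (E t))"
      by (simp add: emeasure_eq_measure sum_ennreal)
    also have "\<dots> \<le> ennreal B" by (intro ennreal_leI partial)
    finally show "(\<Sum>t<T. emeasure M (E t)) \<le> ennreal B" .
  qed auto
  finally show ?thesis .
qed

section \<open>The coupling\<close>

lemma pmf_of_set_Times:
  assumes "finite A" "A \<noteq> {}" "finite B" "B \<noteq> {}"
  shows "pmf_of_set (A \<times> B) = pair_pmf (pmf_of_set A) (pmf_of_set B)"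
proof (rule pmf_eqI)
  fix p :: "'a \<times> 'b"
  show "pmf (pmf_of_set (A \<times> B)) p = pmf (pair_pmf (pmf_of_set A) (pmf_of_set B)) p"
    using assms by (cases p) (simp add: pmf_pair card_cartesian_product indicator_times)
qed

lemma expectation_map_pmf_of_set:
  fixes f :: "'z \<Rightarrow> real"
  assumes "finite W" "W \<noteq> {}"
  shows "measure_pmf.expectation (map_pmf (\<lambda>w. T w z) (pmf_of_set W)) f = average W T f z"
  using assms by (simp add: integral_pmf_of_set average_def)

lemma coupling_from_average:
  fixes f :: "'s \<times> 's \<Rightarrow> real"
  assumes fin: "finite S"
    and K: "\<And>z. z \<in> S \<times> S \<Longrightarrow> set_pmf (K z) \<subseteq> S \<times> S"
      "\<And>z. z \<in> S \<times> S \<Longrightarrow> map_pmf fst (K z) = P (fst z)" "\<And>z. z \<in> S \<times> S \<Longrightarrow> map_pmf snd (K z) = P (snd z)"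
    and f: "\<And>z. z \<in> S \<times> S \<Longrightarrow> 0 \<le> f z" "\<And>z. z \<in> S \<times> S \<Longrightarrow> f z \<le> B"
    and drift: "\<And>z. z \<in> S \<times> S \<Longrightarrow> fst z \<noteq> snd z \<Longrightarrow> 1 + measure_pmf.expectation (K z) f \<le> f z"
  shows "markov_coupling S P K"
    and "markov_chain M (S \<times> S) K (\<lambda>t \<omega>. (X t \<omega>, Y t \<omega>)) \<Longrightarrow> (\<integral>\<^sup>+ \<omega>. coalescence_time X Y \<omega> \<partial>M) \<le> ennreal B"
proof -
  have fin2: "finite (S \<times> S)" using fin by simp
  show "markov_coupling S P K"
    unfolding markov_coupling_def
  proof (intro conjI allI impI ballI)
    fix M :: "(nat \<Rightarrow> 's \<times> 's) measure" and X Y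
    assume mc: "markov_chain M (S \<times> S) K (\<lambda>t \<omega>. (X t \<omega>, Y t \<omega>))"
    show "markov_chain M S P X"
      using markov_chain_projection[OF mc fin2 _ K(1,2)] by simp
    show "markov_chain M S P Y"
      using markov_chain_projection[OF mc fin2 _ K(1,3)] by simp
  qed (rule K(1))
  show "(\<integral>\<^sup>+ \<omega>. coalescence_time X Y \<omega> \<partial>M) \<le> ennreal B" if mc: "markov_chain M (S \<times> S) K (\<lambda>t \<omega>. (X t \<omega>, Y t \<omega>))"
  proof -
    define D :: "('s \<times> 's) set" where "D = {z. fst z = snd z}"
    have "(\<integral>\<^sup>+ \<omega>. (INF t\<in>{t. (X t \<omega>, Y t \<omega>) \<in> D}. of_nat t) \<partial>M) \<le> ennreal B"
    proof (rule expected_hitting_time_le[OF mc fin2 f])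
      fix z assume z: "z \<in> S \<times> S - D"
      \<comment> \<open>The drift is given with the full expectation; as \<open>f\<close> is
        nonnegative, its part on the diagonal may be dropped.\<close>
      have "(\<Sum>z'\<in>S \<times> S - D. pmf (K z) z' * f z') \<le> (\<Sum>z'\<in>S \<times> S. pmf (K z) z' * f z')"
        using f(1) by (intro sum_mono2 fin2) auto
      also have "\<dots> = measure_pmf.expectation (K z) f"
      proof -
        have "measure_pmf.expectation (K z) f = (\<Sum>z'\<in>S \<times> S. f z' * pmf (K z) z')"
          by (rule integral_measure_pmf_real[OF fin2]) (use K(1)[of z] z in blast)
        then show ?thesis by (simp add: mult.commute)
      qed
      finally show "1 + (\<Sum>z'\<in>S \<times> S - D. pmf (K z) z' * f z') \<le> f z"
        using drift[of z] z by (auto simp: D_def)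
    qed
    then show ?thesis by (simp add: coalescence_time_def D_def)
  qed
qed

text \<open>At each pair the kernel uses the kind of move that attains the minimum in the limiting
  Bellman equation. Both kinds have the right marginals, and the equation itself is the drift
  condition for \<open>f\<close>.\<close>

lemma (in puzzle_pair) exists_coupling:
  assumes B: "\<And>k z. z \<in> S \<times> S \<Longrightarrow> meet_time k z \<le> B"
  shows "\<exists>K. markov_coupling S (puzzle_step n A) K \<and>
    (\<forall>(M :: 'w measure) X Y. markov_chain M (S \<times> S) K (\<lambda>t \<omega>. (X t \<omega>, Y t \<omega>)) \<longrightarrow>
      (\<integral>\<^sup>+ \<omega>. coalescence_time X Y \<omega> \<partial>M) \<le> ennreal B)"
proof -
  let ?avg1 = "average moves same_move" and ?avg2 = "average (moves \<times> moves) sep_move"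
  have ne: "moves \<noteq> {}" "moves \<times> moves \<noteq> {}" "finite (moves \<times> moves)" by (auto simp: moves_def)
  obtain f where f: "\<And>z. z \<in> S \<times> S \<Longrightarrow> 0 \<le> f z" "\<And>z. z \<in> S \<times> S \<Longrightarrow> f z \<le> B"
    "\<And>z. z \<in> S \<times> S \<Longrightarrow> z \<in> {z. fst z = snd z} \<Longrightarrow> f z = 0"
    "\<And>z. z \<in> S \<times> S \<Longrightarrow> z \<notin> {z. fst z = snd z} \<Longrightarrow> f z = 1 + min (?avg1 f z) (?avg2 f z)"
  proof (rule opt_time_limit[of moves "S \<times> S" same_move "moves \<times> moves" sep_move "{z. fst z = snd z}" B])
    show "opt_time moves same_move (moves \<times> moves) sep_move {z. fst z = snd z} k z \<le> B" if "z \<in> S \<times> S" for k z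
      using B[OF that] by (simp only: meet_time_def)
  next
    fix f
    assume "\<And>z. z \<in> S \<times> S \<Longrightarrow> 0 \<le> f z" "\<And>z. z \<in> S \<times> S \<Longrightarrow> f z \<le> B"
      "\<And>z. z \<in> S \<times> S \<Longrightarrow> z \<in> {z. fst z = snd z} \<Longrightarrow> f z = 0"
      "\<And>z. z \<in> S \<times> S \<Longrightarrow> z \<notin> {z. fst z = snd z} \<Longrightarrow> f z = 1 + min (?avg1 f z) (?avg2 f z)"
    then show thesis by (rule that)
  qed (erule same_move_in sep_move_in)+
  define K1 where "K1 z = map_pmf (\<lambda>v. same_move v z) (pmf_of_set moves)" for z
  define K2 where "K2 z = map_pmf (\<lambda>w. sep_move w z) (pmf_of_set (moves \<times> moves))" for z
  define K where "K z = (if ?avg1 f z \<le> ?avg2 f z then K1 z else K2 z)" for z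
  have step: "puzzle_step n A x = map_pmf (\<lambda>v. mv v x) (pmf_of_set moves)" for x
    by (simp add: puzzle_step_def)
  have K1: "map_pmf fst (K1 z) = puzzle_step n A (fst z)" "map_pmf snd (K1 z) = puzzle_step n A (snd z)" for z
    by (simp_all add: K1_def step map_pmf_comp same_move_def)
  have K2: "map_pmf fst (K2 z) = puzzle_step n A (fst z)" "map_pmf snd (K2 z) = puzzle_step n A (snd z)" for z
  proof -
    \<comment> \<open>Uniform on pairs means two independent uniform moves, which yields both
      marginals.\<close>
    have pair: "pmf_of_set (moves \<times> moves) = pair_pmf (pmf_of_set moves) (pmf_of_set moves)"
      using ne by (intro pmf_of_set_Times) auto
    have "map_pmf fst (K2 z) = map_pmf (\<lambda>v. mv v (fst z)) (map_pmf fst (pmf_of_set (moves \<times> moves)))"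
      "map_pmf snd (K2 z) = map_pmf (\<lambda>v. mv v (snd z)) (map_pmf snd (pmf_of_set (moves \<times> moves)))"
      by (simp_all add: K2_def map_pmf_comp sep_move_def)
    then show "map_pmf fst (K2 z) = puzzle_step n A (fst z)" "map_pmf snd (K2 z) = puzzle_step n A (snd z)"
      by (simp_all add: step pair map_fst_pair_pmf map_snd_pair_pmf)
  qed
  have KS: "set_pmf (K z) \<subseteq> S \<times> S" if "z \<in> S \<times> S" for z
  proof -
    have "set_pmf (K1 z) \<subseteq> S \<times> S" "set_pmf (K2 z) \<subseteq> S \<times> S"
      unfolding K1_def K2_def set_map_pmf
      by (rule image_subsetI, rule same_move_in[OF that]) (rule image_subsetI, rule sep_move_in[OF that])
    then show ?thesis by (simp add: K_def)
  qed
  have Kp: "map_pmf fst (K z) = puzzle_step n A (fst z)" "map_pmf snd (K z) = puzzle_step n A (snd z)" for z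
    by (simp_all add: K_def K1 K2)
  have drift: "1 + measure_pmf.expectation (K z) f \<le> f z" if "z \<in> S \<times> S" "fst z \<noteq> snd z" for z
  proof -
    have "measure_pmf.expectation (K z) f = min (?avg1 f z) (?avg2 f z)"
      using ne by (simp add: K_def K1_def K2_def expectation_map_pmf_of_set del: integral_map_pmf)
    then show ?thesis using f(4)[OF that(1)] that(2) by simp
  qed
  have "finite S" using finite_D by simp
  note coupling = coupling_from_average[of S K "puzzle_step n A" f B, OF this KS Kp f(1,2) drift]
  show ?thesis
  proof (intro exI[of _ K] conjI allI impI)
    show "markov_coupling S (puzzle_step n A) K" by (rule coupling(1))
    fix M :: "'w measure" and X Y
    assume "markov_chain M (S \<times> S) K (\<lambda>t \<omega>. (X t \<omega>, Y t \<omega>))"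
    then show "(\<integral>\<^sup>+ \<omega>. coalescence_time X Y \<omega> \<partial>M) \<le> ennreal B"
      by - (rule coupling(2); assumption)
  qed
qed

theorem theorem5:
  fixes d :: nat
  assumes "d \<ge> 1"
  shows "\<exists>C::real. \<forall>\<^sub>F n in sequentially. \<forall>D \<subseteq> {1..n\<^sup>2 - 1}. card D = d \<longrightarrow>
    (let S = puzzle_states n (insert 0 D); P = puzzle_step n (insert 0 D) in
      \<exists>K. markov_coupling S P K \<and>
        (\<forall>x\<in>S. \<forall>\<pi>. stationary_distribution S P \<pi> \<longrightarrow>
          (\<forall>(M :: (nat \<Rightarrow> (nat \<Rightarrow> int \<times> int) \<times> (nat \<Rightarrow> int \<times> int)) measure) X Y.
            markov_chain M (S \<times> S) K (\<lambda>t \<omega>. (X t \<omega>, Y t \<omega>)) \<longrightarrow>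
            (AE \<omega> in M. X 0 \<omega> = x) \<longrightarrow>
            distr M (count_space UNIV) (Y 0) = measure_pmf \<pi> \<longrightarrow>
            (\<integral>\<^sup>+ \<omega>. coalescence_time X Y \<omega> \<partial>M) \<le> ennreal (C * real n ^ 4 * ln (real n)))))"
proof -
  \<comment> \<open>With \<open>p\<close> below, these are \<open>gain_length\<close> and
    \<open>gain_prob ^ card D\<close> for \<open>card D = d\<close>; neither depends on
    \<open>n\<close>.\<close>
  define g :: nat where "g = 2 * d * (2 * d + 2) + 4"
  define p :: real where "p = ((1 / 25) ^ g) ^ d"
  \<comment> \<open>By \<open>1 + ln n \<le> 2 ln n\<close> the constants \<open>750\<close> and
    \<open>2 * 10 ^ 8\<close> double, and \<open>g\<close> is absorbed by
    \<open>1 \<le> n\<^sup>4 ln n\<close>.\<close>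
  define C where "C = (1500 + d * (4 * 10 ^ 8 + g)) / p"
  have p: "p > 0" by (simp add: p_def)
  show ?thesis
  proof (rule exI[of _ C], rule eventually_sequentiallyI[of "d + 3"], intro allI impI)
    fix n D assume n: "d + 3 \<le> n" and D: "D \<subseteq> {1..n\<^sup>2 - 1}" "card D = d"
    interpret puzzle_pair n D
      by unfold_locales (use n D finite_subset in auto)
    define L where "L = ln (real n)"
    \<comment> \<open>The condition \<open>d + 3 \<le> n\<close> gives \<open>n \<ge> 3\<close>,
      which exceeds the base of the logarithm.\<close>
    have "1 \<le> L"
    proof -
      have "exp 1 \<le> real n" using exp_le n by linarith
      then show ?thesis using n by (simp add: L_def ln_ge_iff)
    qed
    have n24: "(real n)\<^sup>2 \<le> real n ^ 4" "1 \<le> real n ^ 4"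
      using n by (auto intro!: power_increasing one_le_power)
    define N where "N = real n ^ 4 * L"
    have N: "1 \<le> N" unfolding N_def using mult_mono[OF n24(2) \<open>1 \<le> L\<close>] by simp
    have t1: "(1 + L) * (real n)\<^sup>2 \<le> 2 * N"
      unfolding N_def using mult_mono[of "1 + L" "2 * L" "(real n)\<^sup>2" "real n ^ 4"] \<open>1 \<le> L\<close> n24
      by (simp add: mult_ac)
    have t2: "(1 + L) * real n ^ 4 \<le> 2 * N"
      unfolding N_def using mult_right_mono[of "1 + L" "2 * L" "real n ^ 4"] \<open>1 \<le> L\<close> by (simp add: mult_ac)
    have "meet_time k z \<le> C * real n ^ 4 * ln (real n)" if "z \<in> S \<times> S" for k z
    proof -
      have gl: "gain_length = g" by (simp add: gain_length_def g_def D(2))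
      have "meet_time k z \<le> (750 * ((1 + L) * (real n)\<^sup>2) + d * (2 * 10 ^ 8 * ((1 + L) * real n ^ 4) + g)) / p"
        using meet_time_bound[OF that, of k]
        unfolding gain_prob_def gl D(2) p_def[symmetric] L_def[symmetric] mult.assoc .
      also have "\<dots> \<le> (750 * (2 * N) + d * (2 * 10 ^ 8 * (2 * N) + g * N)) / p"
        using t1 t2 N p mult_left_mono[OF N, of "real g"]
        by (intro divide_right_mono add_mono mult_left_mono) auto
      also have "\<dots> = C * N" by (simp add: C_def field_simps)
      finally show ?thesis by (simp only: N_def L_def mult.assoc)
    qed
    from exists_coupling[OF this]
    show "let S = puzzle_states n (insert 0 D); P = puzzle_step n (insert 0 D) in
      \<exists>K. markov_coupling S P K \<and>
        (\<forall>x\<in>S. \<forall>\<pi>. stationary_distribution S P \<pi> \<longrightarrow>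
          (\<forall>(M :: (nat \<Rightarrow> (nat \<Rightarrow> int \<times> int) \<times> (nat \<Rightarrow> int \<times> int)) measure) X Y.
            markov_chain M (S \<times> S) K (\<lambda>t \<omega>. (X t \<omega>, Y t \<omega>)) \<longrightarrow>
            (AE \<omega> in M. X 0 \<omega> = x) \<longrightarrow>
            distr M (count_space UNIV) (Y 0) = measure_pmf \<pi> \<longrightarrow>
            (\<integral>\<^sup>+ \<omega>. coalescence_time X Y \<omega> \<partial>M) \<le> ennreal (C * real n ^ 4 * ln (real n))))"
      unfolding Let_def by blast
  qed
qed

end
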